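(* Let $H$ be a hexagon, $\mathcal{MF}$ the space of equivalence classes of measured foliations of $H$, and $\mathcal{PMF}=\mathcal{MF}/\mathbb{R}_{>0}$. For each of the 14 arc triples $\partial=\{\partial_1,\partial_2,\partial_3\}$ of $H$, let $\mathcal{MF}_\partial\subset\mathcal{MF}$ be the set of classes of measured foliations in good position with respect to $\partial$, with coordinates $$I_\partial:\mathcal{MF}_\partial\to\mathbb{R}^3_{\geq 0}\setminus\{0\},\qquad F\mapsto\big(i(F,\partial_1),i(F,\partial_2),i(F,\partial_3)\big).$$ Then for any two arc triples $\partial,\partial'$ the coordinate change $I_{\partial'}\circ I_\partial^{-1}: I_\partial(\mathcal{MF}_\partial\cap\mathcal{MF}_{\partial'})\to I_{\partial'}(\mathcal{MF}_\partial\cap\mathcal{MF}_{\partial'})$ is piecewise-linear; the projectivized sets $\mathcal{PMF}_\partial$ with these coordinates make $\mathcal{PMF}$ a piecewise-linear manifold; and this manifold is homeomorphic to the $2$-sphere.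
   Context: The sides of the hexagon $H$ are denoted, in cyclic order, $a,C,b,A,c,B$ (so $a$ is opposite to $A$, $b$ to $B$, $c$ to $C$). Arcs. An arc in $H$ is the homeomorphic image of a closed interval whose interior is in the interior of $H$ and whose endpoints are on $\partial H$. Homotopies are relative to the boundary in the sense that each boundary edge is fixed setwise (endpoints of arcs may slide inside the edges containing them). There are nine homotopy classes of arcs joining two non-adjacent edges: for each side $s\in\{a,b,c,A,B,C\}$ the arc parallel to $s$, joining the two sides adjacent to $s$ and also denoted $s$; and $\alpha,\beta,\gamma$, joining $a$ to $A$, $b$ to $B$, $c$ to $C$ respectively. An arc triple is a triple of disjoint (pairwise non-homotopic) arcs each joining two non-adjacent edges, up to homotopy. The 14 arc triples are: $\{a,b,c\}$, $\{A,B,C\}$; $\{\alpha,b,c\}$, $\{a,\beta,c\}$, $\{a,b,\gamma\}$, $\{\alpha,B,C\}$, $\{A,\beta,C\}$, $\{A,B,\gamma\}$; $\{a,A,\beta\}$, $\{b,B,\alpha\}$, $\{c,C,\alpha\}$, $\{a,A,\gamma\}$, $\{b,B,\gamma\}$, $\{c,C,\beta\}$. Measured foliations. A measured foliation of $H$ is a foliation with isolated singularities having 3 separatrices (there are zero or one singularities), such that no leaf is homotopic to a point (in particular no leaf joins two adjacent edges), equipped with an invariant transverse measure. A measured foliation may also be represented by a partial foliation, supported on a subsurface of $H$; collapsing the non-foliated regions gives a measured foliation well defined up to equivalence. Foliations are considered up to homotopy, and $\mathcal{MF}$ is the set of equivalence classes. Equivalently, an element of $\mathcal{MF}$ is a nonempty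 finite family of pairwise disjoint, pairwise non-homotopic arcs each joining two non-adjacent edges of $H$ (up to homotopy), each with a positive weight: the weighted arcs record the homotopy classes of the bands of parallel nonsingular leaves and their transverse widths. The geometric intersection number $i(F,\delta)$ of $F$ with an arc $\delta$ is the infimum of the transverse $F$-measures of arcs homotopic to $\delta$. $\mathcal{MF}$ carries the topology for which $F\mapsto (i(F,a),i(F,b),i(F,c),i(F,A),i(F,B),i(F,C))\in\mathbb{R}^6_{\geq0}$ is an embedding. $\mathbb{R}_{>0}$ acts by scaling the transverse measure, $\mathcal{PMF}$ is the quotient, and $\mathcal{PMF}_\partial$ is the image of $\mathcal{MF}_\partial$ in $\mathcal{PMF}$. $F$ is in good position with respect to an arc triple $\{\partial_1,\partial_2,\partial_3\}$ if (1) $\sum_{j=1}^3 i(F,\partial_j)>0$ and (2) $F$ has no leaf parallel (homotopic) to one of $\partial_1,\partial_2,\partial_3$. *)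

theory Defs
  imports "HOL-Analysis.Analysis"
begin

section \<open>The hexagon\<close>

datatype side = Side_a | Side_C | Side_b | Side_A | Side_c | Side_B

lemma UNIV_side: "UNIV = {Side_a, Side_C, Side_b, Side_A, Side_c, Side_B}"
  using side.exhaust by blast

instance side :: finite
  by standard (simp add: UNIV_side)

fun next_side :: "side \<Rightarrow> side" where
  "next_side Side_a = Side_C"
| "next_side Side_C = Side_b"
| "next_side Side_b = Side_A"
| "next_side Side_A = Side_c"
| "next_side Side_c = Side_B"
| "next_side Side_B = Side_a"

fun prev_side :: "side \<Rightarrow> side" where
  "prev_side Side_a = Side_B"
| "prev_side Side_C = Side_a"
| "prev_side Side_b = Side_C"
| "prev_side Side_A = Side_b"
| "prev_side Side_c = Side_A"
| "prev_side Side_B = Side_c"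

fun side_pos :: "side \<Rightarrow> nat" where
  "side_pos Side_a = 0"
| "side_pos Side_C = 1"
| "side_pos Side_b = 2"
| "side_pos Side_A = 3"
| "side_pos Side_c = 4"
| "side_pos Side_B = 5"

definition nonadjacent :: "side \<Rightarrow> side \<Rightarrow> bool" where
  "nonadjacent s t \<longleftrightarrow> s \<noteq> t \<and> t \<noteq> next_side s \<and> s \<noteq> next_side t"

definition std_vertex :: "nat \<Rightarrow> complex" where
  "std_vertex k = cis (real k * pi / 3)"

definition std_hexagon :: "complex set" where
  "std_hexagon = convex hull (std_vertex ` {..<6})"

text \<open>A hexagon is a space \<open>h ` std_hexagon\<close> homeomorphic to a regular hexagon; its sides are
  the images of the sides of the regular hexagon under the marking \<open>h\<close>, which also provides
  their labels. Sides are taken without their endpoints: a vertex lies on two edges, so an arc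
  ending there would have no well-defined pair of edges.\<close>

definition hexagon :: "(complex \<Rightarrow> 'a::topological_space) \<Rightarrow> bool" where
  "hexagon h \<longleftrightarrow> (\<exists>k. homeomorphism std_hexagon (h ` std_hexagon) h k)"

definition hex_side :: "(complex \<Rightarrow> 'a::topological_space) \<Rightarrow> side \<Rightarrow> 'a set" where
  "hex_side h s = h ` open_segment (std_vertex (side_pos s)) (std_vertex (Suc (side_pos s)))"

section \<open>Arcs up to homotopy\<close>

definition arc_param ::
  "(complex \<Rightarrow> 'a::topological_space) \<Rightarrow> side \<Rightarrow> side \<Rightarrow> (real \<Rightarrow> 'a) \<Rightarrow> bool" where
  "arc_param h s t g \<longleftrightarrow> arc g \<and> g ` {0<..<1} \<subseteq> h ` interior std_hexagon \<and>
     g 0 \<in> hex_side h s \<and> g 1 \<in> hex_side h t"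

definition joins ::
  "(complex \<Rightarrow> 'a::topological_space) \<Rightarrow> side \<Rightarrow> side \<Rightarrow> 'a set \<Rightarrow> bool" where
  "joins h s t X \<longleftrightarrow> (\<exists>g. arc_param h s t g \<and> path_image g = X)"

definition essential_arc :: "(complex \<Rightarrow> 'a::topological_space) \<Rightarrow> 'a set \<Rightarrow> bool" where
  "essential_arc h X \<longleftrightarrow> (\<exists>s t. nonadjacent s t \<and> joins h s t X)"

text \<open>Arcs are unoriented point sets; a homotopy moves suitable parametrisations, keeping
  each endpoint inside its side.\<close>

definition arc_homotopic ::
  "(complex \<Rightarrow> 'a::topological_space) \<Rightarrow> 'a set \<Rightarrow> 'a set \<Rightarrow> bool" where
  "arc_homotopic h X Y \<longleftrightarrow> (\<exists>s t g g'.
     arc_param h s t g \<and> path_image g = X \<and> arc_param h s t g' \<and> path_image g' = Y \<and>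
     homotopic_with_canon (\<lambda>f. f 0 \<in> hex_side h s \<and> f 1 \<in> hex_side h t)
       {0..1} (h ` std_hexagon) g g')"

type_synonym 'a arc_class = "'a set set"

definition class_of_arc ::
  "(complex \<Rightarrow> 'a::topological_space) \<Rightarrow> 'a set \<Rightarrow> 'a arc_class" where
  "class_of_arc h X = {Y. arc_homotopic h X Y}"

definition arc_classes :: "(complex \<Rightarrow> 'a::topological_space) \<Rightarrow> 'a arc_class set" where
  "arc_classes h = class_of_arc h ` {X. essential_arc h X}"

text \<open>The class of the arc parallel to a side. The choice is immaterial: the hexagon being a
  disc, any two arcs joining the same pair of sides are homotopic.\<close>

definition side_arc :: "(complex \<Rightarrow> 'a::topological_space) \<Rightarrow> side \<Rightarrow> 'a arc_class" where
  "side_arc h s = class_of_arc h (SOME X. joins h (prev_side s) (next_side s) X)"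

definition disjoint_reps :: "'a arc_class set \<Rightarrow> ('a arc_class \<Rightarrow> 'a set) \<Rightarrow> bool" where
  "disjoint_reps S r \<longleftrightarrow> (\<forall>\<delta>\<in>S. r \<delta> \<in> \<delta>) \<and> pairwise (\<lambda>\<delta> \<epsilon>. disjnt (r \<delta>) (r \<epsilon>)) S"

text \<open>An arc triple with an enumeration of its members, which fixes the order of the
  coordinates.\<close>

definition arc_triple ::
  "(complex \<Rightarrow> 'a::topological_space) \<Rightarrow> (3 \<Rightarrow> 'a arc_class) \<Rightarrow> bool" where
  "arc_triple h d \<longleftrightarrow> range d \<subseteq> arc_classes h \<and> inj d \<and> (\<exists>r. disjoint_reps (range d) r)"

section \<open>Measured foliations\<close>

text \<open>A class of measured foliations is given by the positive transverse widths of its bands of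
  parallel leaves, as a function on the homotopy classes of arcs.\<close>

type_synonym 'a foliation = "'a arc_class \<Rightarrow> real"

definition leaf_classes :: "'a foliation \<Rightarrow> 'a arc_class set" where
  "leaf_classes F = {\<delta>. F \<delta> \<noteq> 0}"

definition MF :: "(complex \<Rightarrow> 'a::topological_space) \<Rightarrow> 'a foliation set" where
  "MF h = {F. (\<forall>\<delta>. F \<delta> \<ge> 0) \<and> finite (leaf_classes F) \<and> leaf_classes F \<noteq> {} \<and>
     leaf_classes F \<subseteq> arc_classes h \<and> (\<exists>r. disjoint_reps (leaf_classes F) r)}"

text \<open>The transverse measure of an arc \<open>X\<close> is its weighted number of crossings with the leaves.
  Arcs with infinitely many crossings have infinite measure; they have to be excluded
  explicitly because \<open>card\<close> vanishes on infinite sets.\<close>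

definition int_number :: "'a foliation \<Rightarrow> 'a arc_class \<Rightarrow> real" where
  "int_number F \<delta> = Inf {(\<Sum>\<epsilon>\<in>leaf_classes F. F \<epsilon> * real (card (r \<epsilon> \<inter> X))) | r X.
     disjoint_reps (leaf_classes F) r \<and> X \<in> \<delta> \<and> (\<forall>\<epsilon>\<in>leaf_classes F. finite (r \<epsilon> \<inter> X))}"

definition MF_topology ::
  "(complex \<Rightarrow> 'a::topological_space) \<Rightarrow> 'a foliation topology" where
  "MF_topology h = pullback_topology (MF h)
     (\<lambda>F. (\<chi> s. int_number F (side_arc h s)) :: real ^ side) euclidean"

definition ray :: "'a foliation \<Rightarrow> 'a foliation set" where
  "ray F = {(\<lambda>\<delta>. t * F \<delta>) | t. t > 0}"

definition PMF :: "(complex \<Rightarrow> 'a::topological_space) \<Rightarrow> 'a foliation set set" where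
  "PMF h = ray ` MF h"

definition PMF_topology ::
  "(complex \<Rightarrow> 'a::topological_space) \<Rightarrow> 'a foliation set topology" where
  "PMF_topology h =
     topology (\<lambda>U. U \<subseteq> PMF h \<and> openin (MF_topology h) {F \<in> MF h. ray F \<in> U})"

lemma openin_PMF_topology:
  "openin (PMF_topology h) U \<longleftrightarrow>
     U \<subseteq> PMF h \<and> openin (MF_topology h) {F \<in> MF h. ray F \<in> U}"
proof -
  have "istopology (\<lambda>U. U \<subseteq> PMF h \<and> openin (MF_topology h) {F \<in> MF h. ray F \<in> U})"
    unfolding istopology_def
  proof (intro conjI allI impI)
    fix S T
    assume S: "S \<subseteq> PMF h \<and> openin (MF_topology h) {F \<in> MF h. ray F \<in> S}"
      and T: "T \<subseteq> PMF h \<and> openin (MF_topology h) {F \<in> MF h. ray F \<in> T}"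
    have eq: "{F \<in> MF h. ray F \<in> S \<inter> T} = {F \<in> MF h. ray F \<in> S} \<inter> {F \<in> MF h. ray F \<in> T}"
      by auto
    show "S \<inter> T \<subseteq> PMF h" using S by auto
    show "openin (MF_topology h) {F \<in> MF h. ray F \<in> S \<inter> T}"
      unfolding eq using S T by (intro openin_Int) auto
  next
    fix K
    assume K: "\<forall>S\<in>K. S \<subseteq> PMF h \<and> openin (MF_topology h) {F \<in> MF h. ray F \<in> S}"
    have eq: "{F \<in> MF h. ray F \<in> \<Union>K} = (\<Union>S\<in>K. {F \<in> MF h. ray F \<in> S})"
      by auto
    show "\<Union>K \<subseteq> PMF h" using K by auto
    show "openin (MF_topology h) {F \<in> MF h. ray F \<in> \<Union>K}"
      unfolding eq using K by auto
  qed
  then show ?thesis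
    unfolding PMF_topology_def by (simp add: topology_inverse')
qed

section \<open>Good position and coordinates\<close>

definition coords :: "(3 \<Rightarrow> 'a arc_class) \<Rightarrow> 'a foliation \<Rightarrow> real ^ 3" where
  "coords d F = (\<chi> j. int_number F (d j))"

definition MF_good ::
  "(complex \<Rightarrow> 'a::topological_space) \<Rightarrow> (3 \<Rightarrow> 'a arc_class) \<Rightarrow> 'a foliation set" where
  "MF_good h d = {F \<in> MF h. (\<Sum>j\<in>UNIV. int_number F (d j)) > 0 \<and> (\<forall>j. d j \<notin> leaf_classes F)}"

definition PMF_good ::
  "(complex \<Rightarrow> 'a::topological_space) \<Rightarrow> (3 \<Rightarrow> 'a arc_class) \<Rightarrow> 'a foliation set set" where
  "PMF_good h d = ray ` MF_good h d"

text \<open>The coordinates of a projective class are homogeneous. They are normalised by evaluating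
  them on the representative with \<open>i(F,a) + i(F,b) + i(F,c) + i(F,A) + i(F,B) + i(F,C) = 1\<close>. This
  normalisation does not depend on the arc triple; dividing the three coordinates of each triple
  by their own sum would make the coordinate changes piecewise projective rather than
  piecewise linear.\<close>

definition normalized_rep ::
  "(complex \<Rightarrow> 'a::topological_space) \<Rightarrow> 'a foliation set \<Rightarrow> 'a foliation" where
  "normalized_rep h p = (THE F. F \<in> p \<and> (\<Sum>s\<in>UNIV. int_number F (side_arc h s)) = 1)"

definition proj_coords ::
  "(complex \<Rightarrow> 'a::topological_space) \<Rightarrow> (3 \<Rightarrow> 'a arc_class) \<Rightarrow> 'a foliation set \<Rightarrow> real ^ 3" where
  "proj_coords h d p = coords d (normalized_rep h p)"

section \<open>Piecewise-linear maps and manifolds\<close>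

definition polyhedral :: "'b::euclidean_space set \<Rightarrow> bool" where
  "polyhedral S \<longleftrightarrow> (\<exists>\<P>. finite \<P> \<and> (\<forall>P\<in>\<P>. polyhedron P) \<and> S = \<Union>\<P>)"

definition piecewise_linear_on ::
  "'b::euclidean_space set \<Rightarrow> ('b \<Rightarrow> 'c::euclidean_space) \<Rightarrow> bool" where
  "piecewise_linear_on S f \<longleftrightarrow> (\<exists>\<P>. finite \<P> \<and> (\<forall>P\<in>\<P>. polyhedron P) \<and> S \<subseteq> \<Union>\<P> \<and>
     (\<forall>P\<in>\<P>. \<exists>A v. linear A \<and> (\<forall>x\<in>S \<inter> P. f x = A x + v)))"

definition pl_homeomorphism ::
  "'b::euclidean_space set \<Rightarrow> 'c::euclidean_space set \<Rightarrow> ('b \<Rightarrow> 'c) \<Rightarrow> bool" where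
  "pl_homeomorphism S T f \<longleftrightarrow> bij_betw f S T \<and> piecewise_linear_on S f \<and>
     piecewise_linear_on T (inv_into S f)"

text \<open>Charts in the sense of Hudson and of Rourke and Sanderson: they have polyhedral images,
  their domains need not be open but have interiors covering the space, and every point has a
  neighbourhood that is identified, piecewise linearly in some chart, with an open subset of the
  model space \<open>'d\<close>.\<close>

definition pl_manifold_atlas ::
  "'d::euclidean_space itself \<Rightarrow> 'x topology \<Rightarrow> ('x set \<times> ('x \<Rightarrow> 'e::euclidean_space)) set \<Rightarrow> bool"
  where
  "pl_manifold_atlas _ X \<A> \<longleftrightarrow>
     Hausdorff_space X \<and> second_countable X \<and>
     (\<forall>(U, \<phi>)\<in>\<A>. U \<subseteq> topspace X \<and> polyhedral (\<phi> ` U) \<and>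
        homeomorphic_map (subtopology X U) (top_of_set (\<phi> ` U)) \<phi>) \<and>
     (\<forall>(U, \<phi>)\<in>\<A>. \<forall>(V, \<psi>)\<in>\<A>. polyhedral (\<phi> ` (U \<inter> V)) \<and>
        piecewise_linear_on (\<phi> ` (U \<inter> V)) (\<psi> \<circ> inv_into U \<phi>)) \<and>
     (\<forall>x\<in>topspace X. \<exists>(U, \<phi>)\<in>\<A>. \<exists>W. openin X W \<and> x \<in> W \<and> W \<subseteq> U \<and>
        (\<exists>(g :: 'e \<Rightarrow> 'd) T. open T \<and> pl_homeomorphism (\<phi> ` W) T g))"

end

theory Submission
  imports Defs
begin

text \<open>A family of weighted arcs is a vector of nine weights, one for each class of arcs. Two classes are
  linked if their endpoints alternate around the boundary. Linked arcs always cross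
  (\<open>linked_arcs_meet\<close>, a consequence of the Fashoda theorem), while straight chords between suitably
  chosen points of the sides realise all classes at once, with one crossing for each linked pair and
  none for the others (\<open>chord_table\<close>). Hence measured foliations are the nonzero nonnegative weight
  vectors without linked pairs in the support (\<open>MF_eq\<close>), and the intersection number with an arc is
  the sum of the weights of the chords linked with it (\<open>int_number_foliation_of\<close>). The weight vectors
  form a fan of simplicial cones on which all intersection numbers are linear functions.

  For an arc triple, the cones avoiding its members are mapped injectively by the three intersection
  numbers. There are three patterns of triples up to symmetry, and in each of them the weights are
  recovered by explicit formulas with minima and maxima (\<open>good_weights_inj\<close>). An injective linear map
  on a polyhedron has an affine inverse there, which makes every coordinate change piecewise linear
  and the images polyhedral (\<open>piecewise_linear_transition\<close>).

  Subtracting the weights of \<open>a\<close>, \<open>b\<close>, \<open>c\<close> from the intersection numbers with \<open>a\<close>, \<open>b\<close>, \<open>c\<close> maps the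
  whole fan homeomorphically onto three-dimensional space, ray by ray (\<open>to_space\<close>, \<open>from_space\<close>). The
  projective classes therefore form a sphere (\<open>slice_sphere\<close>, \<open>homeomorphic_proj_class\<close>). Around a
  foliation containing the chord \<open>v\<close>, the triple of arcs all crossing \<open>v\<close> (\<open>opposite_triple\<close>) gives a
  chart in which \<open>v\<close> is the diagonal direction; projecting along the diagonal flattens the open star
  of \<open>v\<close> onto an open set of the plane (\<open>local_chart\<close>).\<close>

section \<open>The regular hexagon in affine coordinates\<close>

text \<open>In the basis formed by the vertices 0 and 2 all six vertices have coordinates in \<open>{-1, 0, 1}\<close>,
  so incidences become integer computations.\<close>

definition hx :: "complex \<Rightarrow> real" where "hx z = Re z + Im z / sqrt 3"
definition hy :: "complex \<Rightarrow> real" where "hy z = 2 * Im z / sqrt 3"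
definition hpt :: "real \<Rightarrow> real \<Rightarrow> complex" where "hpt x y = Complex (x - y / 2) (y * sqrt 3 / 2)"

lemma hx_hpt [simp]: "hx (hpt x y) = x" and hy_hpt [simp]: "hy (hpt x y) = y"
  by (simp_all add: hx_def hy_def hpt_def)

lemma hpt_hx_hy [simp]: "hpt (hx z) (hy z) = z"
  by (simp add: hx_def hy_def hpt_def complex_eq_iff field_simps)

lemma hex_coords_eqI: "hx z = hx w \<Longrightarrow> hy z = hy w \<Longrightarrow> z = w"
  by (metis hpt_hx_hy)

lemma linear_hx: "linear hx" and linear_hy: "linear hy"
  by (auto simp: linear_iff hx_def hy_def field_simps)

lemmas hx_hy_simps [simp] =
  linear_add[OF linear_hx] linear_diff[OF linear_hx] linear_cmul[OF linear_hx]
  linear_add[OF linear_hy] linear_diff[OF linear_hy] linear_cmul[OF linear_hy]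

lemma continuous_hx [continuous_intros]: "continuous_on S f \<Longrightarrow> continuous_on S (\<lambda>x. hx (f x))"
  unfolding hx_def by (intro continuous_intros) auto

lemma continuous_hy [continuous_intros]: "continuous_on S f \<Longrightarrow> continuous_on S (\<lambda>x. hy (f x))"
  unfolding hy_def by (intro continuous_intros) auto

lemma hpt_mult: "hpt x y * hpt 1 1 = hpt (x - y) x"
  by (simp add: hpt_def complex_eq_iff field_simps)

lemma std_vertex_Suc: "std_vertex (Suc k) = std_vertex k * hpt 1 1"
proof -
  have "cis (pi / 3) = hpt 1 1"
    by (simp add: hpt_def complex_eq_iff cos_60 sin_60)
  then show ?thesis
    by (simp add: std_vertex_def add_divide_distrib distrib_right flip: cis_mult)
qed

lemma std_vertex_0: "std_vertex 0 = hpt 1 0"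
  by (simp add: std_vertex_def hpt_def complex_eq_iff)

lemma std_vertex_hpt [simp]:
  "std_vertex 0 = hpt 1 0" "std_vertex (Suc 0) = hpt 1 1" "std_vertex 1 = hpt 1 1"
  "std_vertex 2 = hpt 0 1" "std_vertex 3 = hpt (-1) 0" "std_vertex 4 = hpt (-1) (-1)"
  "std_vertex 5 = hpt 0 (-1)" "std_vertex 6 = hpt 1 0"
  by (simp_all add: std_vertex_Suc std_vertex_0 hpt_mult numeral_eq_Suc)

text \<open>The outward functional of a side, scaled to equal 1 on the line through that side.\<close>

fun edge_fun :: "side \<Rightarrow> complex \<Rightarrow> real" where
  "edge_fun Side_a z = hx z"
| "edge_fun Side_C z = hy z"
| "edge_fun Side_b z = hy z - hx z"
| "edge_fun Side_A z = - hx z"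
| "edge_fun Side_c z = - hy z"
| "edge_fun Side_B z = hx z - hy z"

lemma edge_fun_convex:
  "edge_fun s ((1 - u) *\<^sub>R z + u *\<^sub>R w) = (1 - u) * edge_fun s z + u * edge_fun s w"
  by (cases s) (simp_all add: algebra_simps)

lemma all_side: "(\<forall>s. P s) \<longleftrightarrow> P Side_a \<and> P Side_C \<and> P Side_b \<and> P Side_A \<and> P Side_c \<and> P Side_B"
  by (metis side.exhaust)

lemma lessThan_6: "{..<6::nat} = {0, 1, 2, 3, 4, 5}"
  by auto

lemma std_vertex_in: "k < 6 \<Longrightarrow> std_vertex k \<in> std_hexagon"
  unfolding std_hexagon_def by (auto intro: hull_inc)

lemma convex_std_hexagon: "convex std_hexagon"
  by (simp add: std_hexagon_def)

lemma std_hexagon_iff: "z \<in> std_hexagon \<longleftrightarrow> (\<forall>s. edge_fun s z \<le> 1)"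
proof
  have conv: "convex {z. \<forall>s. edge_fun s z \<le> 1}"
    unfolding convex_alt
  proof safe
    fix z w :: complex and u :: real and s
    assume "\<forall>s. edge_fun s z \<le> 1" "\<forall>s. edge_fun s w \<le> 1" "0 \<le> u" "u \<le> 1"
    then show "edge_fun s ((1 - u) *\<^sub>R z + u *\<^sub>R w) \<le> 1"
      unfolding edge_fun_convex by (intro convex_bound_le) auto
  qed
  have "std_hexagon \<subseteq> {z. \<forall>s. edge_fun s z \<le> 1}"
    unfolding std_hexagon_def
    by (rule hull_minimal) (use conv in \<open>auto simp: lessThan_6 all_side\<close>)
  then show "z \<in> std_hexagon \<Longrightarrow> \<forall>s. edge_fun s z \<le> 1" by auto
next
  assume z: "\<forall>s. edge_fun s z \<le> 1"
  define x y where "x = hx z" and "y = hy z"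
  have b: "x \<le> 1" "y \<le> 1" "y - x \<le> 1" "-x \<le> 1" "-y \<le> 1" "x - y \<le> 1"
    using z by (auto simp: all_side x_def y_def)
  have "std_vertex 0 \<in> std_hexagon" "std_vertex 3 \<in> std_hexagon"
    by (rule std_vertex_in; simp)+
  then have "(1/2) *\<^sub>R std_vertex 0 + (1/2) *\<^sub>R std_vertex 3 \<in> std_hexagon"
    by (intro convexD[OF convex_std_hexagon]) auto
  moreover have "(1/2) *\<^sub>R std_vertex 0 + (1/2) *\<^sub>R std_vertex 3 = (0::complex)"
    by (rule hex_coords_eqI) (auto simp: hx_def hy_def hpt_def)
  ultimately have zero: "0 \<in> std_hexagon" by simp
  \<comment> \<open>every sextant is spanned by two consecutive vertices\<close>
  have *: "z \<in> std_hexagon"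
    if "p \<in> std_hexagon" "q \<in> std_hexagon" "0 \<le> s" "0 \<le> t" "s + t \<le> 1"
      "x = s * hx p + t * hx q" "y = s * hy p + t * hy q" for p q s t
  proof -
    have "convex hull {0, p, q} \<subseteq> std_hexagon"
      using that zero by (intro hull_minimal convex_std_hexagon) auto
    moreover have "z = s *\<^sub>R p + t *\<^sub>R q"
      by (rule hex_coords_eqI) (use that in \<open>simp_all add: x_def y_def\<close>)
    moreover have "s *\<^sub>R p + t *\<^sub>R q \<in> convex hull {0, p, q}"
      unfolding convex_hull_3 using that
      by (intro CollectI exI[of _ "1 - s - t"] exI[of _ s] exI[of _ t]) auto
    ultimately show ?thesis by auto
  qed
  have v: "std_vertex k \<in> std_hexagon" if "k \<in> {0,1,2,3,4,5}" for k
    by (rule std_vertex_in) (use that in auto)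
  consider "x \<ge> y" "y \<ge> 0" | "y \<ge> x" "x \<ge> 0" | "x \<le> 0" "y \<ge> 0" | "y \<ge> x" "y \<le> 0" | "x \<le> 0" "x \<ge> y" | "x \<ge> 0" "y \<le> 0"
    by linarith
  then show "z \<in> std_hexagon"
  proof cases
    case 1 then show ?thesis using b
      by (intro *[OF v[of 0] v[of 1], of "x - y" y]) auto
  next
    case 2 then show ?thesis using b
      by (intro *[OF v[of 1] v[of 2], of x "y - x"]) auto
  next
    case 3 then show ?thesis using b
      by (intro *[OF v[of 2] v[of 3], of y "-x"]) auto
  next
    case 4 then show ?thesis using b
      by (intro *[OF v[of 3] v[of 4], of "y - x" "-y"]) auto
  next
    case 5 then show ?thesis using b
      by (intro *[OF v[of 4] v[of 5], of "-x" "x - y"]) auto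
  next
    case 6 then show ?thesis using b
      by (intro *[OF v[of 5] v[of 0], of "-y" x]) auto
  qed
qed

lemma continuous_edge_fun [continuous_intros]:
  "continuous_on S f \<Longrightarrow> continuous_on S (\<lambda>x. edge_fun s (f x))"
  by (cases s) (auto intro!: continuous_intros)

lemma interior_std_hexagon_iff: "z \<in> interior std_hexagon \<longleftrightarrow> (\<forall>s. edge_fun s z < 1)"
proof
  assume z: "z \<in> interior std_hexagon"
  then obtain e where e: "e > 0" "ball z e \<subseteq> std_hexagon"
    by (meson mem_interior)
  \<comment> \<open>a point slightly further out in the direction of the vertex of a side would leave the hexagon\<close>
  have out: "edge_fun s z < 1" if "edge_fun s c = 1" for s and c :: complex
  proof -
    have "c \<noteq> 0" using that by (cases s) (auto simp: hx_def hy_def)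
    define t where "t = e / (2 * norm c)"
    have t: "t > 0" using e \<open>c \<noteq> 0\<close> by (simp add: t_def)
    have "dist z (z + t *\<^sub>R c) < e"
      using e \<open>c \<noteq> 0\<close> by (simp add: dist_norm t_def)
    then have "z + t *\<^sub>R c \<in> std_hexagon" using e by auto
    then have "edge_fun s (z + t *\<^sub>R c) \<le> 1" by (simp add: std_hexagon_iff)
    moreover have "edge_fun s (z + t *\<^sub>R c) = edge_fun s z + t * edge_fun s c"
      by (cases s) (simp_all add: algebra_simps)
    ultimately show ?thesis using t that by simp
  qed
  show "\<forall>s. edge_fun s z < 1"
  proof
    fix s
    show "edge_fun s z < 1"
      by (rule out[of s "std_vertex (side_pos s)"]) (cases s; simp)
  qed
next
  assume z: "\<forall>s. edge_fun s z < 1"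
  have "open (\<Inter>s. {z. edge_fun s z < 1})"
    by (intro open_INT ballI open_Collect_less) (auto intro!: continuous_intros)
  moreover have "(\<Inter>s. {z. edge_fun s z < 1}) \<subseteq> std_hexagon"
    by (auto simp: std_hexagon_iff less_imp_le)
  ultimately show "z \<in> interior std_hexagon"
    using z by (intro interiorI[of "\<Inter>s. {z. edge_fun s z < 1}"]) auto
qed

definition hex_edge :: "side \<Rightarrow> complex set" where
  "hex_edge s = open_segment (std_vertex (side_pos s)) (std_vertex (Suc (side_pos s)))"

lemma hex_side_eq: "hex_side h s = h ` hex_edge s"
  by (simp add: hex_side_def hex_edge_def)

lemma hex_edge_param:
  "z \<in> hex_edge s \<longleftrightarrow> (\<exists>u. 0 < u \<and> u < 1 \<and>
     z = (1 - u) *\<^sub>R std_vertex (side_pos s) + u *\<^sub>R std_vertex (Suc (side_pos s)))"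
proof -
  have "std_vertex (side_pos s) \<noteq> std_vertex (Suc (side_pos s))"
  proof
    assume *: "std_vertex (side_pos s) = std_vertex (Suc (side_pos s))"
    show False
      using arg_cong[OF *, of hx] arg_cong[OF *, of hy]
      by (cases s) (simp_all flip: numeral_2_eq_2 numeral_3_eq_3 add: eval_nat_numeral(3)[symmetric])
  qed
  then show ?thesis unfolding hex_edge_def in_segment by auto
qed

lemma Suc_side_pos [simp]:
  "std_vertex (Suc (Suc 0)) = hpt 0 1" "std_vertex (Suc 2) = hpt (-1) 0"
  "std_vertex (Suc 3) = hpt (-1) (-1)" "std_vertex (Suc 4) = hpt 0 (-1)"
  "std_vertex (Suc 5) = hpt 1 0"
  using std_vertex_hpt by (simp_all add: eval_nat_numeral del: std_vertex_hpt)

lemma hex_edge_edge_fun: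
  assumes "z \<in> hex_edge s"
  shows "edge_fun s z = 1" "t \<noteq> s \<Longrightarrow> edge_fun t z < 1"
proof -
  obtain u where u: "0 < u" "u < 1"
    "z = (1 - u) *\<^sub>R std_vertex (side_pos s) + u *\<^sub>R std_vertex (Suc (side_pos s))"
    using assms by (auto simp: hex_edge_param)
  show "edge_fun s z = 1" "t \<noteq> s \<Longrightarrow> edge_fun t z < 1"
    using u(1,2) unfolding u(3) by (cases s; cases t; simp add: algebra_simps)+
qed

lemma hex_edge_disjoint: "z \<in> hex_edge s \<Longrightarrow> z \<in> hex_edge t \<Longrightarrow> s = t"
  using hex_edge_edge_fun by force

lemma hex_edge_subset: "hex_edge s \<subseteq> std_hexagon"
  by (metis hex_edge_edge_fun less_imp_le order_refl std_hexagon_iff subsetI)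

lemma hex_edge_not_interior: "z \<in> hex_edge s \<Longrightarrow> z \<notin> interior std_hexagon"
  by (metis hex_edge_edge_fun(1) interior_std_hexagon_iff less_irrefl)

lemma convex_hex_edge: "convex (hex_edge s)"
  by (simp add: hex_edge_def)

text \<open>Each side functional is at most 1 at both endpoints and below 1 at one of them, because the
  endpoints lie on different open sides.\<close>

lemma chord_interior:
  assumes "p \<in> hex_edge s" "q \<in> hex_edge t" "s \<noteq> t" "0 < u" "u < 1"
  shows "(1 - u) *\<^sub>R p + u *\<^sub>R q \<in> interior std_hexagon"
  unfolding interior_std_hexagon_iff edge_fun_convex
proof
  fix k
  have "edge_fun k p \<le> 1" "edge_fun k q \<le> 1" "edge_fun k p < 1 \<or> edge_fun k q < 1"
    by (metis assms(1-3) hex_edge_edge_fun less_imp_le order_refl)+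
  then consider "edge_fun k p < 1" "edge_fun k q \<le> 1" | "edge_fun k p \<le> 1" "edge_fun k q < 1" by auto
  then show "(1 - u) * edge_fun k p + u * edge_fun k q < 1"
  proof cases
    case 1
    have "(1 - u) * edge_fun k p < (1 - u) * 1" using 1 assms by (intro mult_strict_left_mono) auto
    moreover have "u * edge_fun k q \<le> u * 1" using 1 assms by (intro mult_left_mono) auto
    ultimately show ?thesis by simp
  next
    case 2
    have "(1 - u) * edge_fun k p \<le> (1 - u) * 1" using 2 assms by (intro mult_left_mono) auto
    moreover have "u * edge_fun k q < u * 1" using 2 assms by (intro mult_strict_left_mono) auto
    ultimately show ?thesis by simp
  qed
qed

section \<open>Orientation\<close>

text \<open>Twice the signed area of a triangle, in the affine coordinates.\<close>

definition orient :: "complex \<Rightarrow> complex \<Rightarrow> complex \<Rightarrow> real" where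
  "orient p q r = (hx q - hx p) * (hy r - hy p) - (hy q - hy p) * (hx r - hx p)"

lemma orient_rotate: "orient p q r = orient q r p"
  by (simp add: orient_def algebra_simps)

lemma orient_swap: "orient p q r = - orient q p r"
  by (simp add: orient_def algebra_simps)

lemma orient_self [simp]: "orient p q p = 0" "orient p q q = 0" "orient p p q = 0"
  by (simp_all add: orient_def)

lemma orient_convex:
  "orient p q ((1 - u) *\<^sub>R a + u *\<^sub>R b) = (1 - u) * orient p q a + u * orient p q b"
  by (simp add: orient_def algebra_simps)

definition vertex_xs :: "int list" where "vertex_xs = [1, 1, 0, -1, -1, 0, 1]"
definition vertex_ys :: "int list" where "vertex_ys = [0, 1, 1, 0, -1, -1, 0]"

lemma orient_vertices:
  assumes "i \<le> 6" "j \<le> 6" "k \<le> 6"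
  shows "orient (std_vertex i) (std_vertex j) (std_vertex k) = of_int
    ((vertex_xs ! j - vertex_xs ! i) * (vertex_ys ! k - vertex_ys ! i) -
     (vertex_ys ! j - vertex_ys ! i) * (vertex_xs ! k - vertex_xs ! i))"
proof -
  have "hx (std_vertex n) = of_int (vertex_xs ! n) \<and> hy (std_vertex n) = of_int (vertex_ys ! n)"
    if "n \<le> 6" for n
  proof -
    have "n \<in> {0, 1, 2, 3, 4, 5, 6}" using that by auto
    then show ?thesis by (elim insertE emptyE; simp add: vertex_xs_def vertex_ys_def)
  qed
  then show ?thesis using assms by (simp add: orient_def)
qed

lemma vertex_table:
  "\<forall>i\<in>set [0..<7]. \<forall>j\<in>set [i..<7]. \<forall>k\<in>set [j..<7].
    let d = (vertex_xs ! j - vertex_xs ! i) * (vertex_ys ! k - vertex_ys ! i) -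
      (vertex_ys ! j - vertex_ys ! i) * (vertex_xs ! k - vertex_xs ! i)
    in 0 \<le> d \<and> (i < j \<longrightarrow> j < k \<longrightarrow> k < 6 \<longrightarrow> 0 < d)"
  by code_simp

lemma orient_vertices_nonneg:
  assumes "i \<le> j" "j \<le> k" "k \<le> 6"
  shows "0 \<le> orient (std_vertex i) (std_vertex j) (std_vertex k)"
  using assms vertex_table[rule_format, of i j k]
  by (subst orient_vertices) (auto simp: Let_def simp del: of_int_diff of_int_mult)

lemma orient_vertices_pos:
  assumes "i < j" "j < k" "k < 6"
  shows "0 < orient (std_vertex i) (std_vertex j) (std_vertex k)"
  using assms vertex_table[rule_format, of i j k]
  by (subst orient_vertices) (auto simp: Let_def simp del: of_int_diff of_int_mult)

text \<open>The orientation is affine in each argument, so its sign for points on three sides follows from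
  its values on vertices, where it is a finite table. The listing of vertices runs to index 6, which
  repeats vertex 0, so that the end of the last side needs no wrap-around.\<close>

lemma orient_edges_pos:
  assumes "p \<in> hex_edge s" "q \<in> hex_edge t" "r \<in> hex_edge k"
    and lt: "side_pos s < side_pos t" "side_pos t < side_pos k"
  shows "0 < orient p q r"
proof -
  have k6: "side_pos k < 6" by (cases k) auto
  let ?i = "side_pos s" and ?j = "side_pos t" and ?k = "side_pos k"
  obtain u v w where u: "0 < u" "u < 1" "p = (1 - u) *\<^sub>R std_vertex ?i + u *\<^sub>R std_vertex (Suc ?i)"
    and v: "0 < v" "v < 1" "q = (1 - v) *\<^sub>R std_vertex ?j + v *\<^sub>R std_vertex (Suc ?j)"
    and w: "0 < w" "w < 1" "r = (1 - w) *\<^sub>R std_vertex ?k + w *\<^sub>R std_vertex (Suc ?k)"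
    using assms(1-3) unfolding hex_edge_param by metis
  have 1: "0 \<le> orient (std_vertex a) (std_vertex b) r"
    if "a \<le> b" "b \<le> ?k" for a b
    unfolding w(3) orient_convex using w that k6
    by (intro add_nonneg_nonneg mult_nonneg_nonneg orient_vertices_nonneg) auto
  have 2: "0 < orient (std_vertex ?i) (std_vertex ?j) r"
    unfolding w(3) orient_convex using w lt k6
    by (intro add_pos_nonneg mult_nonneg_nonneg mult_pos_pos orient_vertices_nonneg orient_vertices_pos) auto
  have q: "orient a q r = (1 - v) * orient a (std_vertex ?j) r + v * orient a (std_vertex (Suc ?j)) r" for a
    unfolding v(3) orient_rotate[of a _ r] orient_rotate[of _ r a] using orient_convex orient_rotate by metis
  have p: "orient p q r = (1 - u) * orient (std_vertex ?i) q r + u * orient (std_vertex (Suc ?i)) q r"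
    unfolding u(3) using orient_convex orient_rotate by metis
  have 3: "0 < orient (std_vertex ?i) q r"
    unfolding q using v 2 1[of ?i "Suc ?j"] lt
    by (intro add_pos_nonneg mult_nonneg_nonneg mult_pos_pos) auto
  have 4: "0 \<le> orient (std_vertex (Suc ?i)) q r"
    unfolding q using v 1[of "Suc ?i" "?j"] 1[of "Suc ?i" "Suc ?j"] lt
    by (intro add_nonneg_nonneg mult_nonneg_nonneg) auto
  show ?thesis
    unfolding p using u 3 4 by (intro add_pos_nonneg mult_nonneg_nonneg mult_pos_pos) auto
qed

section \<open>Interlacing arcs cross\<close>

text \<open>Fashoda theorem for paths between points on the coordinate axes. The paths are prolonged along
  the axes to the boundary of a large square; the hypotheses on axis points keep the prolongations
  from creating crossings of their own.\<close>

lemma axis_paths_meet: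
  fixes f g :: "real \<Rightarrow> real^2"
  assumes f: "path f" "pathstart f = vector [-a, 0]" "pathfinish f = vector [b, 0]"
    and g: "path g" "pathstart g = vector [0, -c]" "pathfinish g = vector [0, d]"
    and pos: "0 < a" "0 < b" "0 < c" "0 < d"
    and hor: "\<And>x. vector [x, 0] \<in> path_image g \<Longrightarrow> - a \<le> x \<and> x \<le> b"
    and ver: "\<And>y. vector [0, y] \<in> path_image f \<Longrightarrow> - c \<le> y \<and> y \<le> d"
  shows "path_image f \<inter> path_image g \<noteq> {}"
proof -
  have "bounded (path_image f \<union> path_image g)"
    using f g by (simp add: bounded_path_image)
  then obtain M where M: "M > 0" "\<And>z. z \<in> path_image f \<union> path_image g \<Longrightarrow> norm z \<le> M"
    by (meson bounded_pos)
  have comp: "- M \<le> z $ i \<and> z $ i \<le> M" if "z \<in> path_image f \<union> path_image g" for z i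
    using M(2)[OF that] component_le_norm_cart[of z i] by linarith
  have abcd: "a \<le> M" "b \<le> M" "c \<le> M" "d \<le> M"
    using comp[OF UnI1[OF pathstart_in_path_image], of 1] comp[OF UnI1[OF pathfinish_in_path_image], of 1]
      comp[OF UnI2[OF pathstart_in_path_image], of 2] comp[OF UnI2[OF pathfinish_in_path_image], of 2]
    unfolding f(2,3) g(2,3) by auto
  define F where "F = linepath (vector [-M, 0]) (vector [-a, 0]) +++ f +++ linepath (vector [b, 0]) (vector [M, 0])"
  define G where "G = linepath (vector [0, -M]) (vector [0, -c]) +++ g +++ linepath (vector [0, d]) (vector [0, M])"
  have seg1: "z \<in> closed_segment (vector [x, 0]) (vector [x', 0]) \<longleftrightarrow> z $ 2 = 0 \<and> z $ 1 \<in> closed_segment x x'"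
    and seg2: "z \<in> closed_segment (vector [0, x]) (vector [0, x']) \<longleftrightarrow> z $ 1 = 0 \<and> z $ 2 \<in> closed_segment x x'"
    for z :: "real^2" and x x'
    by (auto simp: in_segment vec_eq_iff forall_2)
  have imF: "path_image F = closed_segment (vector [-M, 0]) (vector [-a, 0]) \<union> path_image f \<union>
      closed_segment (vector [b, 0]) (vector [M, 0])"
    and imG: "path_image G = closed_segment (vector [0, -M]) (vector [0, -c]) \<union> path_image g \<union>
      closed_segment (vector [0, d]) (vector [0, M])"
    unfolding F_def G_def using f g by (simp_all add: path_image_join Un_assoc)
  have box: "path_image F \<subseteq> cbox (vector [-M, -M]) (vector [M, M])"
    "path_image G \<subseteq> cbox (vector [-M, -M]) (vector [M, M])"
    unfolding imF imG using comp abcd pos M(1)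
    by (auto simp: mem_box_cart forall_2 seg1 seg2 closed_segment_eq_real_ivl)
  obtain z where z: "z \<in> path_image F" "z \<in> path_image G"
  proof (rule fashoda[OF _ _ box])
    show "path F" "path G" using f g by (simp_all add: F_def G_def)
  qed (auto simp: F_def G_def)
  have zz: "z = vector [z $ 1, z $ 2]" by (simp add: vec_eq_iff forall_2)
  have fa: "vector [-a, 0] \<in> path_image f" "vector [b, 0] \<in> path_image f"
    and gc: "vector [0, -c] \<in> path_image g" "vector [0, d] \<in> path_image g"
    using f g by (metis pathstart_in_path_image pathfinish_in_path_image)+
  have zf: "z \<in> path_image f" if "z \<in> path_image g"
  proof (rule ccontr)
    assume "z \<notin> path_image f"
    then have "z $ 2 = 0" "z $ 1 \<in> {-M..-a} \<union> {b..M}"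
      using z(1) pos abcd by (auto simp: imF seg1 closed_segment_eq_real_ivl)
    moreover then have "- a \<le> z $ 1" "z $ 1 \<le> b"
      using hor[of "z $ 1"] that zz by auto
    ultimately show False using fa \<open>z \<notin> path_image f\<close> zz by auto
  qed
  have zg: "z \<in> path_image g" if "z \<in> path_image f"
  proof (rule ccontr)
    assume "z \<notin> path_image g"
    then have "z $ 1 = 0" "z $ 2 \<in> {-M..-c} \<union> {d..M}"
      using z(2) pos abcd by (auto simp: imG seg2 closed_segment_eq_real_ivl)
    moreover then have "- c \<le> z $ 2" "z $ 2 \<le> d"
      using ver[of "z $ 2"] that zz by auto
    ultimately show False using gc \<open>z \<notin> path_image g\<close> zz by auto
  qed
  have "z \<in> path_image f \<or> z \<in> path_image g"
    using z pos M(1) by (auto simp: imF imG seg1 seg2 closed_segment_eq_real_ivl split: if_splits)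
  then show ?thesis using zf zg by blast
qed

text \<open>Beyond \<open>p\<close> on the line from \<open>r\<close> through \<open>p\<close> the functional supporting the side of \<open>p\<close>
  exceeds 1, so the line has left the hexagon there. The position on the line is measured by the
  signed distance from the other chord.\<close>

lemma chord_line_bound:
  assumes "p \<in> hex_edge s" "z \<in> std_hexagon" "r \<in> std_hexagon" "edge_fun s r < 1"
    and col: "orient p r z = 0" and sep: "orient q q' p < 0" "orient q q' r > 0" "orient q q' q = 0"
  shows "orient q q' p \<le> orient q q' z"
proof -
  \<comment> \<open>on the line through p and r both affine functions are affine in one parameter\<close>
  have "(edge_fun s z - edge_fun s p) * (orient q q' r - orient q q' p) =
      (edge_fun s r - edge_fun s p) * (orient q q' z - orient q q' p)"
  proof -
    have *: "(hx r - hx p) * (hy z - hy p) = (hy r - hy p) * (hx z - hx p)"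
      using col by (simp add: orient_def)
    have "(\<alpha> * (hx z - hx p) + \<beta> * (hy z - hy p)) * (\<gamma> * (hx r - hx p) + \<delta> * (hy r - hy p)) =
      (\<alpha> * (hx r - hx p) + \<beta> * (hy r - hy p)) * (\<gamma> * (hx z - hx p) + \<delta> * (hy z - hy p))" for \<alpha> \<beta> \<gamma> \<delta>
      using * by algebra
    moreover have "\<exists>\<alpha> \<beta>. \<forall>z w. edge_fun s z - edge_fun s w = \<alpha> * (hx z - hx w) + \<beta> * (hy z - hy w)"
    proof (cases s)
      case Side_a then show ?thesis by (intro exI[of _ 1] exI[of _ 0]) auto
    next
      case Side_C then show ?thesis by (intro exI[of _ 0] exI[of _ 1]) auto
    next
      case Side_b then show ?thesis by (intro exI[of _ "-1"] exI[of _ 1]) auto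
    next
      case Side_A then show ?thesis by (intro exI[of _ "-1"] exI[of _ 0]) auto
    next
      case Side_c then show ?thesis by (intro exI[of _ 0] exI[of _ "-1"]) auto
    next
      case Side_B then show ?thesis by (intro exI[of _ 1] exI[of _ "-1"]) auto
    qed
    moreover have "\<exists>\<gamma> \<delta>. \<forall>z w. orient q q' z - orient q q' w = \<gamma> * (hx z - hx w) + \<delta> * (hy z - hy w)"
      by (intro exI[of _ "- (hy q' - hy q)"] exI[of _ "hx q' - hx q"]) (auto simp: orient_def algebra_simps)
    ultimately show ?thesis by metis
  qed
  moreover have "edge_fun s z - edge_fun s p \<le> 0"
    using assms hex_edge_edge_fun(1)[OF assms(1)] by (simp add: std_hexagon_iff)
  moreover have "edge_fun s r - edge_fun s p < 0"
    using assms hex_edge_edge_fun(1)[OF assms(1)] by simp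
  moreover have "orient q q' r - orient q q' p > 0" using sep by simp
  ultimately have "0 \<le> orient q q' z - orient q q' p"
    by (metis linorder_not_less mult_neg_neg mult_nonpos_nonneg order_less_imp_le linorder_not_le)
  then show ?thesis by simp
qed

lemma orient_coords_inj:
  assumes "orient p r z = orient p r w" "orient q s z = orient q s w"
    and "orient p r s < 0" "orient p r q > 0"
  shows "z = w"
proof -
  define A B C D where "A = hx r - hx p" and "B = hy r - hy p" and "C = hx s - hx q" and "D = hy s - hy q"
  define X Y where "X = hx z - hx w" and "Y = hy z - hy w"
  have 1: "A * Y = B * X" "C * Y = D * X"
    using assms(1,2) by (simp_all add: orient_def A_def B_def C_def D_def X_def Y_def algebra_simps)
  have "orient p r q - orient p r s = B * C - A * D"
    by (simp add: orient_def A_def B_def C_def D_def algebra_simps)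
  then have det: "A * D - B * C < 0" using assms by linarith
  have "(A * D - B * C) * X = 0" "(A * D - B * C) * Y = 0" using 1 by algebra+
  then have "X = 0" "Y = 0" using det by auto
  then show ?thesis by (intro hex_coords_eqI) (auto simp: X_def Y_def)
qed

text \<open>The signed distances to the two chords spanned by the endpoints serve as coordinates, in which
  the endpoints lie on the two axes on opposite sides of the origin. Convexity of the hexagon then
  gives the hypotheses of the axis version.\<close>

lemma interlacing_paths_meet:
  assumes f: "path f" "path_image f \<subseteq> std_hexagon" "pathstart f \<in> hex_edge s1" "pathfinish f \<in> hex_edge s3"
    and g: "path g" "path_image g \<subseteq> std_hexagon" "pathstart g \<in> hex_edge s2" "pathfinish g \<in> hex_edge s4"
    and lt: "side_pos s1 < side_pos s2" "side_pos s2 < side_pos s3" "side_pos s3 < side_pos s4"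
  shows "path_image f \<inter> path_image g \<noteq> {}"
proof -
  define p r q s where "p = pathstart f" and "r = pathfinish f" and "q = pathfinish g" and "s = pathstart g"
  note defs = p_def r_def q_def s_def
  have ins: "p \<in> hex_edge s1" "r \<in> hex_edge s3" "s \<in> hex_edge s2" "q \<in> hex_edge s4"
    using f g by (auto simp: defs)
  then have hex: "p \<in> std_hexagon" "r \<in> std_hexagon" "q \<in> std_hexagon" "s \<in> std_hexagon"
    using hex_edge_subset by blast+
  have o: "orient p s r > 0" "orient p r q > 0" "orient p s q > 0" "orient s r q > 0"
    using ins lt by (auto intro!: orient_edges_pos)
  \<comment> \<open>the two chords separate each other's endpoints\<close>
  have sg: "orient p r s < 0" "orient p r q > 0" "orient q s r > 0" "orient q s p < 0"
    using o by (simp_all add: orient_def algebra_simps)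
  define \<xi> \<eta> where "\<xi> z = orient q s z" and "\<eta> z = orient p r z" for z
  have \<xi>: "\<xi> p < 0" "\<xi> r > 0" "\<xi> s = 0" "\<xi> q = 0" and \<eta>: "\<eta> s < 0" "\<eta> q > 0" "\<eta> p = 0" "\<eta> r = 0"
    using sg by (auto simp: \<xi>_def \<eta>_def orient_def algebra_simps)
  define L where "L z = (vector [\<xi> z, \<eta> z] :: real^2)" for z
  have contL: "continuous_on S L" for S
  proof -
    have "L = (\<lambda>z. \<chi> i. if i = 1 then \<xi> z else \<eta> z)"
      by (auto simp: L_def vec_eq_iff forall_2)
    moreover have "continuous_on S (\<lambda>z. if i = (1::2) then \<xi> z else \<eta> z)" for i
      by (cases "i = 1") (auto simp: \<xi>_def \<eta>_def orient_def intro!: continuous_intros)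
    ultimately show ?thesis by (simp add: continuous_on_vec_lambda)
  qed
  have injL: "z = w" if "L z = L w" for z w
  proof -
    have "\<xi> z = \<xi> w" "\<eta> z = \<eta> w"
      using that unfolding L_def by (metis vector_2)+
    then show ?thesis
      using orient_coords_inj[of p r z w q s] \<xi> \<eta> by (simp add: \<xi>_def \<eta>_def)
  qed
  have ne: "edge_fun s1 r < 1" "edge_fun s3 p < 1" "edge_fun s2 q < 1" "edge_fun s4 s < 1"
    using ins lt hex_edge_edge_fun(2) by (metis less_irrefl less_trans)+
  have "path_image (L \<circ> f) \<inter> path_image (L \<circ> g) \<noteq> {}"
  proof (rule axis_paths_meet)
    show "path (L \<circ> f)" "path (L \<circ> g)"
      using f g contL by (auto intro!: path_continuous_image)
    show "pathstart (L \<circ> f) = vector [- (- \<xi> p), 0]" "pathfinish (L \<circ> f) = vector [\<xi> r, 0]"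
      "pathstart (L \<circ> g) = vector [0, - (- \<eta> s)]" "pathfinish (L \<circ> g) = vector [0, \<eta> q]"
      using \<xi> \<eta> by (simp_all add: pathstart_compose pathfinish_compose L_def flip: defs)
    show "0 < - \<xi> p" "0 < \<xi> r" "0 < - \<eta> s" "0 < \<eta> q" using \<xi> \<eta> by auto
  next
    fix x assume "vector [x, 0] \<in> path_image (L \<circ> g)"
    then obtain z where z: "z \<in> std_hexagon" "\<xi> z = x" "\<eta> z = 0"
      using g by (auto simp: path_image_compose L_def) (metis subsetD vector_2)
    have "\<xi> p \<le> \<xi> z"
      using chord_line_bound[of p s1 z r q s] z ins hex ne \<xi> by (simp add: \<xi>_def \<eta>_def)
    moreover have "orient s q r \<le> orient s q z"
      using chord_line_bound[of r s3 z p s q] z ins hex ne \<xi>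
      by (simp add: \<xi>_def \<eta>_def orient_def algebra_simps)
    then have "\<xi> z \<le> \<xi> r" by (simp add: \<xi>_def orient_def algebra_simps)
    ultimately show "- (- \<xi> p) \<le> x \<and> x \<le> \<xi> r" using z by simp
  next
    fix y assume "vector [0, y] \<in> path_image (L \<circ> f)"
    then obtain z where z: "z \<in> std_hexagon" "\<xi> z = 0" "\<eta> z = y"
      using f by (auto simp: path_image_compose L_def) (metis subsetD vector_2)
    have "\<eta> s \<le> \<eta> z"
      using chord_line_bound[of s s2 z q p r] orient_swap[of s q z] z ins hex ne \<eta> by (simp add: \<xi>_def \<eta>_def)
    moreover have "orient r p q \<le> orient r p z"
      using chord_line_bound[of q s4 z s r p] z ins hex ne \<eta>
      by (simp add: \<xi>_def \<eta>_def orient_def algebra_simps)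
    then have "\<eta> z \<le> \<eta> q" by (simp add: \<eta>_def orient_def algebra_simps)
    ultimately show "- (- \<eta> s) \<le> y \<and> y \<le> \<eta> q" using z by simp
  qed
  then obtain z w where "z \<in> path_image f" "w \<in> path_image g" "L z = L w"
    by (auto simp: path_image_compose)
  then show ?thesis using injL by auto
qed

section \<open>The nine classes of arcs\<close>

datatype chord = Parallel side | Alpha | Beta | Gamma

lemma UNIV_chord:
  "UNIV = {Parallel Side_a, Parallel Side_b, Parallel Side_c, Parallel Side_A, Parallel Side_B,
    Parallel Side_C, Alpha, Beta, Gamma}" (is "_ = ?R")
proof -
  have "v \<in> ?R" for v
  proof (cases v)
    case (Parallel s)
    then show ?thesis by (cases s) auto
  qed auto
  then show ?thesis by auto
qed

instance chord :: finite
  by standard (simp add: UNIV_chord)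

lemma chord_cases [case_names a b c A B C Alpha Beta Gamma]:
  obtains "v = Parallel Side_a" | "v = Parallel Side_b" | "v = Parallel Side_c"
    | "v = Parallel Side_A" | "v = Parallel Side_B" | "v = Parallel Side_C"
    | "v = Alpha" | "v = Beta" | "v = Gamma"
  using UNIV_I[of v] unfolding UNIV_chord by blast

fun chord_lo :: "chord \<Rightarrow> side" where
  "chord_lo (Parallel Side_a) = Side_C"
| "chord_lo (Parallel Side_C) = Side_a"
| "chord_lo (Parallel Side_b) = Side_C"
| "chord_lo (Parallel Side_A) = Side_b"
| "chord_lo (Parallel Side_c) = Side_A"
| "chord_lo (Parallel Side_B) = Side_a"
| "chord_lo Alpha = Side_a"
| "chord_lo Beta = Side_b"
| "chord_lo Gamma = Side_C"

fun chord_hi :: "chord \<Rightarrow> side" where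
  "chord_hi (Parallel Side_a) = Side_B"
| "chord_hi (Parallel Side_C) = Side_b"
| "chord_hi (Parallel Side_b) = Side_A"
| "chord_hi (Parallel Side_A) = Side_c"
| "chord_hi (Parallel Side_c) = Side_B"
| "chord_hi (Parallel Side_B) = Side_c"
| "chord_hi Alpha = Side_A"
| "chord_hi Beta = Side_B"
| "chord_hi Gamma = Side_c"

definition interlaced :: "chord \<Rightarrow> chord \<Rightarrow> bool" where
  "interlaced u v \<longleftrightarrow> side_pos (chord_lo u) < side_pos (chord_lo v) \<and>
     side_pos (chord_lo v) < side_pos (chord_hi u) \<and> side_pos (chord_hi u) < side_pos (chord_hi v)"

text \<open>Two classes of arcs are linked if their four sides are distinct and alternate around the
  boundary; arcs ending on a common side can always be made disjoint.\<close>

definition linked :: "chord \<Rightarrow> chord \<Rightarrow> bool" where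
  "linked u v \<longleftrightarrow> interlaced u v \<or> interlaced v u"

lemma linked_sym: "linked u v \<longleftrightarrow> linked v u"
  by (auto simp: linked_def)

lemma not_linked_self [simp]: "\<not> linked v v"
  by (simp add: linked_def interlaced_def)

definition chord_class :: "(complex \<Rightarrow> 'a::topological_space) \<Rightarrow> chord \<Rightarrow> 'a arc_class" where
  "chord_class h v = {X. joins h (chord_lo v) (chord_hi v) X}"

lemma chord_ends: "nonadjacent s t \<Longrightarrow> \<exists>v. chord_lo v = s \<and> chord_hi v = t \<or> chord_lo v = t \<and> chord_hi v = s"
proof -
  have ex: "(\<exists>v. P v) \<longleftrightarrow> P (Parallel Side_a) \<or> P (Parallel Side_b) \<or> P (Parallel Side_c) \<or>
    P (Parallel Side_A) \<or> P (Parallel Side_B) \<or> P (Parallel Side_C) \<or> P Alpha \<or> P Beta \<or> P Gamma" for P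
    by (metis chord_cases)
  show "nonadjacent s t \<Longrightarrow> ?thesis"
    by (cases s; cases t) (auto simp: nonadjacent_def ex)
qed

lemma nonadjacent_chord: "nonadjacent (chord_lo v) (chord_hi v)"
  by (cases v rule: chord_cases) (auto simp: nonadjacent_def)

lemma chord_lo_less_hi: "side_pos (chord_lo v) < side_pos (chord_hi v)"
  by (cases v rule: chord_cases) auto

lemma chord_ends_inj: "chord_lo u = chord_lo v \<Longrightarrow> chord_hi u = chord_hi v \<Longrightarrow> u = v"
  by (cases u rule: chord_cases; cases v rule: chord_cases; simp)

lemma hexagonE:
  assumes "hexagon h"
  obtains k where "homeomorphism std_hexagon (h ` std_hexagon) h k"
  using assms by (auto simp: hexagon_def)

lemma hexagon_inj: "hexagon h \<Longrightarrow> inj_on h std_hexagon"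
  by (auto simp: hexagon_def homeomorphism_def intro: inj_on_inverseI)

lemma joins_reverse: "joins h s t X \<Longrightarrow> joins h t s X"
proof -
  assume "joins h s t X"
  then obtain g where g: "arc_param h s t g" "path_image g = X" by (auto simp: joins_def)
  have "reversepath g ` {0<..<1} \<subseteq> g ` {0<..<1}"
    by (auto simp: reversepath_def intro!: imageI)
  then have "arc_param h t s (reversepath g)"
    using g(1) by (auto simp: arc_param_def arc_reversepath) (auto simp: reversepath_def)
  then show ?thesis using g(2) by (auto simp: joins_def)
qed

text \<open>An arc touches the boundary only at its endpoints, so its image alone determines the pair of
  sides that it joins.\<close>

lemma arc_param_meets_edge:
  assumes "hexagon h" "arc_param h s t g"
  shows "path_image g \<inter> h ` hex_edge u \<noteq> {} \<longleftrightarrow> u = s \<or> u = t"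
proof
  assume "path_image g \<inter> h ` hex_edge u \<noteq> {}"
  then obtain x z where x: "0 \<le> x" "x \<le> 1" "g x = h z" "z \<in> hex_edge u"
    by (auto simp: path_image_def)
  have inj: "h a = h b \<Longrightarrow> a \<in> std_hexagon \<Longrightarrow> b \<in> std_hexagon \<Longrightarrow> a = b" for a b
    using hexagon_inj[OF assms(1)] by (auto dest: inj_onD)
  consider "x = 0" | "x = 1" | "x \<in> {0<..<1}" using x by fastforce
  then show "u = s \<or> u = t"
  proof cases
    case 1
    then obtain a where "a \<in> hex_edge s" "h a = h z" using assms x by (auto simp: arc_param_def hex_side_eq)
    then show ?thesis using inj[of a z] x hex_edge_subset hex_edge_disjoint by blast
  next
    case 2
    then obtain a where "a \<in> hex_edge t" "h a = h z" using assms x by (auto simp: arc_param_def hex_side_eq)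
    then show ?thesis using inj[of a z] x hex_edge_subset hex_edge_disjoint by blast
  next
    case 3
    then have "g x \<in> h ` interior std_hexagon" using assms by (auto simp: arc_param_def)
    then obtain a where "a \<in> interior std_hexagon" "h a = h z" using x by auto
    then show ?thesis using inj[of a z] x hex_edge_subset interior_subset hex_edge_not_interior by blast
  qed
next
  assume "u = s \<or> u = t"
  then show "path_image g \<inter> h ` hex_edge u \<noteq> {}"
    using assms(2) pathstart_in_path_image[of g] pathfinish_in_path_image[of g]
    by (auto simp: arc_param_def hex_side_eq pathstart_def pathfinish_def)
qed

lemma joins_same_sides:
  assumes "hexagon h" "joins h s t X" "joins h s' t' X"
  shows "s = s' \<and> t = t' \<or> s = t' \<and> t = s'"
  using assms arc_param_meets_edge unfolding joins_def by metis

lemma arc_param_in_hexagon: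
  assumes "arc_param h s t g" "x \<in> {0..1}"
  shows "g x \<in> h ` std_hexagon"
proof -
  have "h ` hex_edge e \<subseteq> h ` std_hexagon" "h ` interior std_hexagon \<subseteq> h ` std_hexagon" for e
    by (intro image_mono hex_edge_subset interior_subset)+
  moreover have "x = 0 \<or> x = 1 \<or> x \<in> {0<..<1}" using assms(2) by auto
  moreover have "g 0 \<in> h ` hex_edge s" "g 1 \<in> h ` hex_edge t" "g ` {0<..<1} \<subseteq> h ` interior std_hexagon"
    using assms(1) by (simp_all add: arc_param_def hex_side_eq)
  ultimately show ?thesis by (metis image_subset_iff subset_iff)
qed

text \<open>The straight-line homotopy between two parametrisations, taken in the convex model hexagon,
  keeps the endpoints in their sides because sides are convex.\<close>

lemma joins_homotopic:
  assumes "hexagon h" "joins h s t X" "joins h s t Y"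
  shows "arc_homotopic h X Y"
proof -
  obtain k where k: "homeomorphism std_hexagon (h ` std_hexagon) h k"
    using assms(1) by (rule hexagonE)
  obtain g g' where g: "arc_param h s t g" "path_image g = X"
    and g': "arc_param h s t g'" "path_image g' = Y"
    using assms by (auto simp: joins_def)
  have kh: "k (h z) = z" if "z \<in> std_hexagon" for z
    using k that by (auto simp: homeomorphism_def)
  have hk: "h (k y) = y" "k y \<in> std_hexagon" if "y \<in> h ` std_hexagon" for y
    using k that by (auto simp: homeomorphism_def)
  have side: "k y \<in> hex_edge e" if "y \<in> hex_side h e" for y e
    using that kh hex_edge_subset by (fastforce simp: hex_side_eq)
  have cont: "continuous_on {0..1} (k \<circ> f)" if "arc_param h s t f" for f
  proof (rule continuous_on_compose)
    show "continuous_on {0..1} f" using that by (auto simp: arc_param_def arc_def path_def)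
    show "continuous_on (f ` {0..1}) k"
      using k arc_param_in_hexagon[OF that] by (auto simp: homeomorphism_def intro: continuous_on_subset)
  qed
  define H where "H = (\<lambda>(u::real, x). (1 - u) *\<^sub>R (k \<circ> g) x + u *\<^sub>R (k \<circ> g') x)"
  have Hin: "H (u, x) \<in> std_hexagon" if "u \<in> {0..1}" "x \<in> {0..1}" for u x
    unfolding H_def using that hk(2) arc_param_in_hexagon[OF g(1)] arc_param_in_hexagon[OF g'(1)]
    by (auto intro!: convexD[OF convex_std_hexagon])
  have contfst: "continuous_on ({0..1} \<times> {0..1}) (\<lambda>p. f (snd p))"
    if "continuous_on {0..1} f" for f :: "real \<Rightarrow> complex"
    by (rule continuous_on_compose2[OF that]) (auto intro!: continuous_intros)
  have contH: "continuous_on ({0..1} \<times> {0..1}) H"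
    unfolding H_def case_prod_unfold
    by (intro continuous_intros contfst cont g g')
  define Q where "Q = (\<lambda>p. if snd p \<in> {0..1} then h (H p) else if fst p = 0 then g (snd p) else g' (snd p))"
  have Qin: "Q (u, x) = h (H (u, x))" if "x \<in> {0..1}" for u x
    using that by (simp add: Q_def)
  have "homotopic_with_canon (\<lambda>f. f 0 \<in> hex_side h s \<and> f 1 \<in> hex_side h t)
      {0..1} (h ` std_hexagon) g g'"
    unfolding homotopic_with_def
  proof (intro exI[of _ Q] conjI ballI allI)
    have "continuous_on ({0..1} \<times> {0..1}) (h \<circ> H)"
      by (rule continuous_on_compose[OF contH])
        (use k Hin in \<open>auto simp: homeomorphism_def intro: continuous_on_subset\<close>)
    then have "continuous_on ({0..1} \<times> {0..1}) Q"
      by (rule continuous_on_eq) (auto simp: Q_def)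
    moreover have "Q ` ({0..1} \<times> {0..1}) \<subseteq> h ` std_hexagon"
      using Hin by (auto simp: Q_def)
    ultimately show "continuous_map (prod_topology (top_of_set {0..1}) (top_of_set {0..1})) (top_of_set (h ` std_hexagon)) Q"
      by (simp add: subtopology_Times euclidean_product_topology continuous_map_in_subtopology image_subset_iff_funcset flip: subtopology_Times)
  next
    fix x
    show "Q (0, x) = g x"
      using hk arc_param_in_hexagon[OF g(1)] by (auto simp: Q_def H_def)
    show "Q (1, x) = g' x"
      using hk arc_param_in_hexagon[OF g'(1)] by (auto simp: Q_def H_def)
  next
    fix u :: real assume u: "u \<in> {0..1}"
    have "H (u, 0) \<in> hex_edge s" "H (u, 1) \<in> hex_edge t"
      unfolding H_def using u g(1) g'(1) side
      by (auto simp: arc_param_def intro!: convexD[OF convex_hex_edge])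
    then show "Q (u, 0) \<in> hex_side h s" "Q (u, 1) \<in> hex_side h t"
      by (auto simp: hex_side_eq Qin)
  qed
  then show ?thesis unfolding arc_homotopic_def using g g' by blast
qed

lemma arc_homotopic_joins:
  assumes "arc_homotopic h X Y"
  obtains s t where "joins h s t X" "joins h s t Y"
  using assms by (auto simp: arc_homotopic_def joins_def)

lemma class_of_arc_eq:
  assumes "hexagon h" "X \<in> chord_class h v"
  shows "class_of_arc h X = chord_class h v"
proof -
  have X: "joins h (chord_lo v) (chord_hi v) X" using assms(2) by (simp add: chord_class_def)
  have "joins h (chord_lo v) (chord_hi v) Y" if "arc_homotopic h X Y" for Y
  proof -
    obtain s t where st: "joins h s t X" "joins h s t Y" using \<open>arc_homotopic h X Y\<close> by (rule arc_homotopic_joins)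
    from joins_same_sides[OF assms(1) X st(1)] show ?thesis
      using st(2) joins_reverse[OF st(2)] by auto
  qed
  moreover have "arc_homotopic h X Y" if "joins h (chord_lo v) (chord_hi v) Y" for Y
    using joins_homotopic[OF assms(1) X that] .
  ultimately show ?thesis by (auto simp: class_of_arc_def chord_class_def)
qed

section \<open>Straight chords in minimal position\<close>

text \<open>The points dividing the sides into sixteenths, in coordinates scaled by 16. A chord
  parallel to a side ends nearer to that side than a chord crossing the hexagon, so that all nine
  chords can be drawn with as few crossings as possible. The parameter \<open>e = 1\<close> moves a chord
  off itself without changing its crossings with the others.\<close>

fun edge_x :: "side \<Rightarrow> int \<Rightarrow> int" where
  "edge_x Side_a n = 16"
| "edge_x Side_C n = 16 - n"
| "edge_x Side_b n = - n"
| "edge_x Side_A n = -16"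
| "edge_x Side_c n = n - 16"
| "edge_x Side_B n = n"

fun edge_y :: "side \<Rightarrow> int \<Rightarrow> int" where
  "edge_y Side_a n = n"
| "edge_y Side_C n = 16"
| "edge_y Side_b n = 16 - n"
| "edge_y Side_A n = - n"
| "edge_y Side_c n = -16"
| "edge_y Side_B n = n - 16"

definition edge_pt :: "side \<Rightarrow> int \<Rightarrow> complex" where
  "edge_pt s n = hpt (of_int (edge_x s n) / 16) (of_int (edge_y s n) / 16)"

lemma edge_pt_in: "0 < n \<Longrightarrow> n < 16 \<Longrightarrow> edge_pt s n \<in> hex_edge s"
  unfolding hex_edge_param edge_pt_def
  by (intro exI[of _ "of_int n / 16"] conjI hex_coords_eqI; cases s) (simp_all add: field_simps)

fun lo_par :: "int \<Rightarrow> chord \<Rightarrow> int" where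
  "lo_par e (Parallel s) = (if s = Side_a \<or> s = Side_B then 4 - e else 12 + e)"
| "lo_par e _ = 8 + e"

fun hi_par :: "int \<Rightarrow> chord \<Rightarrow> int" where
  "hi_par e (Parallel s) = (if s = Side_a \<or> s = Side_B then 12 + e else 4 - e)"
| "hi_par e _ = 8 - e"

definition chord_from :: "int \<Rightarrow> chord \<Rightarrow> complex" where
  "chord_from e v = edge_pt (chord_lo v) (lo_par e v)"

definition chord_to :: "int \<Rightarrow> chord \<Rightarrow> complex" where
  "chord_to e v = edge_pt (chord_hi v) (hi_par e v)"

definition straight_chord :: "int \<Rightarrow> chord \<Rightarrow> complex set" where
  "straight_chord e v = closed_segment (chord_from e v) (chord_to e v)"

lemma chord_end_pts:
  assumes "0 \<le> e" "e < 4"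
  shows "chord_from e v \<in> hex_edge (chord_lo v)" "chord_to e v \<in> hex_edge (chord_hi v)"
  unfolding chord_from_def chord_to_def using assms
  by (cases v; auto intro!: edge_pt_in)+

lemma straight_chord_subset:
  assumes "0 \<le> e" "e < 4"
  shows "straight_chord e v \<subseteq> std_hexagon"
  unfolding straight_chord_def
  using chord_end_pts[OF assms] hex_edge_subset by (intro closed_segment_subset convex_std_hexagon) blast+

lemma straight_chord_in_class:
  assumes "hexagon h" "0 \<le> e" "e < 4"
  shows "h ` straight_chord e v \<in> chord_class h v"
proof -
  let ?l = "linepath (chord_from e v) (chord_to e v)"
  note ends = chord_end_pts[OF assms(2,3), of v]
  obtain k where k: "homeomorphism std_hexagon (h ` std_hexagon) h k"
    using assms(1) by (rule hexagonE)
  have sub: "path_image ?l \<subseteq> std_hexagon"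
    using straight_chord_subset[OF assms(2,3)] by (simp add: straight_chord_def)
  have lohi: "chord_lo v \<noteq> chord_hi v" using chord_lo_less_hi[of v] by auto
  have ne: "chord_from e v \<noteq> chord_to e v"
    using ends hex_edge_disjoint lohi by metis
  have "arc (h \<circ> ?l)"
    unfolding arc_def
  proof
    show "path (h \<circ> ?l)"
      using k sub by (intro path_continuous_image) (auto simp: homeomorphism_def intro: continuous_on_subset)
    show "inj_on (h \<circ> ?l) {0..1}"
      using arc_linepath[OF ne] sub hexagon_inj[OF assms(1)]
      by (intro comp_inj_on) (auto simp: arc_def path_image_def intro: inj_on_subset)
  qed
  moreover have "(h \<circ> ?l) ` {0<..<1} \<subseteq> h ` interior std_hexagon"
  proof -
    have "?l x \<in> interior std_hexagon" if "x \<in> {0<..<1}" for x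
      unfolding linepath_def using chord_interior[OF ends lohi] that by simp
    then show ?thesis by auto
  qed
  ultimately have "arc_param h (chord_lo v) (chord_hi v) (h \<circ> ?l)"
    using ends by (auto simp: arc_param_def hex_side_eq linepath_0' linepath_1')
  then show ?thesis
    by (auto simp: chord_class_def joins_def straight_chord_def path_image_compose intro!: exI[of _ "h \<circ> ?l"])
qed

lemma segments_disjoint:
  assumes "0 < orient p r q * orient p r s"
  shows "closed_segment p r \<inter> closed_segment q s = {}"
proof -
  have False if z: "z \<in> closed_segment p r" "z \<in> closed_segment q s" for z
  proof -
    obtain u where "z = (1 - u) *\<^sub>R p + u *\<^sub>R r" using z(1) by (auto simp: in_segment)
    then have 0: "orient p r z = 0" by (simp add: orient_convex)
    obtain v where v: "0 \<le> v" "v \<le> 1" "z = (1 - v) *\<^sub>R q + v *\<^sub>R s" using z(2) by (auto simp: in_segment)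
    let ?A = "orient p r q" and ?B = "orient p r s"
    have "(1 - v) * ?A + v * ?B = 0" using 0 v(3) by (simp add: orient_convex)
    then have "?A * ((1 - v) * ?A + v * ?B) = 0" by simp
    then have "(1 - v) * (?A * ?A) + v * (?A * ?B) = 0" by (simp add: algebra_simps)
    moreover have "(1 - v) * (?A * ?A) \<ge> 0" "v * (?A * ?B) \<ge> 0" using v assms by auto
    ultimately have "(1 - v) * (?A * ?A) = 0" "v * (?A * ?B) = 0" by linarith+
    then show False using assms by auto
  qed
  then show ?thesis by auto
qed

lemma segments_meet_once:
  assumes "orient p r q \<noteq> 0" "z \<in> closed_segment p r" "z \<in> closed_segment q s"
    "w \<in> closed_segment p r" "w \<in> closed_segment q s"
  shows "z = w"
proof -
  have 0: "orient p r z = 0" "orient p r w = 0"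
    using assms(2,4) by (auto simp: in_segment orient_convex)
  obtain u v where u: "z = (1 - u) *\<^sub>R q + u *\<^sub>R s" and v: "w = (1 - v) *\<^sub>R q + v *\<^sub>R s"
    using assms(3,5) by (auto simp: in_segment)
  let ?A = "orient p r q" and ?B = "orient p r s"
  have 1: "(1 - u) * ?A + u * ?B = 0" "(1 - v) * ?A + v * ?B = 0"
    using 0 u v by (simp_all add: orient_convex)
  then have "(u - v) * ?A = 0" by algebra
  then show ?thesis using assms(1) u v by simp
qed

definition int_orient :: "int \<Rightarrow> int \<Rightarrow> int \<Rightarrow> int \<Rightarrow> int \<Rightarrow> int \<Rightarrow> int" where
  "int_orient px py qx qy rx ry = (qx - px) * (ry - py) - (qy - py) * (rx - px)"

lemma orient_edge_pts:
  "orient (edge_pt s m) (edge_pt t n) (edge_pt u l) =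
    of_int (int_orient (edge_x s m) (edge_y s m) (edge_x t n) (edge_y t n) (edge_x u l) (edge_y u l)) / 256"
  by (simp add: orient_def edge_pt_def int_orient_def field_simps)

definition orient_from :: "chord \<Rightarrow> int \<Rightarrow> chord \<Rightarrow> int" where
  "orient_from u e v = (let s = chord_lo u; t = chord_hi u; m = lo_par 0 u; n = hi_par 0 u;
     w = chord_lo v; l = lo_par e v in
     int_orient (edge_x s m) (edge_y s m) (edge_x t n) (edge_y t n) (edge_x w l) (edge_y w l))"

definition orient_to :: "chord \<Rightarrow> int \<Rightarrow> chord \<Rightarrow> int" where
  "orient_to u e v = (let s = chord_lo u; t = chord_hi u; m = lo_par 0 u; n = hi_par 0 u;
     w = chord_hi v; l = hi_par e v in
     int_orient (edge_x s m) (edge_y s m) (edge_x t n) (edge_y t n) (edge_x w l) (edge_y w l))"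

lemma orient_chord_ends:
  "orient (chord_from 0 u) (chord_to 0 u) (chord_from e v) = of_int (orient_from u e v) / 256"
  "orient (chord_from 0 u) (chord_to 0 u) (chord_to e v) = of_int (orient_to u e v) / 256"
  by (simp_all add: chord_from_def chord_to_def orient_edge_pts orient_from_def orient_to_def Let_def)

definition all_chords :: "chord list" where
  "all_chords = map Parallel [Side_a, Side_b, Side_c, Side_A, Side_B, Side_C] @ [Alpha, Beta, Gamma]"

lemma set_all_chords: "v \<in> set all_chords"
  using UNIV_I[of v] unfolding UNIV_chord by (simp add: all_chords_def)

text \<open>A positive product of orientations puts both endpoints of \<open>v\<close> strictly on one side of the line
  through \<open>u\<close>, which keeps the chords apart; a single nonzero orientation shows that they are not
  collinear, which limits the crossings to one.\<close>

lemma chord_table: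
  "\<forall>u\<in>set all_chords. \<forall>v\<in>set all_chords. \<forall>e\<in>set [0, 1].
     if linked u v then orient_from u e v \<noteq> 0
     else u = v \<and> e = 0 \<or> 0 < orient_from u e v * orient_to u e v"
  by code_simp

lemma straight_chords_disjoint:
  assumes "\<not> linked u v" "e = 0 \<and> u \<noteq> v \<or> e = 1"
  shows "straight_chord 0 u \<inter> straight_chord e v = {}"
  unfolding straight_chord_def
proof (rule segments_disjoint)
  have "0 < orient_from u e v * orient_to u e v"
    using assms chord_table[rule_format, of u v e] by (auto simp: set_all_chords)
  then have "0 < (of_int (orient_from u e v * orient_to u e v) :: real)"
    by (simp only: of_int_0_less_iff)
  then show "0 < orient (chord_from 0 u) (chord_to 0 u) (chord_from e v) *
      orient (chord_from 0 u) (chord_to 0 u) (chord_to e v)"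
    by (simp add: orient_chord_ends)
qed

lemma straight_chords_meet_once:
  assumes "linked u v" "z \<in> straight_chord 0 u \<inter> straight_chord 1 v"
    "w \<in> straight_chord 0 u \<inter> straight_chord 1 v"
  shows "z = w"
proof (rule segments_meet_once)
  show "orient (chord_from 0 u) (chord_to 0 u) (chord_from 1 v) \<noteq> 0"
    using assms(1) chord_table[rule_format, of u v 1] by (simp add: set_all_chords orient_chord_ends)
qed (use assms in \<open>auto simp: straight_chord_def\<close>)

lemma linked_arcs_meet:
  assumes "hexagon h" "linked u v" "X \<in> chord_class h u" "Y \<in> chord_class h v"
  shows "X \<inter> Y \<noteq> {}"
proof -
  obtain k where k: "homeomorphism std_hexagon (h ` std_hexagon) h k"
    using assms(1) by (rule hexagonE)
  have kh: "k (h z) = z" if "z \<in> std_hexagon" for z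
    using k that by (auto simp: homeomorphism_def)
  have pull: "path (k \<circ> f) \<and> path_image (k \<circ> f) \<subseteq> std_hexagon \<and>
      pathstart (k \<circ> f) \<in> hex_edge s \<and> pathfinish (k \<circ> f) \<in> hex_edge t" if "arc_param h s t f" for f s t
  proof (intro conjI)
    have im: "path_image f \<subseteq> h ` std_hexagon"
      using arc_param_in_hexagon[OF that] by (auto simp: path_image_def)
    show "path (k \<circ> f)"
      using that k im by (intro path_continuous_image)
        (auto simp: arc_param_def arc_def homeomorphism_def intro: continuous_on_subset)
    show "path_image (k \<circ> f) \<subseteq> std_hexagon"
      using im kh by (auto simp: path_image_compose)
    have "k y \<in> hex_edge e" if "y \<in> h ` hex_edge e" for y e
      using that kh hex_edge_subset[of e] by auto
    then show "pathstart (k \<circ> f) \<in> hex_edge s" "pathfinish (k \<circ> f) \<in> hex_edge t"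
      using that by (simp_all add: arc_param_def hex_side_eq pathstart_def pathfinish_def)
  qed
  have main: "X \<inter> Y \<noteq> {}" if uv: "interlaced u v" "X \<in> chord_class h u" "Y \<in> chord_class h v" for u v X Y
  proof -
    obtain f where f: "arc_param h (chord_lo u) (chord_hi u) f" "path_image f = X"
      using uv(2) by (auto simp: chord_class_def joins_def)
    obtain g where g: "arc_param h (chord_lo v) (chord_hi v) g" "path_image g = Y"
      using uv(3) by (auto simp: chord_class_def joins_def)
    have "path_image (k \<circ> f) \<inter> path_image (k \<circ> g) \<noteq> {}"
      using pull[OF f(1)] pull[OF g(1)] uv(1)
      by (intro interlacing_paths_meet[of _ "chord_lo u" "chord_hi u" _ "chord_lo v" "chord_hi v"])
        (auto simp: interlaced_def)
    then obtain x y where "x \<in> X" "y \<in> Y" "k x = k y"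
      using f g by (auto simp: path_image_compose)
    moreover have "x \<in> h ` std_hexagon" "y \<in> h ` std_hexagon"
      using \<open>x \<in> X\<close> \<open>y \<in> Y\<close> f(2) g(2) arc_param_in_hexagon[OF f(1)] arc_param_in_hexagon[OF g(1)]
      by (auto simp: path_image_def)
    then have "h (k x) = x" "h (k y) = y" using kh by auto
    ultimately show ?thesis by (metis disjoint_iff)
  qed
  show ?thesis using assms main by (metis inf_commute linked_def)
qed

lemma inj_chord_class: "hexagon h \<Longrightarrow> inj (chord_class h)"
proof (rule injI)
  fix u v assume h: "hexagon h" and eq: "chord_class h u = chord_class h v"
  have X: "h ` straight_chord 0 u \<in> chord_class h u"
    using straight_chord_in_class[OF h, of 0 u] by simp
  then have "joins h (chord_lo u) (chord_hi u) (h ` straight_chord 0 u)"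
    "joins h (chord_lo v) (chord_hi v) (h ` straight_chord 0 u)"
    using eq by (auto simp: chord_class_def)
  from joins_same_sides[OF h this] show "u = v"
    using chord_ends_inj chord_lo_less_hi[of u] chord_lo_less_hi[of v] by fastforce
qed

lemma chord_class_eq_iff [simp]: "hexagon h \<Longrightarrow> chord_class h u = chord_class h v \<longleftrightarrow> u = v"
  using inj_chord_class by (metis injD)

lemma arc_classes_eq:
  assumes "hexagon h"
  shows "arc_classes h = range (chord_class h)"
proof
  show "arc_classes h \<subseteq> range (chord_class h)"
  proof
    fix \<delta> assume "\<delta> \<in> arc_classes h"
    then obtain X s t where X: "\<delta> = class_of_arc h X" "nonadjacent s t" "joins h s t X"
      by (auto simp: arc_classes_def essential_arc_def)
    obtain v where "X \<in> chord_class h v"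
      using chord_ends[OF X(2)] X(3) joins_reverse[OF X(3)] by (auto simp: chord_class_def)
    then show "\<delta> \<in> range (chord_class h)"
      using class_of_arc_eq[OF assms] X(1) by auto
  qed
  show "range (chord_class h) \<subseteq> arc_classes h"
  proof clarify
    fix v
    have X: "h ` straight_chord 0 v \<in> chord_class h v"
      using straight_chord_in_class[OF assms, of 0 v] by simp
    then have "essential_arc h (h ` straight_chord 0 v)"
      using nonadjacent_chord by (auto simp: essential_arc_def chord_class_def)
    then show "chord_class h v \<in> arc_classes h"
      using class_of_arc_eq[OF assms X] by (auto simp: arc_classes_def)
  qed
qed

lemma side_arc_eq:
  assumes "hexagon h"
  shows "side_arc h s = chord_class h (Parallel s)"
proof -
  let ?P = "joins h (prev_side s) (next_side s)"
  have P: "?P X \<longleftrightarrow> X \<in> chord_class h (Parallel s)" for X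
    using joins_reverse[of h] by (cases s) (auto simp: chord_class_def)
  have "?P (h ` straight_chord 0 (Parallel s))"
    unfolding P using straight_chord_in_class[OF assms, of 0] by simp
  then have "?P (SOME X. ?P X)" by (rule someI)
  then show ?thesis
    unfolding side_arc_def P by (rule class_of_arc_eq[OF assms])
qed

definition class_chord :: "(complex \<Rightarrow> 'a::topological_space) \<Rightarrow> 'a arc_class \<Rightarrow> chord" where
  "class_chord h = inv (chord_class h)"

lemma class_chord [simp]: "hexagon h \<Longrightarrow> class_chord h (chord_class h v) = v"
  by (simp add: class_chord_def inj_chord_class)

lemma card_straight_chords:
  assumes "hexagon h"
  shows "finite (h ` straight_chord 0 u \<inter> h ` straight_chord 1 v)"
    "card (h ` straight_chord 0 u \<inter> h ` straight_chord 1 v) = of_bool (linked u v)"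
proof -
  let ?I = "straight_chord 0 u \<inter> straight_chord 1 v"
  have im: "h ` straight_chord 0 u \<inter> h ` straight_chord 1 v = h ` ?I"
    using inj_on_image_Int[OF hexagon_inj[OF assms], of "straight_chord 0 u" "straight_chord 1 v"]
      straight_chord_subset[of 0 u] straight_chord_subset[of 1 v] by simp
  have "finite (h ` ?I) \<and> card (h ` ?I) = of_bool (linked u v)"
  proof (cases "linked u v")
    case True
    have "h ` ?I \<noteq> {}"
      using linked_arcs_meet[OF assms True straight_chord_in_class[OF assms, of 0]
          straight_chord_in_class[OF assms, of 1]] im by simp
    then obtain z where "z \<in> ?I" by auto
    then have "?I = {z}" using straight_chords_meet_once[OF True] by blast
    then show ?thesis using True by simp
  next
    case False
    then show ?thesis using straight_chords_disjoint[of u v 1] by simp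
  qed
  then show "finite (h ` straight_chord 0 u \<inter> h ` straight_chord 1 v)"
    "card (h ` straight_chord 0 u \<inter> h ` straight_chord 1 v) = of_bool (linked u v)"
    using im by simp_all
qed

lemma disjoint_reps_straight:
  assumes "hexagon h" "\<And>u v. u \<in> T \<Longrightarrow> v \<in> T \<Longrightarrow> \<not> linked u v"
  shows "disjoint_reps (chord_class h ` T) (\<lambda>\<delta>. h ` straight_chord 0 (class_chord h \<delta>))"
  unfolding disjoint_reps_def pairwise_def
proof (intro conjI ballI impI)
  fix \<delta> assume "\<delta> \<in> chord_class h ` T"
  then show "h ` straight_chord 0 (class_chord h \<delta>) \<in> \<delta>"
    using straight_chord_in_class[OF assms(1), of 0] assms(1) by auto
next
  fix \<delta> \<epsilon> assume "\<delta> \<in> chord_class h ` T" "\<epsilon> \<in> chord_class h ` T" "\<delta> \<noteq> \<epsilon>"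
  then obtain u v where uv: "\<delta> = chord_class h u" "\<epsilon> = chord_class h v" "u \<in> T" "v \<in> T" "u \<noteq> v"
    by auto
  then have "straight_chord 0 u \<inter> straight_chord 0 v = {}"
    using assms(2) by (intro straight_chords_disjoint) auto
  then show "disjnt (h ` straight_chord 0 (class_chord h \<delta>)) (h ` straight_chord 0 (class_chord h \<epsilon>))"
    using inj_on_image_Int[OF hexagon_inj[OF assms(1)], of "straight_chord 0 u" "straight_chord 0 v"]
      straight_chord_subset[of 0] assms(1) uv by (simp add: disjnt_def)
qed

text \<open>Disjointness up to homotopy is a pairwise condition because the straight chords realise all
  unlinked classes disjointly at the same time.\<close>

lemma disjoint_reps_iff:
  assumes "hexagon h"
  shows "(\<exists>r. disjoint_reps (chord_class h ` T) r) \<longleftrightarrow> (\<forall>u\<in>T. \<forall>v\<in>T. \<not> linked u v)"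
proof
  assume "\<exists>r. disjoint_reps (chord_class h ` T) r"
  then obtain r where r: "disjoint_reps (chord_class h ` T) r" ..
  show "\<forall>u\<in>T. \<forall>v\<in>T. \<not> linked u v"
  proof (intro ballI notI)
    fix u v assume uv: "u \<in> T" "v \<in> T" "linked u v"
    then have "r (chord_class h u) \<inter> r (chord_class h v) \<noteq> {}"
      using r by (intro linked_arcs_meet[OF assms, of u v]) (auto simp: disjoint_reps_def)
    moreover have "u \<noteq> v" using uv by auto
    ultimately show False using r uv assms
      by (auto simp: disjoint_reps_def pairwise_def disjnt_def)
  qed
next
  assume "\<forall>u\<in>T. \<forall>v\<in>T. \<not> linked u v"
  then show "\<exists>r. disjoint_reps (chord_class h ` T) r"
    using disjoint_reps_straight[OF assms, of T] by blast
qed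

section \<open>Foliations as weights on chords\<close>

text \<open>The weights of a measured foliation together with the zero weight: a fan of simplicial cones,
  one for each set of pairwise unlinked chords.\<close>

definition weight_cone :: "(real ^ chord) set" where
  "weight_cone = {w. (\<forall>v. 0 \<le> w $ v) \<and> (\<forall>u v. linked u v \<longrightarrow> w $ u = 0 \<or> w $ v = 0)}"

definition crossing :: "real ^ chord \<Rightarrow> chord \<Rightarrow> real" where
  "crossing w v = (\<Sum>u\<in>UNIV. of_bool (linked u v) * w $ u)"

definition foliation_of :: "(complex \<Rightarrow> 'a::topological_space) \<Rightarrow> real ^ chord \<Rightarrow> 'a foliation" where
  "foliation_of h w = (\<lambda>\<delta>. if \<delta> \<in> range (chord_class h) then w $ class_chord h \<delta> else 0)"

lemma foliation_of_class [simp]: "hexagon h \<Longrightarrow> foliation_of h w (chord_class h v) = w $ v"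
  by (simp add: foliation_of_def)

lemma leaf_classes_foliation_of:
  "hexagon h \<Longrightarrow> leaf_classes (foliation_of h w) = chord_class h ` {v. w $ v \<noteq> 0}"
  by (auto simp: leaf_classes_def foliation_of_def)

lemma foliation_of_inj:
  assumes "hexagon h" "foliation_of h w = foliation_of h w'"
  shows "w = w'"
  by (metis assms foliation_of_class vec_eq_iff)

lemma foliation_of_scaleR: "foliation_of h (t *\<^sub>R w) = (\<lambda>\<delta>. t * foliation_of h w \<delta>)"
  by (auto simp: foliation_of_def)

lemma MF_eq:
  assumes "hexagon h"
  shows "MF h = foliation_of h ` (weight_cone - {0})"
proof
  show "MF h \<subseteq> foliation_of h ` (weight_cone - {0})"
  proof
    fix F assume F: "F \<in> MF h"
    define w :: "real ^ chord" where "w = (\<chi> v. F (chord_class h v))"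
    have "F \<delta> = 0" if "\<delta> \<notin> range (chord_class h)" for \<delta>
      using F that by (auto simp: MF_def leaf_classes_def arc_classes_eq[OF assms])
    then have Fw: "F = foliation_of h w"
      by (intro ext) (auto simp: foliation_of_def w_def assms)
    have lc: "leaf_classes F = chord_class h ` {v. w $ v \<noteq> 0}"
      unfolding Fw by (rule leaf_classes_foliation_of[OF assms])
    have "\<forall>u\<in>{v. w $ v \<noteq> 0}. \<forall>v\<in>{v. w $ v \<noteq> 0}. \<not> linked u v"
      using F unfolding disjoint_reps_iff[OF assms, symmetric] by (simp add: MF_def lc)
    moreover have "w $ v \<ge> 0" for v using F by (simp add: MF_def w_def)
    moreover have "w \<noteq> 0" using F by (auto simp: MF_def lc)
    ultimately have "w \<in> weight_cone - {0}" by (auto simp: weight_cone_def)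
    then show "F \<in> foliation_of h ` (weight_cone - {0})" using Fw by blast
  qed
  show "foliation_of h ` (weight_cone - {0}) \<subseteq> MF h"
  proof (rule image_subsetI)
    fix w assume "w \<in> weight_cone - {0}"
    then have w: "w \<in> weight_cone" "w \<noteq> 0" by auto
    have "{v. w $ v \<noteq> 0} \<noteq> {}" using w(2) by (auto simp: vec_eq_iff)
    moreover have "\<exists>r. disjoint_reps (chord_class h ` {v. w $ v \<noteq> 0}) r"
      unfolding disjoint_reps_iff[OF assms] using w(1) by (auto simp: weight_cone_def)
    moreover have "0 \<le> foliation_of h w \<delta>" for \<delta>
      using w(1) by (simp add: foliation_of_def weight_cone_def)
    ultimately show "foliation_of h w \<in> MF h"
      by (auto simp: MF_def leaf_classes_foliation_of[OF assms] arc_classes_eq[OF assms])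
  qed
qed

text \<open>The straight chords attain the infimum, as every linked pair has to cross at least once.\<close>

lemma int_number_foliation_of:
  assumes "hexagon h" "w \<in> weight_cone"
  shows "int_number (foliation_of h w) (chord_class h v) = crossing w v"
proof -
  let ?F = "foliation_of h w" and ?S = "{u. w $ u \<noteq> 0}"
  have sum: "(\<Sum>\<epsilon>\<in>leaf_classes ?F. ?F \<epsilon> * real (card (r \<epsilon> \<inter> X))) =
      (\<Sum>u\<in>UNIV. real (card (r (chord_class h u) \<inter> X)) * w $ u)" for r :: "'a arc_class \<Rightarrow> 'a set" and X
  proof -
    have "(\<Sum>\<epsilon>\<in>leaf_classes ?F. ?F \<epsilon> * real (card (r \<epsilon> \<inter> X))) =
        (\<Sum>u\<in>?S. w $ u * real (card (r (chord_class h u) \<inter> X)))"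
      unfolding leaf_classes_foliation_of[OF assms(1)]
      using inj_chord_class[OF assms(1)] assms(1)
      by (subst sum.reindex) (auto intro: inj_on_subset)
    also have "\<dots> = (\<Sum>u\<in>UNIV. w $ u * real (card (r (chord_class h u) \<inter> X)))"
      by (rule sum.mono_neutral_left) auto
    finally show ?thesis by (simp add: mult.commute)
  qed
  have pos: "0 \<le> w $ u" for u using assms(2) by (simp add: weight_cone_def)
  show ?thesis
    unfolding int_number_def
  proof (rule cInf_eq_minimum)
    let ?r = "\<lambda>\<delta>. h ` straight_chord 0 (class_chord h \<delta>)" and ?X = "h ` straight_chord 1 v"
    have "disjoint_reps (leaf_classes ?F) ?r"
      unfolding leaf_classes_foliation_of[OF assms(1)]
      using assms(2) by (intro disjoint_reps_straight[OF assms(1)]) (auto simp: weight_cone_def)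
    moreover have "?X \<in> chord_class h v"
      by (rule straight_chord_in_class[OF assms(1)]) auto
    moreover have "\<forall>\<epsilon>\<in>leaf_classes ?F. finite (?r \<epsilon> \<inter> ?X)"
      using card_straight_chords(1)[OF assms(1)] by blast
    moreover have "crossing w v = (\<Sum>\<epsilon>\<in>leaf_classes ?F. ?F \<epsilon> * real (card (?r \<epsilon> \<inter> ?X)))"
      unfolding sum crossing_def using assms(1) card_straight_chords(2)[OF assms(1)] by simp
    ultimately show "crossing w v \<in> {(\<Sum>\<epsilon>\<in>leaf_classes ?F. ?F \<epsilon> * real (card (r \<epsilon> \<inter> X))) | r X.
        disjoint_reps (leaf_classes ?F) r \<and> X \<in> chord_class h v \<and> (\<forall>\<epsilon>\<in>leaf_classes ?F. finite (r \<epsilon> \<inter> X))}"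
      by (intro CollectI exI[of _ ?r] exI[of _ ?X] conjI)
  next
    fix y assume "y \<in> {(\<Sum>\<epsilon>\<in>leaf_classes ?F. ?F \<epsilon> * real (card (r \<epsilon> \<inter> X))) | r X.
        disjoint_reps (leaf_classes ?F) r \<and> X \<in> chord_class h v \<and> (\<forall>\<epsilon>\<in>leaf_classes ?F. finite (r \<epsilon> \<inter> X))}"
    then obtain r X where r: "disjoint_reps (leaf_classes ?F) r" "X \<in> chord_class h v"
        "\<forall>\<epsilon>\<in>leaf_classes ?F. finite (r \<epsilon> \<inter> X)"
      and y: "y = (\<Sum>u\<in>UNIV. real (card (r (chord_class h u) \<inter> X)) * w $ u)"
      unfolding sum by blast
    show "crossing w v \<le> y"
      unfolding y crossing_def
    proof (rule sum_mono)
      fix u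
      show "of_bool (linked u v) * w $ u \<le> real (card (r (chord_class h u) \<inter> X)) * w $ u"
      proof (cases "linked u v \<and> w $ u \<noteq> 0")
        case True
        then have lc: "chord_class h u \<in> leaf_classes ?F"
          by (simp add: leaf_classes_foliation_of[OF assms(1)])
        then have "r (chord_class h u) \<inter> X \<noteq> {}"
          using r True by (intro linked_arcs_meet[OF assms(1), of u v]) (auto simp: disjoint_reps_def)
        then have "card (r (chord_class h u) \<inter> X) \<ge> 1"
          using r(3) lc by (simp add: Suc_le_eq card_gt_0_iff)
        then show ?thesis using True pos[of u] by (intro mult_right_mono) auto
      qed (use pos[of u] in auto)
    qed
  qed
qed

lemma linear_crossing: "linear (\<lambda>w. crossing w v)"
  by (auto simp: linear_iff crossing_def sum.distrib sum_distrib_left algebra_simps)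

lemmas crossing_linear_simps [simp] =
  linear_add[OF linear_crossing] linear_diff[OF linear_crossing]
  linear_cmul[OF linear_crossing] linear_0[OF linear_crossing]

lemma continuous_crossing [continuous_intros]:
  "continuous_on S f \<Longrightarrow> continuous_on S (\<lambda>x. crossing (f x) v)"
  unfolding crossing_def by (intro continuous_intros)

lemma crossing_eqs:
  "crossing w (Parallel Side_a) = w $ Parallel Side_B + w $ Parallel Side_C + w $ Alpha"
  "crossing w (Parallel Side_b) = w $ Parallel Side_A + w $ Parallel Side_C + w $ Beta"
  "crossing w (Parallel Side_c) = w $ Parallel Side_A + w $ Parallel Side_B + w $ Gamma"
  "crossing w (Parallel Side_A) = w $ Parallel Side_b + w $ Parallel Side_c + w $ Alpha"
  "crossing w (Parallel Side_B) = w $ Parallel Side_a + w $ Parallel Side_c + w $ Beta"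
  "crossing w (Parallel Side_C) = w $ Parallel Side_a + w $ Parallel Side_b + w $ Gamma"
  "crossing w Alpha = w $ Parallel Side_a + w $ Parallel Side_A + w $ Beta + w $ Gamma"
  "crossing w Beta = w $ Parallel Side_b + w $ Parallel Side_B + w $ Alpha + w $ Gamma"
  "crossing w Gamma = w $ Parallel Side_c + w $ Parallel Side_C + w $ Alpha + w $ Beta"
  by (simp_all add: crossing_def UNIV_chord linked_def interlaced_def)

lemma all_chord9:
  "(\<forall>v. P v) \<longleftrightarrow> P (Parallel Side_a) \<and> P (Parallel Side_b) \<and> P (Parallel Side_c) \<and>
    P (Parallel Side_A) \<and> P (Parallel Side_B) \<and> P (Parallel Side_C) \<and> P Alpha \<and> P Beta \<and> P Gamma"
  by (metis chord_cases)

lemma weight_coneD: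
  assumes "w \<in> weight_cone"
  shows "0 \<le> w $ v" "linked u v \<Longrightarrow> w $ u = 0 \<or> w $ v = 0"
  using assms by (auto simp: weight_cone_def)

lemma weight_cone_disj:
  assumes "w \<in> weight_cone"
  shows
    "w $ Parallel Side_a = 0 \<or> w $ Parallel Side_B = 0"
    "w $ Parallel Side_a = 0 \<or> w $ Parallel Side_C = 0"
    "w $ Parallel Side_a = 0 \<or> w $ Alpha = 0"
    "w $ Parallel Side_b = 0 \<or> w $ Parallel Side_A = 0"
    "w $ Parallel Side_b = 0 \<or> w $ Parallel Side_C = 0"
    "w $ Parallel Side_b = 0 \<or> w $ Beta = 0"
    "w $ Parallel Side_c = 0 \<or> w $ Parallel Side_A = 0"
    "w $ Parallel Side_c = 0 \<or> w $ Parallel Side_B = 0"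
    "w $ Parallel Side_c = 0 \<or> w $ Gamma = 0"
    "w $ Parallel Side_A = 0 \<or> w $ Alpha = 0"
    "w $ Parallel Side_B = 0 \<or> w $ Beta = 0"
    "w $ Parallel Side_C = 0 \<or> w $ Gamma = 0"
    "w $ Alpha = 0 \<or> w $ Beta = 0"
    "w $ Alpha = 0 \<or> w $ Gamma = 0"
    "w $ Beta = 0 \<or> w $ Gamma = 0"
  by (rule weight_coneD(2)[OF assms], simp add: linked_def interlaced_def)+

lemma weight_coneI:
  assumes "\<And>v. 0 \<le> w $ v"
    and d:
    "w $ Parallel Side_a = 0 \<or> w $ Parallel Side_B = 0"
    "w $ Parallel Side_a = 0 \<or> w $ Parallel Side_C = 0"
    "w $ Parallel Side_a = 0 \<or> w $ Alpha = 0"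
    "w $ Parallel Side_b = 0 \<or> w $ Parallel Side_A = 0"
    "w $ Parallel Side_b = 0 \<or> w $ Parallel Side_C = 0"
    "w $ Parallel Side_b = 0 \<or> w $ Beta = 0"
    "w $ Parallel Side_c = 0 \<or> w $ Parallel Side_A = 0"
    "w $ Parallel Side_c = 0 \<or> w $ Parallel Side_B = 0"
    "w $ Parallel Side_c = 0 \<or> w $ Gamma = 0"
    "w $ Parallel Side_A = 0 \<or> w $ Alpha = 0"
    "w $ Parallel Side_B = 0 \<or> w $ Beta = 0"
    "w $ Parallel Side_C = 0 \<or> w $ Gamma = 0"
    "w $ Alpha = 0 \<or> w $ Beta = 0"
    "w $ Alpha = 0 \<or> w $ Gamma = 0"
    "w $ Beta = 0 \<or> w $ Gamma = 0"
  shows "w \<in> weight_cone"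
proof -
  note d' = d d[THEN disj_commute[THEN iffD1]]
  have "w $ u = 0 \<or> w $ v = 0" if "interlaced u v" for u v
    using that by (cases u rule: chord_cases; cases v rule: chord_cases; simp add: interlaced_def d')
  then show ?thesis using assms(1) by (auto simp: weight_cone_def linked_def)
qed

section \<open>Intersection numbers determine weights\<close>

text \<open>Each leaf in a triangle-like configuration with intersection numbers \<open>x\<close>, \<open>y\<close>, \<open>z\<close> either
  meets two of the three arcs (counted by \<open>corner\<close>) or meets one of them only, which is possible
  exactly when the triangle inequality fails (counted by \<open>excess\<close>).\<close>

definition excess :: "real \<Rightarrow> real \<Rightarrow> real \<Rightarrow> real" where
  "excess x y z = max 0 (x - y - z)"

definition corner :: "real \<Rightarrow> real \<Rightarrow> real \<Rightarrow> real" where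
  "corner x y z = (y + z - x + excess x y z - excess y x z - excess z x y) / 2"

lemma corner_excess_sum: "corner y x z + corner z x y + excess x y z = x"
proof -
  have "excess y z x = excess y x z" "excess z y x = excess z x y" "excess x z y = excess x y z" by (simp_all add: excess_def)
  then show ?thesis by (simp add: corner_def field_simps)
qed

lemma excess_nonneg: "0 \<le> excess x y z"
  by (simp add: excess_def)

lemma corner_nonneg: "0 \<le> x \<Longrightarrow> 0 \<le> y \<Longrightarrow> 0 \<le> z \<Longrightarrow> 0 \<le> corner x y z"
  by (auto simp: corner_def excess_def max_def)

lemma corner_excess_disjoint:
  "0 \<le> x \<Longrightarrow> 0 \<le> y \<Longrightarrow> 0 \<le> z \<Longrightarrow> corner x y z = 0 \<or> excess x y z = 0"
  "0 \<le> x \<Longrightarrow> 0 \<le> y \<Longrightarrow> 0 \<le> z \<Longrightarrow> excess x y z = 0 \<or> excess y x z = 0"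
  "0 \<le> x \<Longrightarrow> 0 \<le> y \<Longrightarrow> 0 \<le> z \<Longrightarrow> excess x y z = 0 \<or> excess z x y = 0"
  by (auto simp: corner_def excess_def max_def)

lemma excess_unique:
  assumes "0 \<le> A" "0 \<le> B" "0 \<le> C" "0 \<le> p" "0 \<le> q" "0 \<le> r"
    and "A = 0 \<or> p = 0" "p = 0 \<or> q = 0" "p = 0 \<or> r = 0"
  shows "excess (B + C + p) (A + C + q) (A + B + r) = p"
  using assms by (auto simp: excess_def max_def)

text \<open>For a triple of arcs parallel to alternate sides: \<open>x\<close>, \<open>y\<close>, \<open>z\<close> are the intersection
  numbers and the remaining six weights are recovered by explicit piecewise linear formulas. The
  disjunctions say that linked chords do not both occur.\<close>

lemma triangle_weights:
  assumes "0 \<le> A" "0 \<le> B" "0 \<le> C" "0 \<le> p" "0 \<le> q" "0 \<le> r"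
    and "A = 0 \<or> p = 0" "B = 0 \<or> q = 0" "C = 0 \<or> r = 0" "p = 0 \<or> q = 0" "p = 0 \<or> r = 0" "q = 0 \<or> r = 0"
    and "x = B + C + p" "y = A + C + q" "z = A + B + r"
  shows "p = excess x y z" "q = excess y x z" "r = excess z x y"
    "A = corner x y z" "B = corner y x z" "C = corner z x y"
proof -
  show p: "p = excess x y z" using excess_unique[of A B C p q r] assms by simp
  show q: "q = excess y x z" using excess_unique[of B A C q p r] assms by (auto simp: add.commute)
  show r: "r = excess z x y" using excess_unique[of C A B r p q] assms by (auto simp: add.commute)
  have sym: "excess x z y = excess x y z" "excess y z x = excess y x z" "excess z y x = excess z x y"
    by (simp_all add: excess_def)
  show "A = corner x y z" "B = corner y x z" "C = corner z x y"
    unfolding corner_def sym p[symmetric] q[symmetric] r[symmetric] by (simp_all add: assms(13-15))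
qed

lemma min_eqI: "q \<le> s \<Longrightarrow> q \<le> t \<Longrightarrow> s = q \<or> t = q \<Longrightarrow> q = min s t"
  for q s t :: real
  by linarith

text \<open>For a triple such as \<open>\<alpha>, b, c\<close>: the chord \<open>A\<close> crosses all three and is compatible with the
  other five remaining chords, which form a pentagon of compatible pairs.\<close>

lemma pentagon_weights:
  fixes a A B C q r :: real
  assumes nn: "0 \<le> a" "0 \<le> A" "0 \<le> B" "0 \<le> C" "0 \<le> q" "0 \<le> r"
    and d: "a = 0 \<or> B = 0" "a = 0 \<or> C = 0" "B = 0 \<or> q = 0" "C = 0 \<or> r = 0" "q = 0 \<or> r = 0"
    and eqs: "x = a + A + q + r" "y = A + C + q" "z = A + B + r"
  shows "A = min x (min y z)" "q = min (x - A) (y - A)" "r = min (x - A) (z - A)"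
proof -
  have "a + q + r = 0 \<or> C + q = 0 \<or> B + r = 0" using d by auto
  then have "x = A \<or> y = A \<or> z = A" "A \<le> x" "A \<le> y" "A \<le> z" using nn eqs by linarith+
  then show "A = min x (min y z)" by linarith
  have "a + r = 0 \<or> C = 0" "a + q = 0 \<or> B = 0" using d by auto
  then show "q = min (x - A) (y - A)" "r = min (x - A) (z - A)"
    using nn eqs by (intro min_eqI; linarith)+
qed

text \<open>For a triple such as \<open>a, A, \<beta>\<close>: the chord with weight \<open>p\<close> crosses all three and is compatible
  with a square of chords; the sixth remaining chord, of weight \<open>r\<close>, is compatible with two of these.\<close>

lemma square_weights:
  fixes b c B C p r :: real
  assumes nn: "0 \<le> b" "0 \<le> c" "0 \<le> B" "0 \<le> C" "0 \<le> p" "0 \<le> r"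
    and d: "b = 0 \<or> C = 0" "c = 0 \<or> B = 0" "p = 0 \<or> r = 0" "r = 0 \<or> c = 0" "r = 0 \<or> C = 0"
    and eqs: "x = B + C + p" "y = b + c + p" "z = b + B + p + r"
  shows "r = max 0 (z - x - y)" "p = max 0 (min (min x y) (min z (x + y - z)))"
    "b = min (y - p) (z - p - r)" "B = min (x - p) (z - p - r)"
proof -
  have "r = 0 \<or> C + c + p = 0" using d by auto
  then show "r = max 0 (z - x - y)" using nn eqs by linarith
  have "r > 0 \<and> C + c = 0 \<or> r = 0 \<and> (B + C = 0 \<or> b + c = 0 \<or> b + B + r = 0 \<or> C + c = 0)"
    using d nn by fastforce
  then have "min (min x y) (min z (x + y - z)) \<le> p" using nn eqs by linarith
  moreover have "p = 0 \<or> p \<le> min (min x y) (min z (x + y - z))" using d(3) nn eqs by linarith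
  ultimately show "p = max 0 (min (min x y) (min z (x + y - z)))"
    using nn(5) by (metis max.absorb1 max_absorb2 order_antisym)
  have "y - p = b \<or> z - p - r = b" "x - p = B \<or> z - p - r = B" using d(1,2) eqs by auto
  then show "b = min (y - p) (z - p - r)" "B = min (x - p) (z - p - r)"
    using nn eqs by (intro min_eqI; simp)+
qed

lemma triangle_unique:
  fixes A B C p q r :: real
  assumes "0 \<le> A" "0 \<le> B" "0 \<le> C" "0 \<le> p" "0 \<le> q" "0 \<le> r"
    "A = 0 \<or> p = 0" "B = 0 \<or> q = 0" "C = 0 \<or> r = 0" "p = 0 \<or> q = 0" "p = 0 \<or> r = 0" "q = 0 \<or> r = 0"
    "0 \<le> A'" "0 \<le> B'" "0 \<le> C'" "0 \<le> p'" "0 \<le> q'" "0 \<le> r'"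
    "A' = 0 \<or> p' = 0" "B' = 0 \<or> q' = 0" "C' = 0 \<or> r' = 0" "p' = 0 \<or> q' = 0" "p' = 0 \<or> r' = 0" "q' = 0 \<or> r' = 0"
    and "B + C + p = B' + C' + p'" "A + C + q = A' + C' + q'" "A + B + r = A' + B' + r'"
  shows "A = A' \<and> B = B' \<and> C = C' \<and> p = p' \<and> q = q' \<and> r = r'"
  using triangle_weights[OF assms(1-12) refl refl refl]
    triangle_weights[OF assms(13-24) refl refl refl] assms(25-27) by metis

lemma pentagon_unique:
  fixes a A B C q r :: real
  assumes "0 \<le> a" "0 \<le> A" "0 \<le> B" "0 \<le> C" "0 \<le> q" "0 \<le> r"
    "a = 0 \<or> B = 0" "a = 0 \<or> C = 0" "B = 0 \<or> q = 0" "C = 0 \<or> r = 0" "q = 0 \<or> r = 0"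
    "0 \<le> a'" "0 \<le> A'" "0 \<le> B'" "0 \<le> C'" "0 \<le> q'" "0 \<le> r'"
    "a' = 0 \<or> B' = 0" "a' = 0 \<or> C' = 0" "B' = 0 \<or> q' = 0" "C' = 0 \<or> r' = 0" "q' = 0 \<or> r' = 0"
    and eqs: "a + A + q + r = a' + A' + q' + r'" "A + C + q = A' + C' + q'" "A + B + r = A' + B' + r'"
  shows "a = a' \<and> A = A' \<and> B = B' \<and> C = C' \<and> q = q' \<and> r = r'"
proof -
  note 1 = pentagon_weights[OF assms(1-11) refl refl refl]
  note 2 = pentagon_weights[OF assms(12-22) refl refl refl]
  have A: "A = A'" using 1(1) 2(1) eqs by metis
  have "q = q'" "r = r'" using 1(2,3) 2(2,3) eqs A by metis+
  then show ?thesis using A eqs by simp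
qed

lemma square_unique:
  fixes b c B C p r :: real
  assumes "0 \<le> b" "0 \<le> c" "0 \<le> B" "0 \<le> C" "0 \<le> p" "0 \<le> r"
    "b = 0 \<or> C = 0" "c = 0 \<or> B = 0" "p = 0 \<or> r = 0" "r = 0 \<or> c = 0" "r = 0 \<or> C = 0"
    "0 \<le> b'" "0 \<le> c'" "0 \<le> B'" "0 \<le> C'" "0 \<le> p'" "0 \<le> r'"
    "b' = 0 \<or> C' = 0" "c' = 0 \<or> B' = 0" "p' = 0 \<or> r' = 0" "r' = 0 \<or> c' = 0" "r' = 0 \<or> C' = 0"
    and eqs: "B + C + p = B' + C' + p'" "b + c + p = b' + c' + p'" "b + B + p + r = b' + B' + p' + r'"
  shows "b = b' \<and> c = c' \<and> B = B' \<and> C = C' \<and> p = p' \<and> r = r'"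
proof -
  note 1 = square_weights[OF assms(1-11) refl refl refl]
  note 2 = square_weights[OF assms(12-22) refl refl refl]
  have r: "r = r'" using 1(1) 2(1) eqs by metis
  have p: "p = p'" using 1(2) 2(2) eqs by metis
  have "b = b'" "B = B'" using 1(3,4) 2(3,4) eqs r p by metis+
  then show ?thesis using r p eqs by simp
qed

definition triples :: "chord list list" where
  "triples =
    [[Parallel Side_a, Parallel Side_b, Parallel Side_c], [Parallel Side_A, Parallel Side_B, Parallel Side_C],
     [Alpha, Parallel Side_b, Parallel Side_c], [Beta, Parallel Side_a, Parallel Side_c],
     [Gamma, Parallel Side_a, Parallel Side_b],
     [Alpha, Parallel Side_B, Parallel Side_C], [Beta, Parallel Side_A, Parallel Side_C],
     [Gamma, Parallel Side_A, Parallel Side_B],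
     [Parallel Side_a, Parallel Side_A, Beta], [Parallel Side_b, Parallel Side_B, Alpha],
     [Parallel Side_c, Parallel Side_C, Alpha], [Parallel Side_a, Parallel Side_A, Gamma],
     [Parallel Side_b, Parallel Side_B, Gamma], [Parallel Side_c, Parallel Side_C, Beta]]"

lemma triples_complete:
  "\<forall>u\<in>set all_chords. \<forall>v\<in>set (filter (\<lambda>v. v \<noteq> u \<and> \<not> linked u v) all_chords).
   \<forall>t\<in>set (filter (\<lambda>t. t \<noteq> u \<and> t \<noteq> v \<and> \<not> linked u t \<and> \<not> linked v t) all_chords).
   list_ex (list_all (\<lambda>x. x = u \<or> x = v \<or> x = t)) triples"
  by code_simp

lemma vec_chord_eqI:
  fixes w w' :: "real ^ chord"
  assumes "w $ Parallel Side_a = w' $ Parallel Side_a" "w $ Parallel Side_b = w' $ Parallel Side_b"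
    "w $ Parallel Side_c = w' $ Parallel Side_c" "w $ Parallel Side_A = w' $ Parallel Side_A"
    "w $ Parallel Side_B = w' $ Parallel Side_B" "w $ Parallel Side_C = w' $ Parallel Side_C"
    "w $ Alpha = w' $ Alpha" "w $ Beta = w' $ Beta" "w $ Gamma = w' $ Gamma"
  shows "w = w'"
  using assms by (simp add: vec_eq_iff all_chord9)

lemma triple_coords_inj:
  assumes \<tau>: "\<tau> \<in> set triples" and w: "w \<in> weight_cone" "w' \<in> weight_cone"
    and z: "\<forall>v\<in>set \<tau>. w $ v = 0 \<and> w' $ v = 0 \<and> crossing w v = crossing w' v"
  shows "w = w'"
proof -
  let ?a = "Parallel Side_a" and ?b = "Parallel Side_b" and ?c = "Parallel Side_c"
    and ?A = "Parallel Side_A" and ?B = "Parallel Side_B" and ?C = "Parallel Side_C"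
  have nn: "0 \<le> w $ v" "0 \<le> w' $ v" for v using w by (auto simp: weight_cone_def)
  have tri: "w $ A = w' $ A \<and> w $ B = w' $ B \<and> w $ C = w' $ C \<and> w $ p = w' $ p \<and> w $ q = w' $ q \<and> w $ r = w' $ r"
    if "linked A p" "linked B q" "linked C r" "linked p q" "linked p r" "linked q r"
      "w $ B + w $ C + w $ p = w' $ B + w' $ C + w' $ p"
      "w $ A + w $ C + w $ q = w' $ A + w' $ C + w' $ q"
      "w $ A + w $ B + w $ r = w' $ A + w' $ B + w' $ r" for A B C p q r
    using that nn weight_coneD(2)[OF w(1)] weight_coneD(2)[OF w(2)]
    by (intro triangle_unique) auto
  have pent: "w $ a = w' $ a \<and> w $ A = w' $ A \<and> w $ B = w' $ B \<and> w $ C = w' $ C \<and> w $ q = w' $ q \<and> w $ r = w' $ r"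
    if "linked a B" "linked a C" "linked B q" "linked C r" "linked q r"
      "w $ a + w $ A + w $ q + w $ r = w' $ a + w' $ A + w' $ q + w' $ r"
      "w $ A + w $ C + w $ q = w' $ A + w' $ C + w' $ q"
      "w $ A + w $ B + w $ r = w' $ A + w' $ B + w' $ r" for a A B C q r
    using that nn weight_coneD(2)[OF w(1)] weight_coneD(2)[OF w(2)]
    by (intro pentagon_unique) auto
  have squ: "w $ b = w' $ b \<and> w $ c = w' $ c \<and> w $ B = w' $ B \<and> w $ C = w' $ C \<and> w $ p = w' $ p \<and> w $ r = w' $ r"
    if "linked b C" "linked c B" "linked p r" "linked r c" "linked r C"
      "w $ B + w $ C + w $ p = w' $ B + w' $ C + w' $ p"
      "w $ b + w $ c + w $ p = w' $ b + w' $ c + w' $ p"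
      "w $ b + w $ B + w $ p + w $ r = w' $ b + w' $ B + w' $ p + w' $ r" for b c B C p r
    using that nn weight_coneD(2)[OF w(1)] weight_coneD(2)[OF w(2)]
    by (intro square_unique) auto
  note sm = crossing_eqs linked_def interlaced_def
  from \<tau> show ?thesis
    unfolding triples_def set_simps
  proof (elim insertE emptyE)
    assume "\<tau> = [?a, ?b, ?c]"
    then show ?thesis using z tri[of ?A Alpha ?B Beta ?C Gamma] by (intro vec_chord_eqI) (simp_all add: sm)
  next
    assume "\<tau> = [?A, ?B, ?C]"
    then show ?thesis using z tri[of ?a Alpha ?b Beta ?c Gamma] by (intro vec_chord_eqI) (simp_all add: sm)
  next
    assume "\<tau> = [Alpha, ?b, ?c]"
    then show ?thesis using z pent[of ?a ?B ?C Beta Gamma ?A] by (intro vec_chord_eqI) (simp_all add: sm)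
  next
    assume "\<tau> = [Beta, ?a, ?c]"
    then show ?thesis using z pent[of ?b ?A ?C Alpha Gamma ?B] by (intro vec_chord_eqI) (simp_all add: sm)
  next
    assume "\<tau> = [Gamma, ?a, ?b]"
    then show ?thesis using z pent[of ?c ?A ?B Alpha Beta ?C] by (intro vec_chord_eqI) (simp_all add: sm)
  next
    assume "\<tau> = [Alpha, ?B, ?C]"
    then show ?thesis using z pent[of ?A ?b ?c Beta Gamma ?a] by (intro vec_chord_eqI) (simp_all add: sm)
  next
    assume "\<tau> = [Beta, ?A, ?C]"
    then show ?thesis using z pent[of ?B ?a ?c Alpha Gamma ?b] by (intro vec_chord_eqI) (simp_all add: sm)
  next
    assume "\<tau> = [Gamma, ?A, ?B]"
    then show ?thesis using z pent[of ?C ?a ?b Alpha Beta ?c] by (intro vec_chord_eqI) (simp_all add: sm)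
  next
    assume "\<tau> = [?a, ?A, Beta]"
    then show ?thesis using z squ[of ?b ?C ?c ?B Alpha Gamma] by (intro vec_chord_eqI) (simp_all add: sm)
  next
    assume "\<tau> = [?b, ?B, Alpha]"
    then show ?thesis using z squ[of ?a ?C ?c ?A Beta Gamma] by (intro vec_chord_eqI) (simp_all add: sm)
  next
    assume "\<tau> = [?c, ?C, Alpha]"
    then show ?thesis using z squ[of ?a ?B ?b ?A Gamma Beta] by (intro vec_chord_eqI) (simp_all add: sm)
  next
    assume "\<tau> = [?a, ?A, Gamma]"
    then show ?thesis using z squ[of ?c ?B ?b ?C Alpha Beta] by (intro vec_chord_eqI) (simp_all add: sm)
  next
    assume "\<tau> = [?b, ?B, Gamma]"
    then show ?thesis using z squ[of ?c ?A ?a ?C Beta Alpha] by (intro vec_chord_eqI) (simp_all add: sm)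
  next
    assume "\<tau> = [?c, ?C, Beta]"
    then show ?thesis using z squ[of ?b ?A ?a ?B Gamma Alpha] by (intro vec_chord_eqI) (simp_all add: sm)
  qed
qed

text \<open>The maximal sets of pairwise unlinked chords are the 14 arc triples, and each of them falls under
  one of the three patterns above.\<close>

lemma good_weights_inj:
  assumes T: "\<And>u v. u \<in> T \<Longrightarrow> v \<in> T \<Longrightarrow> \<not> linked u v" "card T = 3"
    and w: "w \<in> weight_cone" "w' \<in> weight_cone"
    and z: "\<And>v. v \<in> T \<Longrightarrow> w $ v = 0 \<and> w' $ v = 0 \<and> crossing w v = crossing w' v"
  shows "w = w'"
proof -
  obtain u v t where uvt: "T = {u, v, t}" "u \<noteq> v" "u \<noteq> t" "v \<noteq> t"
    using T(2) by (auto simp: card_3_iff)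
  then have "list_ex (list_all (\<lambda>x. x = u \<or> x = v \<or> x = t)) triples"
    using T(1) by (intro triples_complete[rule_format]) (auto simp: set_all_chords)
  then obtain \<tau> where "\<tau> \<in> set triples" "set \<tau> \<subseteq> T"
    by (auto simp: list_ex_iff list_all_iff uvt(1))
  then show ?thesis using z by (intro triple_coords_inj[OF _ w]) blast+
qed

text \<open>Every chord is crossed by all members of some arc triple. In the chart of that triple the chord
  has coordinates \<open>(1, 1, 1)\<close>, which lie inside the octant; this makes the chart a neighbourhood of
  every foliation containing the chord.\<close>

lemma opposite_triple:
  "\<exists>T. card T = 3 \<and> (\<forall>u\<in>T. \<forall>v\<in>T. \<not> linked u v) \<and> (\<forall>u\<in>T. linked v u)"
proof -
  have w: ?thesis if "u \<noteq> v'" "u \<noteq> t" "v' \<noteq> t" "\<not> linked u v'" "\<not> linked u t" "\<not> linked v' t"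
    "linked v u" "linked v v'" "linked v t" for u v' t
    using that linked_sym by (intro exI[of _ "{u, v', t}"]) auto
  let ?a = "Parallel Side_a" and ?b = "Parallel Side_b" and ?c = "Parallel Side_c"
    and ?A = "Parallel Side_A" and ?B = "Parallel Side_B" and ?C = "Parallel Side_C"
  note sm = linked_def interlaced_def
  show ?thesis
  proof (cases v rule: chord_cases)
    case a then show ?thesis by (intro w[of Alpha ?B ?C]) (simp_all add: sm)
  next
    case b then show ?thesis by (intro w[of Beta ?A ?C]) (simp_all add: sm)
  next
    case c then show ?thesis by (intro w[of Gamma ?A ?B]) (simp_all add: sm)
  next
    case A then show ?thesis by (intro w[of Alpha ?b ?c]) (simp_all add: sm)
  next
    case B then show ?thesis by (intro w[of Beta ?a ?c]) (simp_all add: sm)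
  next
    case C then show ?thesis by (intro w[of Gamma ?a ?b]) (simp_all add: sm)
  next
    case Alpha then show ?thesis by (intro w[of ?a ?A Beta]) (simp_all add: sm)
  next
    case Beta then show ?thesis by (intro w[of ?b ?B Alpha]) (simp_all add: sm)
  next
    case Gamma then show ?thesis by (intro w[of ?c ?C Alpha]) (simp_all add: sm)
  qed
qed

section \<open>Global piecewise linear coordinates\<close>

definition side_numbers :: "real ^ chord \<Rightarrow> real ^ side" where
  "side_numbers w = (\<chi> s. crossing w (Parallel s))"

text \<open>The weights in terms of the six side numbers. The three numbers of \<open>a\<close>, \<open>b\<close>, \<open>c\<close> determine the
  weights of all other chords, and those of \<open>A\<close>, \<open>B\<close>, \<open>C\<close> the weights of \<open>a\<close>, \<open>b\<close>, \<open>c\<close>.\<close>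

fun decode_at :: "real ^ side \<Rightarrow> chord \<Rightarrow> real" where
  "decode_at x (Parallel Side_A) = corner (x $ Side_a) (x $ Side_b) (x $ Side_c)"
| "decode_at x (Parallel Side_B) = corner (x $ Side_b) (x $ Side_a) (x $ Side_c)"
| "decode_at x (Parallel Side_C) = corner (x $ Side_c) (x $ Side_a) (x $ Side_b)"
| "decode_at x (Parallel Side_a) = corner (x $ Side_A) (x $ Side_B) (x $ Side_C)"
| "decode_at x (Parallel Side_b) = corner (x $ Side_B) (x $ Side_A) (x $ Side_C)"
| "decode_at x (Parallel Side_c) = corner (x $ Side_C) (x $ Side_A) (x $ Side_B)"
| "decode_at x Alpha = excess (x $ Side_a) (x $ Side_b) (x $ Side_c)"
| "decode_at x Beta = excess (x $ Side_b) (x $ Side_a) (x $ Side_c)"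
| "decode_at x Gamma = excess (x $ Side_c) (x $ Side_a) (x $ Side_b)"

lemma continuous_excess_corner [continuous_intros]:
  assumes "continuous_on S f" "continuous_on S g" "continuous_on S k"
  shows "continuous_on S (\<lambda>x. excess (f x) (g x) (k x))" "continuous_on S (\<lambda>x. corner (f x) (g x) (k x))"
  unfolding excess_def corner_def using assms by (intro continuous_intros; simp)+

lemma continuous_decode: "continuous_on UNIV (\<lambda>x. \<chi> v. decode_at x v)"
proof -
  have "continuous_on UNIV (\<lambda>x. decode_at x v)" for v
    by (cases v rule: chord_cases) (auto intro!: continuous_intros)
  then show ?thesis by (simp add: continuous_on_vec_lambda)
qed

lemma decode_side_numbers:
  assumes w: "w \<in> weight_cone"
  shows "(\<chi> v. decode_at (side_numbers w) v) = w"
proof -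
  have nn: "0 \<le> w $ v" for v using w by (auto simp: weight_cone_def)
  note lk = weight_cone_disj[OF w]
  note low = triangle_weights[OF nn nn nn nn nn nn lk(10-15) crossing_eqs(1-3)]
  note up = triangle_weights[OF nn nn nn nn nn nn lk(3,6,9,13-15) crossing_eqs(4-6)]
  show ?thesis
    by (intro vec_chord_eqI) (simp_all add: side_numbers_def flip: low up(4-6))
qed

text \<open>A chord that occurs in a foliation is not crossed by it, so of the intersection number with \<open>a\<close>
  and the weight of \<open>a\<close> at most one is nonzero, and the difference encodes both. The same holds for
  \<open>b\<close> and \<open>c\<close>. Hence the whole fan is mapped bijectively onto the space.\<close>

definition to_space :: "real ^ chord \<Rightarrow> real ^ 3" where
  "to_space w = vector [crossing w (Parallel Side_a) - w $ Parallel Side_a,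
     crossing w (Parallel Side_b) - w $ Parallel Side_b,
     crossing w (Parallel Side_c) - w $ Parallel Side_c]"

fun from_space_at :: "real ^ 3 \<Rightarrow> chord \<Rightarrow> real" where
  "from_space_at y (Parallel Side_a) = max 0 (- y $ 1)"
| "from_space_at y (Parallel Side_b) = max 0 (- y $ 2)"
| "from_space_at y (Parallel Side_c) = max 0 (- y $ 3)"
| "from_space_at y (Parallel Side_A) = corner (max 0 (y $ 1)) (max 0 (y $ 2)) (max 0 (y $ 3))"
| "from_space_at y (Parallel Side_B) = corner (max 0 (y $ 2)) (max 0 (y $ 1)) (max 0 (y $ 3))"
| "from_space_at y (Parallel Side_C) = corner (max 0 (y $ 3)) (max 0 (y $ 1)) (max 0 (y $ 2))"
| "from_space_at y Alpha = excess (max 0 (y $ 1)) (max 0 (y $ 2)) (max 0 (y $ 3))"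
| "from_space_at y Beta = excess (max 0 (y $ 2)) (max 0 (y $ 1)) (max 0 (y $ 3))"
| "from_space_at y Gamma = excess (max 0 (y $ 3)) (max 0 (y $ 1)) (max 0 (y $ 2))"

definition from_space :: "real ^ 3 \<Rightarrow> real ^ chord" where
  "from_space y = (\<chi> v. from_space_at y v)"

lemma linear_to_space: "linear to_space"
  by (auto simp: linear_iff to_space_def vec_eq_iff forall_3 algebra_simps)

text \<open>If the weight of \<open>a\<close> is positive, then the intersection number with \<open>a\<close> vanishes, and so do all
  three summands of that number, the weights of the chords crossing \<open>a\<close>.\<close>

lemma from_space_in_cone: "from_space y \<in> weight_cone"
proof -
  define X Y Z where "X = max 0 (y $ 1)" and "Y = max 0 (y $ 2)" and "Z = max 0 (y $ 3)"
  have nn: "0 \<le> X" "0 \<le> Y" "0 \<le> Z" by (auto simp: X_def Y_def Z_def)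
  have z: "corner v u t = 0 \<and> corner t u v = 0 \<and> excess u v t = 0" if "u = 0" "0 \<le> v" "0 \<le> t" for u v t
    using corner_excess_sum[of v u t] corner_nonneg[of v u t] corner_nonneg[of t u v] excess_nonneg[of u v t] that
    by linarith
  have sym: "corner u v t = corner u t v" "excess u v t = excess u t v" for u v t
    by (simp_all add: corner_def excess_def)
  have "X = 0 \<or> max 0 (- y $ 1) = 0" "Y = 0 \<or> max 0 (- y $ 2) = 0" "Z = 0 \<or> max 0 (- y $ 3) = 0"
    by (auto simp: X_def Y_def Z_def)
  then have neg: "max 0 (- y $ 1) = 0 \<or> corner Y X Z = 0 \<and> corner Z X Y = 0 \<and> excess X Y Z = 0"
    "max 0 (- y $ 2) = 0 \<or> corner X Y Z = 0 \<and> corner Z X Y = 0 \<and> excess Y X Z = 0"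
    "max 0 (- y $ 3) = 0 \<or> corner X Y Z = 0 \<and> corner Y X Z = 0 \<and> excess Z X Y = 0"
    using z[of X Y Z] z[of Y X Z] z[of Z X Y] nn sym by metis+
  note ex = corner_excess_disjoint[of X Y Z] corner_excess_disjoint[of Y X Z] corner_excess_disjoint[of Z X Y]
  have ex': "excess Y X Z = 0 \<or> excess Z X Y = 0" using ex nn sym by metis
  have "0 \<le> from_space_at y v" for v
    by (cases v rule: chord_cases) (simp_all add: excess_nonneg corner_nonneg)
  then show ?thesis
    unfolding from_space_def
    by (intro weight_coneI, unfold vec_lambda_beta from_space_at.simps X_def[symmetric] Y_def[symmetric] Z_def[symmetric])
      (use neg ex ex' nn in \<open>blast+\<close>)
qed

lemma to_space_from_space: "to_space (from_space y) = y"
proof -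
  define X Y Z where "X = max 0 (y $ 1)" and "Y = max 0 (y $ 2)" and "Z = max 0 (y $ 3)"
  have sym: "corner u v t = corner u t v" for u v t
    by (simp add: corner_def excess_def)
  have sums: "corner Y X Z + corner Z X Y + excess X Y Z = X"
    "corner X Y Z + corner Z X Y + excess Y X Z = Y"
    "corner X Y Z + corner Y X Z + excess Z X Y = Z"
    using corner_excess_sum[of Y X Z] corner_excess_sum[of X Y Z] corner_excess_sum[of X Z Y]
      sym[of Z X Y] sym[of X Y Z] sym[of Y X Z] by linarith+
  have "X - max 0 (- y $ 1) = y $ 1" "Y - max 0 (- y $ 2) = y $ 2" "Z - max 0 (- y $ 3) = y $ 3"
    by (auto simp: X_def Y_def Z_def)
  then show ?thesis
    by (simp add: to_space_def from_space_def vec_eq_iff forall_3 crossing_eqs sums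
        flip: X_def Y_def Z_def)
qed

lemma from_space_to_space:
  assumes w: "w \<in> weight_cone"
  shows "from_space (to_space w) = w"
proof -
  have nn: "0 \<le> w $ v" for v using w by (auto simp: weight_cone_def)
  note lk = weight_cone_disj[OF w]
  let ?x = "\<lambda>s. crossing w (Parallel s)"
  note low = triangle_weights[OF nn nn nn nn nn nn lk(10-15) crossing_eqs(1-3)]
  have pn: "max 0 (?x s - w $ Parallel s) = ?x s \<and> max 0 (w $ Parallel s - ?x s) = w $ Parallel s" for s
  proof -
    have "?x s \<ge> 0" unfolding crossing_def using nn by (simp add: sum_nonneg)
    moreover have "w $ Parallel s = 0 \<or> ?x s = 0"
    proof (rule disjCI)
      assume "?x s \<noteq> 0"
      then obtain u where "of_bool (linked u (Parallel s)) * w $ u \<noteq> 0"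
        unfolding crossing_def by (rule sum.not_neutral_contains_not_neutral)
      then show "w $ Parallel s = 0" using weight_coneD(2)[OF w, of u "Parallel s"] by (auto split: if_splits)
    qed
    ultimately show ?thesis using nn[of "Parallel s"] by auto
  qed
  show ?thesis
    using pn by (intro vec_chord_eqI) (simp_all add: from_space_def to_space_def flip: low)
qed

section \<open>The projective slice\<close>

definition side_total :: "real ^ chord \<Rightarrow> real" where
  "side_total w = (\<Sum>s\<in>UNIV. crossing w (Parallel s))"

text \<open>Projective classes are represented by the weights whose side numbers add up to 1.\<close>

definition slice :: "(real ^ chord) set" where
  "slice = {w \<in> weight_cone. side_total w = 1}"

lemma total_eq: "side_total w = 2 * (\<Sum>v\<in>UNIV. w $ v)"
  by (simp add: side_total_def UNIV_side crossing_eqs UNIV_chord)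

lemma linear_total: "linear side_total"
  by (auto simp: linear_iff total_eq sum.distrib sum_distrib_left algebra_simps)

lemmas total_linear_simps [simp] =
  linear_add[OF linear_total] linear_diff[OF linear_total]
  linear_cmul[OF linear_total] linear_0[OF linear_total]

lemma continuous_total [continuous_intros]:
  "continuous_on S f \<Longrightarrow> continuous_on S (\<lambda>x. side_total (f x))"
  unfolding side_total_def by (intro continuous_intros)

lemma weight_le_total:
  assumes "w \<in> weight_cone"
  shows "2 * w $ v \<le> side_total w"
proof -
  have "w $ v \<le> (\<Sum>v\<in>UNIV. w $ v)"
    using weight_coneD(1)[OF assms] by (intro member_le_sum) auto
  then show ?thesis by (simp add: total_eq)
qed

lemma total_pos:
  assumes "w \<in> weight_cone" "w \<noteq> 0"
  shows "0 < side_total w"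
proof -
  obtain v where "w $ v \<noteq> 0" using assms(2) by (auto simp: vec_eq_iff)
  then have "0 < w $ v" using weight_coneD(1)[OF assms(1), of v] by simp
  then show ?thesis using weight_le_total[OF assms(1), of v] by simp
qed

lemma crossing_nonneg: "w \<in> weight_cone \<Longrightarrow> 0 \<le> crossing w v"
  unfolding crossing_def using weight_coneD(1) by (simp add: sum_nonneg)

lemma zero_in_cone [simp]: "0 \<in> weight_cone"
  by (simp add: weight_cone_def)

lemma scale_in_cone: "w \<in> weight_cone \<Longrightarrow> 0 \<le> t \<Longrightarrow> t *\<^sub>R w \<in> weight_cone"
  by (auto simp: weight_cone_def)

lemma slice_nonzero: "w \<in> slice \<Longrightarrow> w \<in> weight_cone - {0}"
  by (auto simp: slice_def)

lemma normalize_in_slice: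
  assumes "w \<in> weight_cone - {0}"
  shows "(1 / side_total w) *\<^sub>R w \<in> slice"
  using assms total_pos[of w] scale_in_cone[of w "1 / side_total w"] by (auto simp: slice_def)

lemma closed_weight_cone: "closed weight_cone"
proof -
  have "weight_cone = (\<Inter>v. {w. 0 \<le> w $ v}) \<inter> (\<Inter>u. \<Inter>v. {w. linked u v \<longrightarrow> w $ u * w $ v = 0})"
    by (auto simp: weight_cone_def)
  also have "closed \<dots>"
    by (intro closed_Int closed_INT ballI closed_Collect_imp closed_Collect_le closed_Collect_eq
        open_Collect_const continuous_intros)
  finally show ?thesis .
qed

lemma compact_slice: "compact slice"
proof (rule compact_eq_bounded_closed[THEN iffD2], intro conjI)
  have "norm w \<le> 1" if w: "w \<in> slice" for w
  proof -
    have "norm w \<le> (\<Sum>v\<in>UNIV. \<bar>w $ v\<bar>)" by (rule norm_le_l1_cart)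
    also have "\<dots> = (\<Sum>v\<in>UNIV. w $ v)" using w by (auto simp: slice_def weight_cone_def)
    also have "\<dots> \<le> 1" using w by (simp add: slice_def total_eq)
    finally show ?thesis .
  qed
  then show "bounded slice" by (auto simp: bounded_iff)
  have "slice = weight_cone \<inter> {w. side_total w = 1}" by (auto simp: slice_def)
  moreover have "closed {w. side_total w = 1}"
    by (intro closed_Collect_eq continuous_intros)
  ultimately show "closed slice"
    using closed_Int[OF closed_weight_cone] by metis
qed

lemma to_space_eq_0: "w \<in> weight_cone \<Longrightarrow> to_space w = 0 \<longleftrightarrow> w = 0"
  using from_space_to_space[of w] from_space_to_space[of 0] linear_0[OF linear_to_space] by auto

text \<open>Every ray of the fan meets the slice once, and \<open>to_space\<close> maps the rays of the fan bijectively to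
  the rays of the space.\<close>

lemma slice_sphere:
  obtains f g where "homeomorphism slice (sphere (0 :: real ^ 3) 1) f g"
proof -
  define f where "f w = (1 / norm (to_space w)) *\<^sub>R to_space w" for w
  have nz: "norm (to_space w) > 0" if "w \<in> slice" for w
    using slice_nonzero[OF that] to_space_eq_0 by auto
  have "continuous_on slice f"
    unfolding f_def using nz linear_continuous_on[of to_space] linear_to_space
    by (intro continuous_intros) (auto simp: linear_conv_bounded_linear)
  moreover have "f ` slice = sphere 0 1"
  proof
    show "f ` slice \<subseteq> sphere 0 1" using nz by (auto simp: f_def)
    show "sphere 0 1 \<subseteq> f ` slice"
    proof
      fix y :: "real ^ 3" assume y: "y \<in> sphere 0 1"
      let ?w = "from_space y"
      have "?w \<noteq> 0"
      proof
        assume "?w = 0"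
        then have "y = 0"
          using to_space_from_space[of y] linear_0[OF linear_to_space] by simp
        then show False using y by simp
      qed
      then have w: "?w \<in> weight_cone - {0}" using from_space_in_cone by auto
      then have t: "side_total ?w > 0" using total_pos by auto
      have "f ((1 / side_total ?w) *\<^sub>R ?w) = y"
        using t y by (simp add: f_def linear_cmul[OF linear_to_space] to_space_from_space)
      then show "y \<in> f ` slice" using normalize_in_slice[OF w] by (metis imageI)
    qed
  qed
  moreover have "inj_on f slice"
  proof (rule inj_onI)
    fix w w' assume w: "w \<in> slice" "w' \<in> slice" and eq: "f w = f w'"
    define t where "t = norm (to_space w) / norm (to_space w')"
    have t: "t > 0" using nz w by (simp add: t_def)
    have "to_space w = norm (to_space w) *\<^sub>R f w" using nz[OF w(1)] by (simp add: f_def)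
    also have "\<dots> = t *\<^sub>R to_space w'" unfolding eq by (simp add: f_def t_def)
    also have "\<dots> = to_space (t *\<^sub>R w')" by (simp add: linear_cmul[OF linear_to_space])
    finally have "w = t *\<^sub>R w'"
      using from_space_to_space w t scale_in_cone by (metis (lifting) less_imp_le mem_Collect_eq slice_def)
    moreover from this have "t = 1" using w by (auto simp: slice_def)
    ultimately show "w = w'" by simp
  qed
  ultimately show ?thesis
    using homeomorphism_compact[OF compact_slice] that by blast
qed

section \<open>The space of projective classes\<close>

definition proj_class :: "(complex \<Rightarrow> 'a::topological_space) \<Rightarrow> real ^ chord \<Rightarrow> 'a foliation set" where
  "proj_class h w = ray (foliation_of h w)"

lemma mem_proj_class:
  "F \<in> proj_class h w \<longleftrightarrow> (\<exists>t>0. F = foliation_of h (t *\<^sub>R w))"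
  by (auto simp: proj_class_def ray_def foliation_of_scaleR)

lemma proj_class_scale:
  assumes "0 < t"
  shows "proj_class h (t *\<^sub>R w) = proj_class h w"
proof -
  have "(\<exists>s>0. F = foliation_of h (s *\<^sub>R t *\<^sub>R w)) \<longleftrightarrow> (\<exists>s>0. F = foliation_of h (s *\<^sub>R w))" for F
  proof
    assume "\<exists>s>0. F = foliation_of h (s *\<^sub>R t *\<^sub>R w)"
    then obtain s where "s > 0" "F = foliation_of h ((s * t) *\<^sub>R w)" by auto
    then show "\<exists>s>0. F = foliation_of h (s *\<^sub>R w)" using assms by (intro exI[of _ "s * t"]) auto
  next
    assume "\<exists>s>0. F = foliation_of h (s *\<^sub>R w)"
    then obtain s where "s > 0" "F = foliation_of h (s *\<^sub>R w)" by auto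
    then show "\<exists>s>0. F = foliation_of h (s *\<^sub>R t *\<^sub>R w)" using assms by (intro exI[of _ "s / t"]) auto
  qed
  then show ?thesis by (intro set_eqI) (simp add: mem_proj_class)
qed

lemma proj_class_normalize:
  "w \<in> weight_cone - {0} \<Longrightarrow> proj_class h ((1 / side_total w) *\<^sub>R w) = proj_class h w"
  using total_pos by (intro proj_class_scale) auto

lemma inj_proj_class:
  assumes "hexagon h"
  shows "inj_on (proj_class h) slice"
proof (rule inj_onI)
  fix w w' assume w: "w \<in> slice" "w' \<in> slice" and eq: "proj_class h w = proj_class h w'"
  have "foliation_of h w \<in> proj_class h w"
    unfolding mem_proj_class by (intro exI[of _ 1]) auto
  then obtain t where "foliation_of h w = foliation_of h (t *\<^sub>R w')"
    unfolding eq mem_proj_class by auto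
  then have "w = t *\<^sub>R w'" by (rule foliation_of_inj[OF assms])
  moreover from this have "t = 1" using w by (auto simp: slice_def)
  ultimately show "w = w'" by simp
qed

lemma proj_class_image_slice:
  assumes "S \<subseteq> weight_cone" "\<And>w t. w \<in> S \<Longrightarrow> 0 < t \<Longrightarrow> t *\<^sub>R w \<in> S"
  shows "proj_class h ` (S - {0}) = proj_class h ` (S \<inter> slice)"
proof
  show "proj_class h ` (S - {0}) \<subseteq> proj_class h ` (S \<inter> slice)"
  proof (rule image_subsetI)
    fix w assume w: "w \<in> S - {0}"
    then have "(1 / side_total w) *\<^sub>R w \<in> S \<inter> slice"
      using assms total_pos[of w] normalize_in_slice[of w] by auto
    moreover have "proj_class h w = proj_class h ((1 / side_total w) *\<^sub>R w)"
      using w assms(1) by (intro proj_class_normalize[symmetric]) auto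
    ultimately show "proj_class h w \<in> proj_class h ` (S \<inter> slice)" by blast
  qed
  show "proj_class h ` (S \<inter> slice) \<subseteq> proj_class h ` (S - {0})"
    using slice_nonzero by blast
qed

lemma PMF_eq:
  assumes "hexagon h"
  shows "PMF h = proj_class h ` slice"
proof -
  have "PMF h = proj_class h ` (weight_cone - {0})"
    by (simp add: PMF_def MF_eq[OF assms] image_image proj_class_def)
  also have "\<dots> = proj_class h ` (weight_cone \<inter> slice)"
    by (rule proj_class_image_slice) (auto intro: scale_in_cone)
  also have "weight_cone \<inter> slice = slice" by (auto simp: slice_def)
  finally show ?thesis .
qed

lemma side_vector_foliation_of:
  assumes "hexagon h" "w \<in> weight_cone"
  shows "(\<chi> s. int_number (foliation_of h w) (side_arc h s)) = side_numbers w"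
  using assms by (simp add: side_numbers_def side_arc_eq int_number_foliation_of)

lemma continuous_side_numbers: "continuous_on S side_numbers"
  unfolding side_numbers_def by (intro continuous_on_vec_lambda continuous_intros)

text \<open>The topology given by the six side numbers is the Euclidean topology of the weights, since
  weights and side numbers determine each other continuously.\<close>

lemma openin_MF_topology_iff:
  assumes "hexagon h" "S \<subseteq> MF h"
  shows "openin (MF_topology h) S \<longleftrightarrow>
    openin (top_of_set (weight_cone - {0})) {w \<in> weight_cone - {0}. foliation_of h w \<in> S}"
proof
  let ?f = "\<lambda>F. (\<chi> s. int_number F (side_arc h s)) :: real ^ side" and ?M = "weight_cone - {0}"
  assume "openin (MF_topology h) S"
  then obtain V where V: "open V" "S = ?f -` V \<inter> MF h"
    by (auto simp: MF_topology_def openin_pullback_topology)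
  have "{w \<in> ?M. foliation_of h w \<in> S} = ?M \<inter> side_numbers -` V"
    using V(2) by (auto simp: MF_eq[OF assms(1)] side_vector_foliation_of[OF assms(1)]
        dest!: foliation_of_inj[OF assms(1)])
  then show "openin (top_of_set ?M) {w \<in> ?M. foliation_of h w \<in> S}"
    using continuous_openin_preimage_gen[OF continuous_side_numbers V(1)] by simp
next
  let ?f = "\<lambda>F. (\<chi> s. int_number F (side_arc h s)) :: real ^ side" and ?M = "weight_cone - {0}"
  let ?dec = "\<lambda>x. (\<chi> v. decode_at x v)"
  assume "openin (top_of_set ?M) {w \<in> ?M. foliation_of h w \<in> S}"
  then obtain G where G: "open G" "{w \<in> ?M. foliation_of h w \<in> S} = ?M \<inter> G"
    by (auto simp: openin_open)
  have "open (?dec -` G)"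
    using continuous_open_vimage[OF G(1)] continuous_decode continuous_on_eq_continuous_at
    by (metis open_UNIV UNIV_I)
  moreover have "S = ?f -` (?dec -` G) \<inter> MF h"
  proof -
    have "foliation_of h w \<in> S \<longleftrightarrow> ?f (foliation_of h w) \<in> ?dec -` G" if "w \<in> ?M" for w
    proof -
      have "?dec (side_numbers w) = w" using that decode_side_numbers by auto
      then show ?thesis
        using that G(2) side_vector_foliation_of[OF assms(1), of w] by auto
    qed
    then have "F \<in> S \<longleftrightarrow> ?f F \<in> ?dec -` G" if "F \<in> MF h" for F
      using that unfolding MF_eq[OF assms(1)] by blast
    then show ?thesis using assms(2) by blast
  qed
  ultimately show "openin (MF_topology h) S"
    unfolding MF_topology_def openin_pullback_topology by auto
qed

lemma topspace_MF_topology: "topspace (MF_topology h) = MF h"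
  by (simp add: MF_topology_def topspace_pullback_topology)

lemma topspace_PMF_topology: "topspace (PMF_topology h) = PMF h"
proof
  show "topspace (PMF_topology h) \<subseteq> PMF h"
    using openin_PMF_topology[of h "topspace (PMF_topology h)"] by auto
  have "{F \<in> MF h. ray F \<in> PMF h} = topspace (MF_topology h)"
    by (auto simp: topspace_MF_topology PMF_def)
  then have "openin (PMF_topology h) (PMF h)"
    by (simp add: openin_PMF_topology)
  then show "PMF h \<subseteq> topspace (PMF_topology h)" by (rule openin_subset)
qed

text \<open>Normalising to the slice is a continuous retraction along rays, so a set of projective classes
  is open as soon as its representatives in the slice form an open set.\<close>

lemma homeomorphic_proj_class:
  assumes "hexagon h"
  shows "homeomorphic_map (top_of_set slice) (PMF_topology h) (proj_class h)"
  unfolding homeomorphic_map_def quotient_map_def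
proof (intro conjI allI impI)
  show "proj_class h ` topspace (top_of_set slice) = topspace (PMF_topology h)"
    by (simp add: topspace_PMF_topology PMF_eq[OF assms])
  show "inj_on (proj_class h) (topspace (top_of_set slice))"
    using inj_proj_class[OF assms] by simp
  fix U assume "U \<subseteq> topspace (PMF_topology h)"
  then have U: "U \<subseteq> PMF h" by (simp add: topspace_PMF_topology)
  let ?M = "weight_cone - {0}"
  let ?P = "{w \<in> ?M. proj_class h w \<in> U}" and ?Q = "{w \<in> slice. proj_class h w \<in> U}"
  have "openin (PMF_topology h) U \<longleftrightarrow> openin (MF_topology h) {F \<in> MF h. ray F \<in> U}"
    using U by (simp add: openin_PMF_topology)
  also have "\<dots> \<longleftrightarrow> openin (top_of_set ?M) {w \<in> ?M. foliation_of h w \<in> {F \<in> MF h. ray F \<in> U}}"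
    by (rule openin_MF_topology_iff[OF assms]) auto
  also have "{w \<in> ?M. foliation_of h w \<in> {F \<in> MF h. ray F \<in> U}} = ?P"
    unfolding MF_eq[OF assms] by (auto simp: proj_class_def)
  also have "openin (top_of_set ?M) ?P \<longleftrightarrow> openin (top_of_set slice) ?Q"
  proof
    assume P: "openin (top_of_set ?M) ?P"
    obtain G where G: "open G" "?P = ?M \<inter> G" using P by (auto simp: openin_open)
    have "?Q = slice \<inter> ?P" using slice_nonzero by blast
    also have "\<dots> = slice \<inter> G" unfolding G(2) using slice_nonzero by blast
    finally show "openin (top_of_set slice) ?Q" using G(1) by (auto simp: openin_open)
  next
    assume Q: "openin (top_of_set slice) ?Q"
    let ?n = "\<lambda>w. (1 / side_total w) *\<^sub>R w"
    have "continuous_on ?M ?n"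
      by (intro continuous_intros) (use total_pos in force)
    moreover have "?n \<in> ?M \<rightarrow> slice" using normalize_in_slice by auto
    ultimately have "openin (top_of_set ?M) (?M \<inter> ?n -` ?Q)"
      using Q by (intro continuous_openin_preimage[of _ _ slice]) auto
    moreover have "w \<in> ?n -` ?Q \<longleftrightarrow> proj_class h w \<in> U" if "w \<in> ?M" for w
      using normalize_in_slice[OF that] proj_class_normalize[OF that, of h] by simp
    then have "?M \<inter> ?n -` ?Q = ?P" by blast
    ultimately show "openin (top_of_set ?M) ?P" by simp
  qed
  finally show "openin (top_of_set slice) {x \<in> topspace (top_of_set slice). proj_class h x \<in> U} = openin (PMF_topology h) U"
    by simp
qed

lemma normalized_rep_proj_class:
  assumes "hexagon h" "w \<in> slice"
  shows "normalized_rep h (proj_class h w) = foliation_of h w"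
  unfolding normalized_rep_def
proof (rule the_equality)
  have sum: "(\<Sum>s\<in>UNIV. int_number (foliation_of h u) (side_arc h s)) = side_total u" if "u \<in> weight_cone" for u
    using that by (simp add: side_total_def side_arc_eq[OF assms(1)] int_number_foliation_of[OF assms(1)])
  have w: "w \<in> weight_cone" "side_total w = 1" using assms(2) by (auto simp: slice_def)
  show "foliation_of h w \<in> proj_class h w \<and> (\<Sum>s\<in>UNIV. int_number (foliation_of h w) (side_arc h s)) = 1"
    using w sum[of w] by (auto simp: mem_proj_class intro!: exI[of _ 1])
  fix F assume F: "F \<in> proj_class h w \<and> (\<Sum>s\<in>UNIV. int_number F (side_arc h s)) = 1"
  then obtain t where t: "t > 0" "F = foliation_of h (t *\<^sub>R w)" by (auto simp: mem_proj_class)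
  then have "side_total (t *\<^sub>R w) = 1" using F sum[of "t *\<^sub>R w"] scale_in_cone[OF w(1)] by auto
  then show "F = foliation_of h w" using t w by simp
qed

section \<open>Linear maps on polyhedra\<close>

lemma polyhedron_affine_preimage:
  fixes L :: "'b::euclidean_space \<Rightarrow> 'c::euclidean_space"
  assumes "linear L" "polyhedron D"
  shows "polyhedron {y. L y + c \<in> D}"
proof -
  obtain F where F: "finite F" "D = \<Inter>F" "\<forall>h\<in>F. \<exists>a b. a \<noteq> 0 \<and> h = {x. a \<bullet> x \<le> b}"
    using assms(2) unfolding polyhedron_def by (elim exE conjE) (rule that)
  have "polyhedron {y. L y + c \<in> h}" if hF: "h \<in> F" for h
  proof -
    obtain a b where h: "h = {x. a \<bullet> x \<le> b}" using F(3) hF by blast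
    have "a \<bullet> L y = adjoint L a \<bullet> y" for y
      using adjoint_works[OF assms(1), of y a] by (simp add: inner_commute)
    then have "{y. L y + c \<in> h} = {y. adjoint L a \<bullet> y \<le> b - a \<bullet> c}"
      by (simp add: h inner_add_right le_diff_eq)
    then show ?thesis by (simp add: polyhedron_halfspace_le)
  qed
  moreover have "{y. L y + c \<in> D} = (\<Inter>h\<in>F. {y. L y + c \<in> h})" by (auto simp: F(2))
  ultimately show ?thesis using F(1) by (auto intro!: polyhedron_Inter)
qed

text \<open>Near a point of the relative interior, injectivity on a convex set is injectivity on its affine
  hull, so the inverse extends to an affine map.\<close>

lemma injective_on_convex_left_inverse:
  fixes f :: "'b::euclidean_space \<Rightarrow> 'c::euclidean_space"
  assumes "convex D" "linear f" "inj_on f D"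
  obtains L c where "linear L" "\<And>x. x \<in> D \<Longrightarrow> L (f x) + c = x"
proof (cases "D = {}")
  case True
  then show ?thesis using that[of "\<lambda>_. 0"] by (auto simp: linear_iff)
next
  case False
  then obtain p where "p \<in> rel_interior D"
    using rel_interior_eq_empty[OF assms(1)] by blast
  then obtain e where p: "p \<in> D" and e: "e > 0" "ball p e \<inter> affine hull D \<subseteq> D"
    by (auto simp: mem_rel_interior_ball)
  define T where "T = (\<lambda>x. x - p) ` (affine hull D)"
  have T: "subspace T"
    unfolding T_def using affine_diffs_subspace_subtract[of "affine hull D" p] p hull_inc by fastforce
  have "inj_on f T"
    unfolding linear_inj_on_iff_eq_0[OF assms(2) T]
  proof (intro ballI impI)
    fix t assume t: "t \<in> T" "f t = 0"
    define n where "n = norm t + 1"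
    define s where "s = e / (2 * n)"
    have nt: "n > 0" by (simp add: n_def add_nonneg_pos)
    have s: "s > 0" using e nt by (simp add: s_def)
    have "s * norm t < e"
    proof -
      have "s * norm t \<le> s * n" using s by (simp add: n_def)
      also have "\<dots> = e / 2" using nt by (simp add: s_def)
      finally show ?thesis using e by simp
    qed
    then have "p + s *\<^sub>R t \<in> ball p e" using s by (simp add: dist_norm)
    moreover have "s *\<^sub>R t \<in> T" using T t(1) by (rule subspace_scale)
    then have "p + s *\<^sub>R t \<in> affine hull D" by (auto simp: T_def)
    ultimately have "p + s *\<^sub>R t \<in> D" using e by auto
    moreover have "f (p + s *\<^sub>R t) = f p"
      using t(2) by (simp add: linear_add[OF assms(2)] linear_cmul[OF assms(2)])
    ultimately have "p + s *\<^sub>R t = p" using p assms(3) by (auto dest: inj_onD)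
    then show "t = 0" using s by simp
  qed
  then obtain L where L: "linear L" "\<forall>t\<in>T. L (f t) = t"
    using linear_exists_left_inverse_on[OF assms(2) T] by blast
  have "L (f x) + (p - L (f p)) = x" if "x \<in> D" for x
  proof -
    have "x - p \<in> T" unfolding T_def using hull_inc[OF that, of affine] by (rule imageI)
    then have "L (f (x - p)) = x - p" using L by blast
    then show ?thesis by (simp add: linear_diff[OF assms(2)] linear_diff[OF L(1)] algebra_simps)
  qed
  then show ?thesis using that L(1) by blast
qed

text \<open>With an affine left inverse the image becomes the intersection of an affine set with a preimage
  of the polyhedron.\<close>

lemma polyhedron_injective_linear_image:
  fixes f :: "'b::euclidean_space \<Rightarrow> 'c::euclidean_space"
  assumes "polyhedron D" "linear f" "inj_on f D"
  shows "polyhedron (f ` D)"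
proof -
  obtain L c where L: "linear L" "\<And>x. x \<in> D \<Longrightarrow> L (f x) + c = x"
    using injective_on_convex_left_inverse[OF polyhedron_imp_convex[OF assms(1)] assms(2,3)] by blast
  have "f ` D = {y. f (L y + c) = y} \<inter> {y. L y + c \<in> D}"
    using L(2) by (auto intro!: image_eqI)
  moreover have "affine {y. f (L y + c) = y}"
  proof -
    have "f (L (u *\<^sub>R x + v *\<^sub>R y) + c) = u *\<^sub>R f (L x + c) + v *\<^sub>R f (L y + c)" if "u + v = 1" for u v x y
    proof -
      have "f c = u *\<^sub>R f c + v *\<^sub>R f c" using that by (simp flip: scaleR_left_distrib)
      then show ?thesis
        using linear_add[OF assms(2)] linear_cmul[OF assms(2)] linear_add[OF L(1)] linear_cmul[OF L(1)]
        by (simp add: scaleR_right_distrib)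
    qed
    then show ?thesis by (simp add: affine_def)
  qed
  ultimately show ?thesis
    using polyhedron_affine_preimage[OF L(1) assms(1)] by (simp add: affine_imp_polyhedron)
qed

lemma polyhedral_injective_linear_image:
  fixes f :: "'b::euclidean_space \<Rightarrow> 'c::euclidean_space"
  assumes "finite \<D>" "\<And>D. D \<in> \<D> \<Longrightarrow> polyhedron D" "linear f" "inj_on f (\<Union>\<D>)"
  shows "polyhedral (f ` (\<Union>\<D>))"
  unfolding polyhedral_def
proof (intro exI[of _ "(\<lambda>D. f ` D) ` \<D>"] conjI ballI)
  fix P assume "P \<in> (\<lambda>D. f ` D) ` \<D>"
  then show "polyhedron P"
    using assms by (auto intro!: polyhedron_injective_linear_image intro: inj_on_subset)
qed (use assms in auto)

text \<open>A transition between two linear images of one polyhedral complex is affine on each cell: it is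
  the second linear map after the affine inverse of the first.\<close>

lemma piecewise_linear_transition:
  fixes f :: "'b::euclidean_space \<Rightarrow> 'c::euclidean_space" and g :: "'b \<Rightarrow> 'd::euclidean_space"
  assumes \<D>: "finite \<D>" "\<And>D. D \<in> \<D> \<Longrightarrow> polyhedron D" "inj_on f (\<Union>\<D>)"
    and lin: "linear f" "linear g" and S: "S \<subseteq> \<Union>\<D>" "\<And>x. x \<in> S \<Longrightarrow> k (f x) = g x"
  shows "piecewise_linear_on (f ` S) k"
  unfolding piecewise_linear_on_def
proof (intro exI[of _ "(\<lambda>D. f ` D) ` \<D>"] conjI ballI)
  show "finite ((\<lambda>D. f ` D) ` \<D>)" "f ` S \<subseteq> \<Union> ((\<lambda>D. f ` D) ` \<D>)" using \<D>(1) S(1) by auto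
  fix P assume "P \<in> (\<lambda>D. f ` D) ` \<D>"
  then obtain D where D: "D \<in> \<D>" "P = f ` D" by auto
  have inj: "inj_on f D" using \<D>(3) D(1) by (auto intro: inj_on_subset)
  show "polyhedron P"
    using polyhedron_injective_linear_image[OF \<D>(2)[OF D(1)] lin(1) inj] D(2) by simp
  obtain L c where L: "linear L" "\<And>x. x \<in> D \<Longrightarrow> L (f x) + c = x"
    using injective_on_convex_left_inverse[OF polyhedron_imp_convex[OF \<D>(2)[OF D(1)]] lin(1) inj] by blast
  show "\<exists>A v. linear A \<and> (\<forall>y\<in>f ` S \<inter> P. k y = A y + v)"
  proof (intro exI conjI ballI)
    show "linear (g \<circ> L)" using L(1) lin(2) by (rule linear_compose)
    fix y assume "y \<in> f ` S \<inter> P"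
    then obtain x x' where x: "x \<in> S" "y = f x" "x' \<in> D" "y = f x'" using D(2) by auto
    then have "x = x'" using \<D>(3) S(1) D(1) by (auto dest: inj_onD)
    then have "k y = g (L (f x) + c)" using x S(2) L(2) by simp
    then show "k y = (g \<circ> L) y + g c" using x by (simp add: linear_add[OF lin(2)])
  qed
qed

section \<open>Charts\<close>

text \<open>The cones of the fan; those of unlinked sets make up the weight cone.\<close>

definition cell :: "chord set \<Rightarrow> (real ^ chord) set" where
  "cell \<sigma> = {w. (\<forall>v. 0 \<le> w $ v) \<and> (\<forall>v. v \<notin> \<sigma> \<longrightarrow> w $ v = 0)}"

definition unlinked :: "chord set \<Rightarrow> bool" where
  "unlinked \<sigma> \<longleftrightarrow> (\<forall>u\<in>\<sigma>. \<forall>v\<in>\<sigma>. \<not> linked u v)"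

lemma polyhedron_cell: "polyhedron (cell \<sigma>)"
proof -
  have "cell \<sigma> = (\<Inter>v. {w. axis v 1 \<bullet> w \<ge> 0}) \<inter> (\<Inter>v\<in>-\<sigma>. {w. axis v 1 \<bullet> w = 0})"
    by (auto simp: cell_def inner_axis')
  also have "polyhedron \<dots>"
    by (intro polyhedron_Int polyhedron_Inter) (auto simp: polyhedron_halfspace_ge polyhedron_hyperplane)
  finally show ?thesis .
qed

lemma cell_subset_cone: "unlinked \<sigma> \<Longrightarrow> cell \<sigma> \<subseteq> weight_cone"
  by (auto simp: cell_def unlinked_def weight_cone_def)

lemma cone_in_cell:
  assumes "w \<in> weight_cone"
  shows "w \<in> cell {v. w $ v \<noteq> 0}" "unlinked {v. w $ v \<noteq> 0}"
  using assms by (auto simp: cell_def unlinked_def weight_cone_def)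

lemma polyhedron_cell_slice: "polyhedron (cell \<sigma> \<inter> {w. side_total w = 1})"
proof -
  have "side_total w = (\<Sum>v\<in>UNIV. 2 * w $ v)" for w by (simp add: total_eq sum_distrib_left)
  then have "{w. side_total w = 1} = {w. (\<chi> v. 2) \<bullet> w = 1}"
    by (simp add: inner_vec_def)
  then show ?thesis by (simp add: polyhedron_cell polyhedron_hyperplane)
qed

definition good_weights :: "(3 \<Rightarrow> chord) \<Rightarrow> (real ^ chord) set" where
  "good_weights c = {w \<in> weight_cone. \<forall>j. w $ c j = 0}"

definition chord_coords :: "(3 \<Rightarrow> chord) \<Rightarrow> real ^ chord \<Rightarrow> real ^ 3" where
  "chord_coords c w = (\<chi> j. crossing w (c j))"

definition chord_triple :: "(3 \<Rightarrow> chord) \<Rightarrow> bool" where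
  "chord_triple c \<longleftrightarrow> inj c \<and> unlinked (range c)"

lemma linear_chord_coords: "linear (chord_coords c)"
  by (auto simp: linear_iff chord_coords_def vec_eq_iff)

lemma arc_triple_iff:
  assumes "hexagon h"
  shows "arc_triple h d \<longleftrightarrow> (\<exists>c. chord_triple c \<and> d = chord_class h \<circ> c)"
proof
  assume d: "arc_triple h d"
  define c where "c = class_chord h \<circ> d"
  have "d j \<in> range (chord_class h)" for j
    using d arc_classes_eq[OF assms] by (auto simp: arc_triple_def)
  then have "chord_class h (class_chord h (d j)) = d j" for j
    using class_chord[OF assms] by (metis imageE)
  then have dc: "d = chord_class h \<circ> c" by (auto simp: c_def)
  have "inj c" using d unfolding dc arc_triple_def by (auto intro: inj_on_imageI2)
  moreover have "range d = chord_class h ` range c" using dc by auto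
  then have "unlinked (range c)"
    using d disjoint_reps_iff[OF assms, of "range c"] by (simp add: arc_triple_def unlinked_def)
  ultimately show "\<exists>c. chord_triple c \<and> d = chord_class h \<circ> c" using dc by (auto simp: chord_triple_def)
next
  assume "\<exists>c. chord_triple c \<and> d = chord_class h \<circ> c"
  then obtain c where c: "inj c" "unlinked (range c)" "d = chord_class h \<circ> c"
    by (auto simp: chord_triple_def)
  have r: "range d = chord_class h ` range c" using c(3) by auto
  have "inj d" unfolding c(3) by (rule inj_compose[OF inj_chord_class[OF assms] c(1)])
  moreover have "\<exists>r. disjoint_reps (range d) r"
    unfolding r disjoint_reps_iff[OF assms] using c(2) by (simp add: unlinked_def)
  moreover have "range d \<subseteq> arc_classes h" unfolding r arc_classes_eq[OF assms] by auto
  ultimately show "arc_triple h d" by (simp add: arc_triple_def)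
qed

lemma good_weights_subset: "good_weights c \<subseteq> weight_cone"
  by (auto simp: good_weights_def)

lemma chord_coords_inj:
  assumes "chord_triple c"
  shows "inj_on (chord_coords c) (good_weights c)"
proof (rule inj_onI)
  fix w w' assume w: "w \<in> good_weights c" "w' \<in> good_weights c" and eq: "chord_coords c w = chord_coords c w'"
  show "w = w'"
  proof (rule good_weights_inj)
    show "card (range c) = 3" using assms by (simp add: chord_triple_def card_image)
    show "\<not> linked u v" if "u \<in> range c" "v \<in> range c" for u v
      using assms that by (auto simp: chord_triple_def unlinked_def)
    show "w $ v = 0 \<and> w' $ v = 0 \<and> crossing w v = crossing w' v" if "v \<in> range c" for v
      using that w eq by (auto simp: good_weights_def chord_coords_def vec_eq_iff)
  qed (use w in \<open>auto simp: good_weights_def\<close>)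
qed

lemma good_weights_cells:
  "good_weights c = \<Union> {cell \<sigma> |\<sigma>. unlinked \<sigma> \<and> \<sigma> \<inter> range c = {}}"
proof
  show "good_weights c \<subseteq> \<Union> {cell \<sigma> |\<sigma>. unlinked \<sigma> \<and> \<sigma> \<inter> range c = {}}"
  proof
    fix w assume w: "w \<in> good_weights c"
    then have "w \<in> cell {v. w $ v \<noteq> 0}" "unlinked {v. w $ v \<noteq> 0}" "{v. w $ v \<noteq> 0} \<inter> range c = {}"
      using cone_in_cell by (auto simp: good_weights_def)
    then show "w \<in> \<Union> {cell \<sigma> |\<sigma>. unlinked \<sigma> \<and> \<sigma> \<inter> range c = {}}" by blast
  qed
  show "\<Union> {cell \<sigma> |\<sigma>. unlinked \<sigma> \<and> \<sigma> \<inter> range c = {}} \<subseteq> good_weights c"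
  proof (rule Union_least)
    fix D assume "D \<in> {cell \<sigma> |\<sigma>. unlinked \<sigma> \<and> \<sigma> \<inter> range c = {}}"
    then obtain \<sigma> where \<sigma>: "D = cell \<sigma>" "unlinked \<sigma>" "\<sigma> \<inter> range c = {}" by blast
    have "w $ c j = 0" if "w \<in> cell \<sigma>" for w j using that \<sigma>(3) by (auto simp: cell_def)
    then show "D \<subseteq> good_weights c" using cell_subset_cone[OF \<sigma>(2)] \<sigma>(1) by (auto simp: good_weights_def)
  qed
qed

lemma finite_cells: "finite {F \<sigma> |\<sigma> :: chord set. P \<sigma>}"
  by (rule finite_image_set) simp

lemma coords_foliation_of:
  assumes "hexagon h" "w \<in> weight_cone"
  shows "coords (chord_class h \<circ> c) (foliation_of h w) = chord_coords c w"
  using int_number_foliation_of[OF assms] by (simp add: coords_def chord_coords_def)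

text \<open>The intersection numbers of a nonzero good weight have positive sum, since otherwise it would have
  the same coordinates as the zero weight.\<close>

lemma MF_good_eq:
  assumes "hexagon h" "chord_triple c"
  shows "MF_good h (chord_class h \<circ> c) = foliation_of h ` (good_weights c - {0})"
proof -
  have lc: "chord_class h v \<in> leaf_classes (foliation_of h w) \<longleftrightarrow> w $ v \<noteq> 0" for v w
    using assms(1) by (simp add: leaf_classes_def)
  have pos: "(\<Sum>j\<in>UNIV. crossing w (c j)) > 0" if w: "w \<in> good_weights c" "w \<noteq> 0" for w
  proof -
    have nn: "0 \<le> crossing w (c j)" for j using w by (intro crossing_nonneg) (auto simp: good_weights_def)
    have "0 \<in> good_weights c" by (simp add: good_weights_def)
    then have "chord_coords c w \<noteq> chord_coords c 0"
      using chord_coords_inj[OF assms(2)] w by (auto dest: inj_onD)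
    then obtain j where "crossing w (c j) \<noteq> 0" by (auto simp: chord_coords_def vec_eq_iff)
    then show ?thesis using nn by (intro sum_pos2[of _ j]) (auto simp: less_le)
  qed
  show ?thesis
  proof
    show "MF_good h (chord_class h \<circ> c) \<subseteq> foliation_of h ` (good_weights c - {0})"
      by (auto simp: MF_good_def MF_eq[OF assms(1)] lc good_weights_def)
    show "foliation_of h ` (good_weights c - {0}) \<subseteq> MF_good h (chord_class h \<circ> c)"
    proof (rule image_subsetI)
      fix w assume w: "w \<in> good_weights c - {0}"
      then have wc: "w \<in> weight_cone" by (auto simp: good_weights_def)
      then have "(\<Sum>j\<in>UNIV. int_number (foliation_of h w) ((chord_class h \<circ> c) j)) > 0"
        using pos[of w] w by (simp add: int_number_foliation_of[OF assms(1)])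
      then show "foliation_of h w \<in> MF_good h (chord_class h \<circ> c)"
        using w wc by (auto simp: MF_good_def MF_eq[OF assms(1)] lc good_weights_def)
    qed
  qed
qed

lemma PMF_good_eq:
  assumes "hexagon h" "chord_triple c"
  shows "PMF_good h (chord_class h \<circ> c) = proj_class h ` (good_weights c \<inter> slice)"
proof -
  have "PMF_good h (chord_class h \<circ> c) = proj_class h ` (good_weights c - {0})"
    by (simp add: PMF_good_def MF_good_eq[OF assms] image_image proj_class_def)
  also have "\<dots> = proj_class h ` (good_weights c \<inter> slice)"
    by (rule proj_class_image_slice) (auto simp: good_weights_def intro: scale_in_cone)
  finally show ?thesis .
qed

lemma proj_coords_proj_class:
  assumes "hexagon h" "w \<in> slice"
  shows "proj_coords h (chord_class h \<circ> c) (proj_class h w) = chord_coords c w"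
  using assms coords_foliation_of[OF assms(1), of w]
  by (simp add: proj_coords_def normalized_rep_proj_class slice_def)

lemma coords_image_inj:
  assumes "hexagon h" "chord_triple c"
  defines "d \<equiv> chord_class h \<circ> c"
  shows "coords d ` MF_good h d \<subseteq> {x. \<forall>j. 0 \<le> x $ j} - {0}" "inj_on (coords d) (MF_good h d)"
proof -
  have co: "coords d (foliation_of h w) = chord_coords c w" if "w \<in> good_weights c" for w
    unfolding d_def using that good_weights_subset by (intro coords_foliation_of assms) auto
  have inj: "inj_on (chord_coords c) (good_weights c)" by (rule chord_coords_inj[OF assms(2)])
  have z: "0 \<in> good_weights c" "chord_coords c 0 = 0"
    by (simp_all add: good_weights_def linear_0[OF linear_chord_coords])
  show "coords d ` MF_good h d \<subseteq> {x. \<forall>j. 0 \<le> x $ j} - {0}"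
  proof
    fix x assume "x \<in> coords d ` MF_good h d"
    then obtain w where w: "w \<in> good_weights c" "w \<noteq> 0" "x = chord_coords c w"
      unfolding d_def MF_good_eq[OF assms(1,2)] using co by (auto simp: d_def)
    have "x \<noteq> 0" using inj_onD[OF inj _ w(1) z(1)] w z by auto
    moreover have "0 \<le> x $ j" for j
      using w good_weights_subset crossing_nonneg by (auto simp: chord_coords_def)
    ultimately show "x \<in> {x. \<forall>j. 0 \<le> x $ j} - {0}" by simp
  qed
  have "inj_on (coords d) (foliation_of h ` (good_weights c - {0}))"
  proof (rule inj_onI)
    fix F G assume "F \<in> foliation_of h ` (good_weights c - {0})" "G \<in> foliation_of h ` (good_weights c - {0})"
      and eq: "coords d F = coords d G"
    then obtain w w' where w: "F = foliation_of h w" "G = foliation_of h w'" "w \<in> good_weights c" "w' \<in> good_weights c"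
      by auto
    then have "chord_coords c w = chord_coords c w'" using eq co by simp
    then show "F = G" using inj_onD[OF inj] w by auto
  qed
  then show "inj_on (coords d) (MF_good h d)"
    unfolding d_def MF_good_eq[OF assms(1,2)] .
qed

lemma coords_transition:
  assumes "hexagon h" "chord_triple c" "chord_triple c'"
  defines "d \<equiv> chord_class h \<circ> c" and "d' \<equiv> chord_class h \<circ> c'"
  shows "piecewise_linear_on (coords d ` (MF_good h d \<inter> MF_good h d'))
    (coords d' \<circ> inv_into (MF_good h d) (coords d))"
proof -
  let ?S = "good_weights c \<inter> good_weights c' - {0}"
  have MFs: "MF_good h d \<inter> MF_good h d' = foliation_of h ` ?S"
    unfolding d_def d'_def MF_good_eq[OF assms(1,2)] MF_good_eq[OF assms(1,3)]
    using foliation_of_inj[OF assms(1)] by blast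
  have co: "coords d (foliation_of h w) = chord_coords c w" "coords d' (foliation_of h w) = chord_coords c' w"
    if "w \<in> ?S" for w
    unfolding d_def d'_def using that good_weights_subset by (intro coords_foliation_of assms; blast)+
  have im: "coords d ` (MF_good h d \<inter> MF_good h d') = chord_coords c ` ?S"
    unfolding MFs image_image using co(1) by (intro image_cong) auto
  show ?thesis
    unfolding im
  proof (rule piecewise_linear_transition[OF finite_cells, where g = "chord_coords c'"])
    show "polyhedron D" if "D \<in> {cell \<sigma> |\<sigma>. unlinked \<sigma> \<and> \<sigma> \<inter> range c = {}}" for D
      using that polyhedron_cell by auto
    show "inj_on (chord_coords c) (\<Union> {cell \<sigma> |\<sigma>. unlinked \<sigma> \<and> \<sigma> \<inter> range c = {}})"
      using chord_coords_inj[OF assms(2)] by (simp flip: good_weights_cells)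
    show "?S \<subseteq> \<Union> {cell \<sigma> |\<sigma>. unlinked \<sigma> \<and> \<sigma> \<inter> range c = {}}"
      by (auto simp flip: good_weights_cells)
    show "linear (chord_coords c)" "linear (chord_coords c')" by (rule linear_chord_coords)+
    fix w assume w: "w \<in> ?S"
    then have "foliation_of h w \<in> MF_good h d"
      unfolding d_def MF_good_eq[OF assms(1,2)] by auto
    then have "inv_into (MF_good h d) (coords d) (chord_coords c w) = foliation_of h w"
      using coords_image_inj(2)[OF assms(1,2)] inv_into_f_f co(1)[OF w] unfolding d_def by metis
    then show "(coords d' \<circ> inv_into (MF_good h d) (coords d)) (chord_coords c w) = chord_coords c' w"
      using co(2)[OF w] by simp
  qed
qed

subsection \<open>Charts of the projective space\<close>

lemma proj_chart_image:
  assumes "hexagon h" "S \<subseteq> slice"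
  shows "proj_coords h (chord_class h \<circ> c) ` proj_class h ` S = chord_coords c ` S"
  unfolding image_image using assms by (intro image_cong) (auto simp: proj_coords_proj_class)

lemma proj_chart_polyhedral:
  assumes "hexagon h" "chord_triple c" "chord_triple c'"
  defines "d \<equiv> chord_class h \<circ> c" and "d' \<equiv> chord_class h \<circ> c'"
  shows "polyhedral (proj_coords h d ` (PMF_good h d \<inter> PMF_good h d'))"
    "piecewise_linear_on (proj_coords h d ` (PMF_good h d \<inter> PMF_good h d'))
       (proj_coords h d' \<circ> inv_into (PMF_good h d) (proj_coords h d))"
proof -
  let ?S = "good_weights c \<inter> good_weights c' \<inter> slice"
  let ?P = "\<lambda>\<sigma>. cell \<sigma> \<inter> {w. side_total w = 1}"
  have meet: "PMF_good h d \<inter> PMF_good h d' = proj_class h ` ?S"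
    unfolding d_def d'_def PMF_good_eq[OF assms(1,2)] PMF_good_eq[OF assms(1,3)]
    using inj_on_image_Int[OF inj_proj_class[OF assms(1)], of "good_weights c \<inter> slice" "good_weights c' \<inter> slice"]
    by (simp add: Int_ac)
  have im: "proj_coords h d ` (PMF_good h d \<inter> PMF_good h d') = chord_coords c ` ?S"
    unfolding meet unfolding d_def by (rule proj_chart_image[OF assms(1)]) auto
  have inj: "inj_on (chord_coords c) (good_weights c)" by (rule chord_coords_inj[OF assms(2)])
  have S: "?S = \<Union> {?P \<sigma> |\<sigma>. unlinked \<sigma> \<and> \<sigma> \<inter> range c = {} \<and> \<sigma> \<inter> range c' = {}}" (is "_ = \<Union> ?D")
  proof
    show "?S \<subseteq> \<Union> ?D"
    proof
      fix w assume w: "w \<in> ?S"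
      then have "w \<in> ?P {v. w $ v \<noteq> 0}" "unlinked {v. w $ v \<noteq> 0}"
        "{v. w $ v \<noteq> 0} \<inter> range c = {}" "{v. w $ v \<noteq> 0} \<inter> range c' = {}"
        using cone_in_cell by (auto simp: good_weights_def slice_def)
      then show "w \<in> \<Union> ?D" by blast
    qed
    show "\<Union> ?D \<subseteq> ?S"
    proof (rule Union_least)
      fix D assume "D \<in> ?D"
      then obtain \<sigma> where \<sigma>: "D = ?P \<sigma>" "unlinked \<sigma>" "\<sigma> \<inter> range c = {}" "\<sigma> \<inter> range c' = {}" by blast
      then have "cell \<sigma> \<subseteq> good_weights c" "cell \<sigma> \<subseteq> good_weights c'"
        unfolding good_weights_cells by blast+
      then show "D \<subseteq> ?S" using \<sigma>(1) good_weights_subset[of c] by (auto simp: slice_def)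
    qed
  qed
  have poly: "polyhedron D" if "D \<in> ?D" for D using that polyhedron_cell_slice by auto
  have injD: "inj_on (chord_coords c) (\<Union> ?D)"
    unfolding S[symmetric] using inj by (rule inj_on_subset) auto
  show "polyhedral (proj_coords h d ` (PMF_good h d \<inter> PMF_good h d'))"
    unfolding im S by (rule polyhedral_injective_linear_image[OF finite_cells poly linear_chord_coords injD])
  show "piecewise_linear_on (proj_coords h d ` (PMF_good h d \<inter> PMF_good h d'))
       (proj_coords h d' \<circ> inv_into (PMF_good h d) (proj_coords h d))"
    unfolding im
  proof (rule piecewise_linear_transition[OF finite_cells poly injD linear_chord_coords linear_chord_coords])
    show "?S \<subseteq> \<Union> ?D" using S by simp
    fix w assume w: "w \<in> ?S"
    have co: "proj_coords h d (proj_class h w') = chord_coords c w'"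
      "proj_coords h d' (proj_class h w') = chord_coords c' w'" if "w' \<in> slice" for w'
      unfolding d_def d'_def using proj_coords_proj_class[OF assms(1) that] by auto
    have injp: "inj_on (proj_coords h d) (PMF_good h d)"
    proof (rule inj_onI)
      fix p q assume "p \<in> PMF_good h d" "q \<in> PMF_good h d" and eq: "proj_coords h d p = proj_coords h d q"
      then obtain u u' where u: "p = proj_class h u" "q = proj_class h u'" "u \<in> good_weights c" "u' \<in> good_weights c"
        "u \<in> slice" "u' \<in> slice"
        unfolding d_def PMF_good_eq[OF assms(1,2)] by auto
      then have "chord_coords c u = chord_coords c u'" using eq co by simp
      then show "p = q" using inj_onD[OF inj] u by auto
    qed
    have "proj_class h w \<in> PMF_good h d"
      unfolding d_def PMF_good_eq[OF assms(1,2)] using w by auto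
    then have "inv_into (PMF_good h d) (proj_coords h d) (chord_coords c w) = proj_class h w"
      using inv_into_f_f[OF injp] co(1) w by fastforce
    then show "(proj_coords h d' \<circ> inv_into (PMF_good h d) (proj_coords h d)) (chord_coords c w) = chord_coords c' w"
      using co(2) w by simp
  qed
qed

lemma continuous_chord_coords: "continuous_on S (chord_coords c)"
  unfolding chord_coords_def by (intro continuous_on_vec_lambda continuous_intros)

lemma closed_good_weights: "closed (good_weights c)"
proof -
  have "good_weights c = weight_cone \<inter> (\<Inter>j. {w. w $ c j = 0})" by (auto simp: good_weights_def)
  moreover have "closed (\<Inter>j. {w :: real ^ chord. w $ c j = 0})"
    by (intro closed_INT ballI closed_Collect_eq continuous_intros)
  ultimately show ?thesis using closed_Int[OF closed_weight_cone] by metis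
qed

lemma homeomorphism_homeomorphic_maps:
  "homeomorphism S T f g \<Longrightarrow> homeomorphic_maps (top_of_set S) (top_of_set T) f g"
  by (auto simp: homeomorphism_def homeomorphic_maps_def)

lemma second_countable_euclidean:
  "second_countable (euclidean :: 'b::second_countable_topology topology)"
proof -
  obtain B :: "'b set set" where B: "countable B" "topological_basis B"
    using ex_countable_basis by blast
  have "\<exists>V\<in>B. x \<in> V \<and> V \<subseteq> U" if "open U" "x \<in> U" for U x
    using topological_basisE[OF B(2) that] by metis
  then show ?thesis
    unfolding second_countable_def using B topological_basis_open[OF B(2)] by auto
qed

lemma proj_chart_homeomorphic:
  assumes "hexagon h" "chord_triple c"
  defines "d \<equiv> chord_class h \<circ> c"
  shows "homeomorphic_map (subtopology (PMF_topology h) (PMF_good h d))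
    (top_of_set (proj_coords h d ` PMF_good h d)) (proj_coords h d)"
proof -
  let ?S = "good_weights c \<inter> slice"
  have U: "PMF_good h d = proj_class h ` ?S" unfolding d_def by (rule PMF_good_eq[OF assms(1,2)])
  have im: "proj_coords h d ` PMF_good h d = chord_coords c ` ?S"
    unfolding U unfolding d_def by (rule proj_chart_image[OF assms(1)]) auto
  obtain r where r: "homeomorphic_maps (top_of_set slice) (PMF_topology h) (proj_class h) r"
    using homeomorphic_proj_class[OF assms(1)] by (auto simp: homeomorphic_map_maps)
  have r1: "r (proj_class h w) = w" if "w \<in> slice" for w
    using r that by (auto simp: homeomorphic_maps_def)
  have "homeomorphic_maps (subtopology (top_of_set slice) ?S) (subtopology (PMF_topology h) (PMF_good h d)) (proj_class h) r"
    by (rule homeomorphic_maps_subtopologies[OF r])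
      (auto simp: U topspace_PMF_topology PMF_eq[OF assms(1)])
  then have "homeomorphic_maps (top_of_set ?S) (subtopology (PMF_topology h) (PMF_good h d)) (proj_class h) r"
    by (simp add: subtopology_subtopology Int_absorb1 Int_commute)
  then have hr: "homeomorphic_map (subtopology (PMF_topology h) (PMF_good h d)) (top_of_set ?S) r"
    using homeomorphic_map_maps homeomorphic_maps_sym by blast
  have "compact ?S" using compact_slice closed_good_weights by (simp add: closed_Int_compact)
  moreover have "inj_on (chord_coords c) ?S"
    using chord_coords_inj[OF assms(2)] by (rule inj_on_subset) auto
  ultimately obtain g where "homeomorphism ?S (chord_coords c ` ?S) (chord_coords c) g"
    using homeomorphism_compact[OF _ continuous_chord_coords refl] by blast
  then have "homeomorphic_map (top_of_set ?S) (top_of_set (chord_coords c ` ?S)) (chord_coords c)"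
    using homeomorphism_homeomorphic_maps homeomorphic_map_maps by blast
  then have "homeomorphic_map (subtopology (PMF_topology h) (PMF_good h d)) (top_of_set (chord_coords c ` ?S)) (chord_coords c \<circ> r)"
    using homeomorphic_map_compose[OF hr] by blast
  then show ?thesis
    unfolding im
  proof (rule homeomorphic_map_eq)
    fix p assume "p \<in> topspace (subtopology (PMF_topology h) (PMF_good h d))"
    then obtain w where "p = proj_class h w" "w \<in> slice" unfolding U by auto
    then show "(chord_coords c \<circ> r) p = proj_coords h d p"
      using proj_coords_proj_class[OF assms(1)] r1 by (simp add: d_def)
  qed
qed

subsection \<open>Local charts in the plane\<close>

text \<open>The projection of the space along the diagonal, which is the direction of the chord at the centre
  of a chart.\<close>

definition diag_proj :: "real ^ 3 \<Rightarrow> real ^ 2" where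
  "diag_proj x = vector [x $ 1 - x $ 3, x $ 2 - x $ 3]"

lemma linear_diag_proj: "linear diag_proj"
  by (auto simp: linear_iff diag_proj_def vec_eq_iff forall_2 algebra_simps)

lemma diag_proj_eq_iff: "diag_proj x = diag_proj y \<longleftrightarrow> (\<exists>s. x = y + s *\<^sub>R 1)"
proof
  assume "diag_proj x = diag_proj y"
  then have "x $ 1 - x $ 3 = y $ 1 - y $ 3" "x $ 2 - x $ 3 = y $ 2 - y $ 3"
    by (simp_all add: diag_proj_def vec_eq_iff forall_2)
  then have "x = y + (x $ 3 - y $ 3) *\<^sub>R 1" by (simp add: vec_eq_iff forall_3)
  then show "\<exists>s. x = y + s *\<^sub>R 1" by blast
qed (auto simp: diag_proj_def)

definition star_slice :: "chord \<Rightarrow> (real ^ chord) set" where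
  "star_slice v = \<Union> {cell \<sigma> \<inter> {w. side_total w = 1} |\<sigma>. unlinked \<sigma> \<and> v \<in> \<sigma>}"

lemma star_slice_add:
  assumes "w \<in> star_slice v" "0 \<le> s" "\<And>j. linked v (c j)"
  shows "w + s *\<^sub>R axis v 1 \<in> good_weights c"
proof -
  obtain \<sigma> where \<sigma>: "w \<in> cell \<sigma>" "unlinked \<sigma>" "v \<in> \<sigma>" using assms(1) by (auto simp: star_slice_def)
  then have "w + s *\<^sub>R axis v 1 \<in> cell \<sigma>" using assms(2) by (auto simp: cell_def axis_def)
  moreover have "\<sigma> \<inter> range c = {}" using \<sigma> assms(3) by (auto simp: unlinked_def)
  ultimately show ?thesis using \<sigma>(2) unfolding good_weights_cells by blast
qed

lemma crossing_axis: "crossing (axis u 1) v = of_bool (linked u v)"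
proof -
  have "crossing (axis u 1) v = (\<Sum>x\<in>UNIV. if x = u then of_bool (linked u v) else 0)"
    unfolding crossing_def by (rule sum.cong) (auto simp: axis_def)
  then show ?thesis by simp
qed

lemma side_total_axis: "side_total (axis v 1) = 2"
  by (simp add: total_eq axis_def)

text \<open>If two weights in the closed star of \<open>v\<close> have the same projection, then one arises from the
  other by adding weight to \<open>v\<close>. The total is then changed, so it has to be the same weight.\<close>

lemma star_projection_inj:
  assumes "chord_triple c" and lk: "\<And>j. linked v (c j)"
  shows "inj_on (diag_proj \<circ> chord_coords c) (star_slice v)"
proof -
  have main: "w = w'" if w: "w \<in> star_slice v" "w' \<in> star_slice v"
    and eq: "chord_coords c w = chord_coords c w' + s *\<^sub>R 1" and s: "0 \<le> s" for w w' s
  proof -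
    have "chord_coords c (axis v 1) = 1" using lk by (simp add: chord_coords_def crossing_axis vec_eq_iff)
    then have "chord_coords c w = chord_coords c (w' + s *\<^sub>R axis v 1)"
      using eq linear_add[OF linear_chord_coords] linear_cmul[OF linear_chord_coords] by metis
    moreover have "w \<in> good_weights c" using star_slice_add[OF w(1), of 0 c] lk by simp
    moreover have "w' + s *\<^sub>R axis v 1 \<in> good_weights c" using star_slice_add[OF w(2) s] lk by blast
    ultimately have ww: "w = w' + s *\<^sub>R axis v 1"
      using chord_coords_inj[OF assms(1)] by (auto dest: inj_onD)
    have "side_total w = 1" "side_total w' = 1" using w by (auto simp: star_slice_def)
    then have "s = 0" unfolding ww by (simp add: side_total_axis)
    then show "w = w'" using ww by simp
  qed
  show ?thesis
  proof (rule inj_onI)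
    fix w w' assume w: "w \<in> star_slice v" "w' \<in> star_slice v"
      and "(diag_proj \<circ> chord_coords c) w = (diag_proj \<circ> chord_coords c) w'"
    then obtain s where s: "chord_coords c w = chord_coords c w' + s *\<^sub>R 1"
      by (auto simp: diag_proj_eq_iff)
    show "w = w'"
    proof (cases "0 \<le> s")
      case True
      then show ?thesis using main[OF w s] by simp
    next
      case False
      have "chord_coords c w' = chord_coords c w + (- s) *\<^sub>R 1" using s by simp
      then show ?thesis using main[OF w(2,1), of "- s"] False by simp
    qed
  qed
qed

lemma open_star_subset: "w \<in> slice \<Longrightarrow> 0 < w $ v \<Longrightarrow> w \<in> star_slice v"
proof -
  assume w: "w \<in> slice" "0 < w $ v"
  then have "w \<in> cell {v. w $ v \<noteq> 0} \<inter> {w. side_total w = 1}" "unlinked {v. w $ v \<noteq> 0}"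
    "v \<in> {v. w $ v \<noteq> 0}"
    using cone_in_cell[of w] by (auto simp: slice_def)
  then show "w \<in> star_slice v" unfolding star_slice_def by blast
qed

text \<open>The open star of \<open>v\<close> in the slice is an open subset of a sphere, so its injective continuous
  image in the plane is open by invariance of domain. The inverse is affine on each cell of the star.\<close>

lemma local_chart:
  assumes "hexagon h" "chord_triple c" and lk: "\<And>j. linked v (c j)"
  defines "d \<equiv> chord_class h \<circ> c" and "W \<equiv> proj_class h ` {w \<in> slice. 0 < w $ v}"
  shows "openin (PMF_topology h) W" "W \<subseteq> PMF_good h d"
    "open (diag_proj ` proj_coords h d ` W)"
    "pl_homeomorphism (proj_coords h d ` W) (diag_proj ` proj_coords h d ` W) diag_proj"
proof -
  let ?O = "{w \<in> slice. 0 < w $ v}" and ?L = "chord_coords c"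
  have "open {w :: real ^ chord. 0 < w $ v}" by (intro open_Collect_less continuous_intros)
  moreover have "?O = slice \<inter> {w. 0 < w $ v}" by auto
  ultimately have opO: "openin (top_of_set slice) ?O" by (metis openin_open_Int)
  show "openin (PMF_topology h) W"
    unfolding W_def using homeomorphic_imp_open_map[OF homeomorphic_proj_class[OF assms(1)]] opO
    by (simp add: open_map_def)
  have star: "?O \<subseteq> star_slice v" using open_star_subset by auto
  have good: "?O \<subseteq> good_weights c" using star star_slice_add[of _ v 0 c] lk by fastforce
  show "W \<subseteq> PMF_good h d"
    unfolding W_def d_def PMF_good_eq[OF assms(1,2)] using good by (intro image_mono) auto
  have im: "proj_coords h d ` W = ?L ` ?O"
    unfolding W_def d_def by (rule proj_chart_image[OF assms(1)]) auto
  have inj: "inj_on (diag_proj \<circ> ?L) (star_slice v)" by (rule star_projection_inj[OF assms(2) lk])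
  have injO: "inj_on (diag_proj \<circ> ?L) ?O" using inj star by (rule inj_on_subset)
  obtain \<theta> \<theta>' where \<theta>: "homeomorphism slice (sphere (0 :: real ^ 3) 1) \<theta> \<theta>'"
    by (rule slice_sphere)
  have \<theta>O: "\<theta>' ` \<theta> ` ?O = ?O"
  proof -
    have "\<theta>' (\<theta> w) = w" if "w \<in> ?O" for w using \<theta> that by (auto simp: homeomorphism_def)
    then show ?thesis by (simp add: image_image)
  qed
  have sub: "\<theta> ` ?O \<subseteq> sphere 0 1" using \<theta> by (auto simp: homeomorphism_def)
  have "openin (top_of_set (UNIV :: (real ^ 2) set)) (((diag_proj \<circ> ?L) \<circ> \<theta>') ` \<theta> ` ?O)"
  proof (rule invariance_of_domain_sphere_affine_set)
    show "openin (top_of_set (sphere 0 1)) (\<theta> ` ?O)"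
      using homeomorphism_imp_open_map[OF \<theta> opO] .
    show "continuous_on (\<theta> ` ?O) ((diag_proj \<circ> ?L) \<circ> \<theta>')"
    proof (intro continuous_on_compose)
      show "continuous_on (\<theta> ` ?O) \<theta>'" using \<theta> sub by (auto simp: homeomorphism_def intro: continuous_on_subset)
      show "continuous_on (\<theta>' ` \<theta> ` ?O) ?L" by (rule continuous_chord_coords)
      show "continuous_on (?L ` \<theta>' ` \<theta> ` ?O) diag_proj"
        using linear_diag_proj by (simp add: linear_continuous_on linear_conv_bounded_linear)
    qed
    show "inj_on ((diag_proj \<circ> ?L) \<circ> \<theta>') (\<theta> ` ?O)"
    proof (rule comp_inj_on)
      show "inj_on \<theta>' (\<theta> ` ?O)"
        using \<theta> sub by (auto simp: homeomorphism_def intro!: inj_on_inverseI[of _ \<theta>])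
      show "inj_on (diag_proj \<circ> ?L) (\<theta>' ` \<theta> ` ?O)" unfolding \<theta>O by (rule injO)
    qed
  qed auto
  moreover have "((diag_proj \<circ> ?L) \<circ> \<theta>') ` \<theta> ` ?O = diag_proj ` ?L ` ?O"
    by (simp only: image_comp[symmetric] \<theta>O)
  ultimately have "openin euclidean (diag_proj ` ?L ` ?O)" by (simp only: subtopology_UNIV)
  then show "open (diag_proj ` proj_coords h d ` W)"
    unfolding im by (rule open_openin[THEN iffD2])
  have bij: "bij_betw diag_proj (?L ` ?O) (diag_proj ` ?L ` ?O)"
    using injO by (simp add: bij_betw_def inj_on_imageI)
  have "piecewise_linear_on (?L ` ?O) diag_proj"
    unfolding piecewise_linear_on_def
    by (intro exI[of _ "{UNIV}"]) (auto intro!: exI[of _ diag_proj] exI[of _ 0] linear_diag_proj)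
  moreover have "piecewise_linear_on ((diag_proj \<circ> ?L) ` ?O) (inv_into (?L ` ?O) diag_proj)"
  proof (rule piecewise_linear_transition[OF finite_cells])
    show "polyhedron D" if "D \<in> {cell \<sigma> \<inter> {w. side_total w = 1} |\<sigma>. unlinked \<sigma> \<and> v \<in> \<sigma>}" for D
      using that polyhedron_cell_slice by auto
    show "inj_on (diag_proj \<circ> ?L) (\<Union> {cell \<sigma> \<inter> {w. side_total w = 1} |\<sigma>. unlinked \<sigma> \<and> v \<in> \<sigma>})"
      using inj unfolding star_slice_def .
    show "?O \<subseteq> \<Union> {cell \<sigma> \<inter> {w. side_total w = 1} |\<sigma>. unlinked \<sigma> \<and> v \<in> \<sigma>}"
      using star unfolding star_slice_def .
    show "linear (diag_proj \<circ> ?L)" by (rule linear_compose[OF linear_chord_coords linear_diag_proj])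
    show "linear ?L" by (rule linear_chord_coords)
    show "inv_into (?L ` ?O) diag_proj ((diag_proj \<circ> ?L) w) = ?L w" if "w \<in> ?O" for w
      using bij that by (auto simp: bij_betw_def intro!: inv_into_f_f)
  qed
  ultimately show "pl_homeomorphism (proj_coords h d ` W) (diag_proj ` proj_coords h d ` W) diag_proj"
    unfolding im pl_homeomorphism_def using bij by (simp add: image_comp)
qed

lemma opposite_chord_triple:
  obtains c where "chord_triple c" "\<And>j. linked v (c j)"
proof -
  obtain T where T: "card T = 3" "\<forall>u\<in>T. \<forall>v\<in>T. \<not> linked u v" "\<forall>u\<in>T. linked v u"
    using opposite_triple by blast
  have "finite T" using T(1) by (metis card.infinite zero_neq_numeral)
  then obtain c :: "3 \<Rightarrow> chord" where c: "bij_betw c UNIV T"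
    using finite_same_card_bij[of "UNIV :: 3 set" T] T(1) by auto
  have "chord_triple c" using c T(2) by (auto simp: chord_triple_def bij_betw_def unlinked_def)
  moreover have "linked v (c j)" for j using c T(3) by (auto simp: bij_betw_def)
  ultimately show thesis by (rule that)
qed

theorem mainTheorem1:
  fixes h :: "complex \<Rightarrow> 'a::topological_space"
  assumes "hexagon h"
  shows
    "(\<forall>d. arc_triple h d \<longrightarrow>
        coords d ` MF_good h d \<subseteq> {x. \<forall>j. 0 \<le> x $ j} - {0} \<and> inj_on (coords d) (MF_good h d)) \<and>
     (\<forall>d d'. arc_triple h d \<longrightarrow> arc_triple h d' \<longrightarrow>
        piecewise_linear_on (coords d ` (MF_good h d \<inter> MF_good h d'))
          (coords d' \<circ> inv_into (MF_good h d) (coords d))) \<and>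
     pl_manifold_atlas TYPE(real ^ 2) (PMF_topology h)
       {(PMF_good h d, proj_coords h d) | d. arc_triple h d} \<and>
     PMF_topology h homeomorphic_space top_of_set (sphere (0 :: real ^ 3) 1)"
proof (intro conjI allI impI)
  fix d assume "arc_triple h d"
  then obtain c where c: "chord_triple c" "d = chord_class h \<circ> c"
    using arc_triple_iff[OF assms] by blast
  show "coords d ` MF_good h d \<subseteq> {x. \<forall>j. 0 \<le> x $ j} - {0}" "inj_on (coords d) (MF_good h d)"
    using coords_image_inj[OF assms c(1)] unfolding c(2) by auto
next
  fix d d' assume "arc_triple h d" "arc_triple h d'"
  then obtain c c' where c: "chord_triple c" "d = chord_class h \<circ> c" "chord_triple c'" "d' = chord_class h \<circ> c'"
    using arc_triple_iff[OF assms] by blast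
  show "piecewise_linear_on (coords d ` (MF_good h d \<inter> MF_good h d'))
      (coords d' \<circ> inv_into (MF_good h d) (coords d))"
    using coords_transition[OF assms c(1,3)] unfolding c(2,4) .
next
  have hom: "top_of_set slice homeomorphic_space PMF_topology h"
    using homeomorphic_proj_class[OF assms] by (rule homeomorphic_map_imp_homeomorphic_space)
  obtain \<theta> \<theta>' where "homeomorphism slice (sphere (0 :: real ^ 3) 1) \<theta> \<theta>'"
    by (rule slice_sphere)
  then have "top_of_set slice homeomorphic_space top_of_set (sphere (0 :: real ^ 3) 1)"
    using homeomorphism_homeomorphic_maps homeomorphic_space_def by blast
  then show "PMF_topology h homeomorphic_space top_of_set (sphere (0 :: real ^ 3) 1)"
    using hom homeomorphic_space_sym homeomorphic_space_trans by blast
  let ?\<A> = "{(PMF_good h d, proj_coords h d) | d. arc_triple h d}"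
  have A: "(U, \<phi>) \<in> ?\<A> \<longleftrightarrow> (\<exists>c. chord_triple c \<and> U = PMF_good h (chord_class h \<circ> c) \<and>
      \<phi> = proj_coords h (chord_class h \<circ> c))" for U \<phi>
    using arc_triple_iff[OF assms] by auto
  show "pl_manifold_atlas TYPE(real ^ 2) (PMF_topology h) ?\<A>"
    unfolding pl_manifold_atlas_def
  proof (intro conjI)
    show "Hausdorff_space (PMF_topology h)"
      using homeomorphic_Hausdorff_space[OF hom] Hausdorff_space_subtopology[OF Hausdorff_space_euclidean] by blast
    show "second_countable (PMF_topology h)"
      using homeomorphic_space_second_countability[OF hom] second_countable_subtopology[OF second_countable_euclidean] by blast
    show "\<forall>(U, \<phi>)\<in>?\<A>. U \<subseteq> topspace (PMF_topology h) \<and> polyhedral (\<phi> ` U) \<and>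
        homeomorphic_map (subtopology (PMF_topology h) U) (top_of_set (\<phi> ` U)) \<phi>"
    proof clarify
      fix U and \<phi> :: "'a foliation set \<Rightarrow> real ^ 3" and d assume "arc_triple h d"
      then obtain c where c: "chord_triple c" "d = chord_class h \<circ> c"
        using arc_triple_iff[OF assms] by blast
      have "PMF_good h d \<subseteq> topspace (PMF_topology h)"
        unfolding c(2) PMF_good_eq[OF assms c(1)] topspace_PMF_topology PMF_eq[OF assms] by auto
      then show "PMF_good h d \<subseteq> topspace (PMF_topology h) \<and> polyhedral (proj_coords h d ` PMF_good h d) \<and>
          homeomorphic_map (subtopology (PMF_topology h) (PMF_good h d))
            (top_of_set (proj_coords h d ` PMF_good h d)) (proj_coords h d)"
        using proj_chart_polyhedral(1)[OF assms c(1,1)] proj_chart_homeomorphic[OF assms c(1)]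
        unfolding c(2) by simp
    qed
    show "\<forall>(U, \<phi>)\<in>?\<A>. \<forall>(V, \<psi>)\<in>?\<A>. polyhedral (\<phi> ` (U \<inter> V)) \<and>
        piecewise_linear_on (\<phi> ` (U \<inter> V)) (\<psi> \<circ> inv_into U \<phi>)"
    proof clarify
      fix d d' assume "arc_triple h d" "arc_triple h d'"
      then obtain c c' where c: "chord_triple c" "d = chord_class h \<circ> c" "chord_triple c'" "d' = chord_class h \<circ> c'"
        using arc_triple_iff[OF assms] by blast
      show "polyhedral (proj_coords h d ` (PMF_good h d \<inter> PMF_good h d')) \<and>
          piecewise_linear_on (proj_coords h d ` (PMF_good h d \<inter> PMF_good h d'))
            (proj_coords h d' \<circ> inv_into (PMF_good h d) (proj_coords h d))"
        using proj_chart_polyhedral[OF assms c(1,3)] unfolding c(2,4) by simp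
    qed
    show "\<forall>x\<in>topspace (PMF_topology h). \<exists>(U, \<phi>)\<in>?\<A>. \<exists>W. openin (PMF_topology h) W \<and> x \<in> W \<and> W \<subseteq> U \<and>
        (\<exists>(g :: real ^ 3 \<Rightarrow> real ^ 2) T. open T \<and> pl_homeomorphism (\<phi> ` W) T g)"
    proof
      fix x assume "x \<in> topspace (PMF_topology h)"
      then obtain w where w: "w \<in> slice" "x = proj_class h w"
        unfolding topspace_PMF_topology PMF_eq[OF assms] by auto
      obtain v where "w $ v \<noteq> 0" using slice_nonzero[OF w(1)] by (auto simp: vec_eq_iff)
      then have v: "0 < w $ v" using w weight_coneD(1)[of w v] by (auto simp: slice_def)
      obtain c where c: "chord_triple c" "\<And>j. linked v (c j)"
        using opposite_chord_triple by blast
      let ?d = "chord_class h \<circ> c" and ?W = "proj_class h ` {w \<in> slice. 0 < w $ v}"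
      have "(PMF_good h ?d, proj_coords h ?d) \<in> ?\<A>" using A c(1) by blast
      moreover have "x \<in> ?W" using w v by blast
      moreover note local_chart[OF assms c]
      ultimately show "\<exists>(U, \<phi>)\<in>?\<A>. \<exists>W. openin (PMF_topology h) W \<and> x \<in> W \<and> W \<subseteq> U \<and>
          (\<exists>(g :: real ^ 3 \<Rightarrow> real ^ 2) T. open T \<and> pl_homeomorphism (\<phi> ` W) T g)"
        by (intro bexI[of _ "(PMF_good h ?d, proj_coords h ?d)"] case_prodI exI[of _ ?W] conjI exI[of _ diag_proj]
            exI[of _ "diag_proj ` proj_coords h ?d ` ?W"]) auto
    qed
  qed
qed

end
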